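(* Let $M=\begin{pmatrix}1&-2\\1&0\end{pmatrix}$, $D=\{(0,0)^T,(1,0)^T\}$, let $G=\{\sum_{k\ge1}M^{-k}\Delta_k:\Delta_k\in D\}\subset\mathbb{R}^2$ be the Bear tile, and let Bear-3 $=B_2^G$ and Bear-4 $=B_3^G$. The subdivision algorithm constructed by Bear-3 converges in $C^2$, and the subdivision algorithm constructed by Bear-4 converges in $C^3$.
   Context: $B_n^G$ is the convolution of $n+1$ copies of the indicator $\chi_G$. It satisfies the refinement equation $\varphi(x)=\sum_{k\in\mathbb{Z}^2}c_k\varphi(Mx-k)$ with $c_{(j,0)}=2^{-n}\binom{n+1}{j}$ for $j=0,\dots,n+1$ and $c_k=0$ for all other $k\in\mathbb{Z}^2$. The subdivision algorithm constructed by $B_n^G$ is given by the operator $S:\ell_\infty(\mathbb{Z}^2)\to\ell_\infty(\mathbb{Z}^2)$, $[Su](k)=\sum_{j\in\mathbb{Z}^2}c_{k-Mj}u(j)$. For $r\ge0$ let $Q_r$ be the set of functions $h\in C^r(\mathbb{R}^2)$ such that $\widehat h(0)=1$ and $\widehat h$ has a zero of order at least $r+1$ at every point of $\mathbb{Z}^2\setminus\{0\}$, where $\widehat h(\xi)=\int h(x)e^{-2\pi i(x,\xi)}dx$. The algorithm converges in $C^r$ if for some $h\in Q_r$, for every $u\in\ell_\infty(\mathbb{Z}^2)$, there exists $f_u\in C^r(\mathbb{R}^2)$ such that $\big\|\sum_{k\in\mathbb{Z}^2}[S^qu](k)\,h(M^q\cdot-k)-f_u\big\|_{C^r(\mathbb{R}^2)}\to0$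 as $q\to\infty$. *)

theory Defs
  imports "HOL-Analysis.Analysis"
begin

definition bear_matrix :: "'a::ring_1 ^ 2 ^ 2" where
  "bear_matrix = vector [vector [1, - 2], vector [1, 0]]"

definition bear_digits :: "(real ^ 2) set" where
  "bear_digits = {vector [0, 0], vector [1, 0]}"

definition bear_tile :: "(real ^ 2) set" where
  "bear_tile = {x. \<exists>\<Delta> :: nat \<Rightarrow> real ^ 2. (\<forall>k\<ge>1. \<Delta> k \<in> bear_digits) \<and>
      (\<lambda>k. ((\<lambda>y. matrix_inv bear_matrix *v y) ^^ Suc k) (\<Delta> (Suc k))) sums x}"

definition convolution :: "(real ^ 2 \<Rightarrow> real) \<Rightarrow> (real ^ 2 \<Rightarrow> real) \<Rightarrow> real ^ 2 \<Rightarrow> real" where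
  "convolution f g x = (LINT y|lborel. f y * g (x - y))"

primrec tile_bspline :: "(real ^ 2) set \<Rightarrow> nat \<Rightarrow> real ^ 2 \<Rightarrow> real" where
  "tile_bspline G 0 = indicator G"
| "tile_bspline G (Suc n) = convolution (tile_bspline G n) (indicator G)"

text \<open>The name counts the convolution factors, the index of the B-spline is one less.\<close>

definition bear_3 :: "real ^ 2 \<Rightarrow> real" where
  "bear_3 = tile_bspline bear_tile 2"

definition bear_4 :: "real ^ 2 \<Rightarrow> real" where
  "bear_4 = tile_bspline bear_tile 3"

definition lattice_point :: "int ^ 2 \<Rightarrow> real ^ 2" where
  "lattice_point k = (\<chi> i. of_int (k $ i))"

definition bspline_mask :: "nat \<Rightarrow> int ^ 2 \<Rightarrow> real" where
  "bspline_mask n k =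
     (if k $ 2 = 0 \<and> 0 \<le> k $ 1 \<and> k $ 1 \<le> int (n + 1)
      then real ((n + 1) choose nat (k $ 1)) / 2 ^ n else 0)"

definition refinement_equation :: "(int ^ 2 \<Rightarrow> real) \<Rightarrow> (real ^ 2 \<Rightarrow> real) \<Rightarrow> bool" where
  "refinement_equation c \<phi> \<longleftrightarrow>
     (\<forall>x. \<phi> x = (\<Sum>\<^sub>\<infinity>k. c k * \<phi> (bear_matrix *v x - lattice_point k)))"

definition subdivision_operator ::
    "(int ^ 2 \<Rightarrow> real) \<Rightarrow> (int ^ 2 \<Rightarrow> real) \<Rightarrow> int ^ 2 \<Rightarrow> real" where
  "subdivision_operator c u k = (\<Sum>\<^sub>\<infinity>j. c (k - bear_matrix *v j) * u j)"

definition partial_derivative ::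
    "2 \<Rightarrow> (real ^ 2 \<Rightarrow> 'b::real_normed_vector) \<Rightarrow> real ^ 2 \<Rightarrow> 'b" where
  "partial_derivative i f x = frechet_derivative f (at x) (axis i 1)"

definition mixed_derivative ::
    "nat \<Rightarrow> nat \<Rightarrow> (real ^ 2 \<Rightarrow> 'b::real_normed_vector) \<Rightarrow> real ^ 2 \<Rightarrow> 'b" where
  "mixed_derivative a b f = (partial_derivative 1 ^^ a) ((partial_derivative 2 ^^ b) f)"

text \<open>Intended for open sets only, since the derivatives are taken in the whole plane.\<close>

primrec cont_diff_on :: "nat \<Rightarrow> (real ^ 2) set \<Rightarrow> (real ^ 2 \<Rightarrow> 'b::real_normed_vector) \<Rightarrow> bool" where
  "cont_diff_on 0 U f \<longleftrightarrow> continuous_on U f"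
| "cont_diff_on (Suc r) U f \<longleftrightarrow>
     (\<forall>x\<in>U. f differentiable (at x)) \<and> (\<forall>i. cont_diff_on r U (partial_derivative i f))"

text \<open>The normed space of functions whose derivatives up to order \<open>r\<close> are continuous and
  bounded; boundedness is what makes the suprema in the norm meaningful.\<close>

definition C_space :: "nat \<Rightarrow> (real ^ 2 \<Rightarrow> real) set" where
  "C_space r = {f. cont_diff_on r UNIV f \<and>
     (\<forall>a b. a + b \<le> r \<longrightarrow> bounded (range (mixed_derivative a b f)))}"

definition C_norm :: "nat \<Rightarrow> (real ^ 2 \<Rightarrow> real) \<Rightarrow> real" where
  "C_norm r f = (MAX (a, b)\<in>{(a, b). a + b \<le> r}. SUP x. \<bar>mixed_derivative a b f x\<bar>)"

definition fourier_transform :: "(real ^ 2 \<Rightarrow> real) \<Rightarrow> real ^ 2 \<Rightarrow> complex" where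
  "fourier_transform h \<xi> =
     (LINT x|lborel. of_real (h x) * exp (- 2 * of_real pi * \<i> * of_real (x \<bullet> \<xi>)))"

text \<open>A zero of order at least \<open>m + 1\<close>. The local smoothness keeps the derivatives
  from being evaluated where they do not exist.\<close>

definition zero_of_order_gt :: "nat \<Rightarrow> (real ^ 2 \<Rightarrow> complex) \<Rightarrow> real ^ 2 \<Rightarrow> bool" where
  "zero_of_order_gt m F z \<longleftrightarrow> (\<exists>U. open U \<and> z \<in> U \<and> cont_diff_on m U F) \<and>
     (\<forall>a b. a + b \<le> m \<longrightarrow> mixed_derivative a b F z = 0)"

text \<open>Integrability is what the integral defining the Fourier transform needs.\<close>

definition Q_space :: "nat \<Rightarrow> (real ^ 2 \<Rightarrow> real) set" where
  "Q_space r = {h \<in> C_space r. integrable lborel h \<and> fourier_transform h 0 = 1 \<and>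
     (\<forall>k. k \<noteq> 0 \<longrightarrow> zero_of_order_gt r (fourier_transform h) (lattice_point k))}"

definition shift_term ::
    "(real ^ 2 \<Rightarrow> real) \<Rightarrow> (int ^ 2 \<Rightarrow> real) \<Rightarrow> nat \<Rightarrow> real ^ 2 \<Rightarrow> int ^ 2 \<Rightarrow> real" where
  "shift_term h v q x k = v k * h (((\<lambda>y. bear_matrix *v y) ^^ q) x - lattice_point k)"

text \<open>Summability and membership in \<^term>\<open>C_space r\<close> are demanded explicitly because
  \<^const>\<open>infsum\<close> and \<^const>\<open>C_norm\<close> take arbitrary values otherwise.\<close>

definition subdivision_converges ::
    "nat \<Rightarrow> ((int ^ 2 \<Rightarrow> real) \<Rightarrow> int ^ 2 \<Rightarrow> real) \<Rightarrow> bool" where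
  "subdivision_converges r S \<longleftrightarrow>
     (\<exists>h\<in>Q_space r. \<forall>u. bounded (range u) \<longrightarrow>
        (\<exists>f\<in>C_space r.
           (\<forall>q x. shift_term h ((S ^^ q) u) q x summable_on UNIV) \<and>
           (\<forall>q. (\<lambda>x. \<Sum>\<^sub>\<infinity>k. shift_term h ((S ^^ q) u) q x k) \<in> C_space r) \<and>
           (\<lambda>q. C_norm r (\<lambda>x. (\<Sum>\<^sub>\<infinity>k. shift_term h ((S ^^ q) u) q x k) - f x))
             \<longlonglongrightarrow> 0))"

end

(*
  By the refinement equation the sums over [S^q u](k) h(M^q x - k) do not depend on q when h is
  the spline B_n itself, so the algorithm converges as soon as B_n, divided by its integral, lies
  in Q_n. The Fourier transform of B_n is the power n + 1 of that of the tile, which vanishes at the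
  nonzero lattice points. What remains is that B_2 is C^2 and B_3 is C^3. Differences of order
  n + 1 of B_n along the lattice M^(-q) Z^2 are controlled by the differences of S^q delta, and
  these contract at a rate below 2^(-n/2), which is shown with an explicit finite family of
  difference functionals mapped into itself by S. Hence the difference quotients of order
  at most n, taken in the rotating frames M^(-q) e_1, M^(-q+1) e_1, converge uniformly, and their
  limits are the derivatives of B_n.
*)
theory Submission
  imports Defs
begin

section \<open>The expansion and its lattices\<close>

text \<open>M satisfies M^2 = M - 2, with eigenvalues (1 +- i sqrt 7) / 2. It doubles a definite
  quadratic form, so all lengths at scale \<open>q\<close> are comparable with 2^(-q/2), but it
  turns the lattice frame by an angle incommensurable with pi. Quotients of consecutive levels are
  thus taken along different directions, and their comparison rests on the cancellation of
  first-order terms that M^2 = M - 2 provides. The threshold 2^(-n/2) has this origin: a difference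
  quotient of order m magnifies differences by about 2^(qm/2), and deducing bounds on differences of
  order m + 1 from those of order n + 1 costs another 2^(q(n-m)/2). The threshold is 1/2 for B_2 and
  0.3535... for B_3, while the rates obtained are 0.497 and 0.351, which leaves little room: besides
  e1 and M e1 the functionals use the directions e1 - M e1 and, for B_3, 2 e1 - M e1. The indicator
  of the tile satisfies its refinement equation only almost everywhere, by a comparison of measures;
  the first convolution turns this into an identity at every point.\<close>

definition bear :: "real ^ 2 \<Rightarrow> real ^ 2" where "bear x = vector [x $ 1 - 2 * x $ 2, x $ 1]"
definition unbear :: "real ^ 2 \<Rightarrow> real ^ 2" where "unbear x = vector [x $ 2, (x $ 2 - x $ 1) / 2]"

lemma vec2_eq_iff: "x = y \<longleftrightarrow> x $ 1 = y $ 1 \<and> x $ 2 = y $ 2" for x y :: "'a ^ 2"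
  by (simp add: vec_eq_iff forall_2)

lemma bear_nth [simp]: "bear x $ 1 = x $ 1 - 2 * x $ 2" "bear x $ 2 = x $ 1"
  by (simp_all add: bear_def)

lemma unbear_nth [simp]: "unbear x $ 1 = x $ 2" "unbear x $ 2 = (x $ 2 - x $ 1) / 2"
  by (simp_all add: unbear_def)

lemma bear_unbear [simp]: "bear (unbear x) = x" and unbear_bear [simp]: "unbear (bear x) = x"
  by (simp_all add: vec2_eq_iff field_simps)

text \<open>The norm form of the quadratic ring generated by the eigenvalue (1 + i sqrt 7) / 2 of M.
  For it M is a similarity of ratio sqrt 2, which gives sharp growth rates for all powers of M at
  once.\<close>

definition qform :: "real ^ 2 \<Rightarrow> real" where
  "qform x = (x $ 1)\<^sup>2 - x $ 1 * x $ 2 + 2 * (x $ 2)\<^sup>2"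

lemma qform_bear: "qform (bear x) = 2 * qform x"
  by (simp add: qform_def power2_eq_square algebra_simps)

lemma qform_unbear: "qform (unbear x) = qform x / 2"
  using qform_bear[of "unbear x"] by simp

lemma norm_sq2: "(norm x)\<^sup>2 = (x $ 1)\<^sup>2 + (x $ 2)\<^sup>2" for x :: "real ^ 2"
  by (simp add: norm_vec_def L2_set_def UNIV_2)

lemma norm_sq_le_qform: "(norm x)\<^sup>2 \<le> 2 * qform x"
proof -
  have "0 \<le> (x $ 1 - x $ 2)\<^sup>2 + 2 * (x $ 2)\<^sup>2" by simp
  then show ?thesis unfolding norm_sq2 qform_def by (simp add: power2_eq_square algebra_simps)
qed

lemma qform_le_norm_sq: "qform x \<le> 4 * (norm x)\<^sup>2"
proof -
  have "0 \<le> (x $ 1 + x $ 2)\<^sup>2 + 5 * (x $ 1)\<^sup>2 + 3 * (x $ 2)\<^sup>2" by simp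
  then show ?thesis unfolding norm_sq2 qform_def by (simp add: power2_eq_square algebra_simps)
qed

text \<open>\<open>fstep q\<close> and \<open>cstep q\<close> are M^(-q) e1 and M^(1-q) e1, the
  images of the lattice basis e1, M e1 at scale \<open>q\<close>. The coarse step of a level is the
  fine step of the level before it, which ties consecutive levels together.\<close>

definition fstep :: "nat \<Rightarrow> real ^ 2" where "fstep q = (unbear ^^ q) (vector [1, 0])"
definition cstep :: "nat \<Rightarrow> real ^ 2" where "cstep q = bear (fstep q)"

lemma fstep_0: "fstep 0 = vector [1, 0]" by (simp add: fstep_def)
lemma cstep_0: "cstep 0 = vector [1, 1]" by (simp add: cstep_def fstep_def vec2_eq_iff)
lemma fstep_Suc: "fstep (Suc q) = unbear (fstep q)" by (simp add: fstep_def)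
lemma cstep_Suc: "cstep (Suc q) = fstep q" by (simp add: cstep_def fstep_Suc)
text \<open>This is M^2 = M - 2 applied to M^(-q-1) e1.\<close>

lemma cstep_eq: "cstep q = cstep (Suc q) - 2 *\<^sub>R fstep (Suc q)"
  by (simp add: cstep_Suc) (simp add: fstep_Suc cstep_def vec2_eq_iff field_simps)

lemma qform_fstep: "qform (fstep q) = 1 / 2 ^ q"
proof (induction q)
  case 0
  show ?case by (simp add: fstep_0 qform_def)
next
  case (Suc q)
  then show ?case by (simp add: fstep_Suc qform_unbear)
qed

lemma qform_cstep: "qform (cstep q) = 2 / 2 ^ q"
  by (simp add: cstep_def qform_bear qform_fstep)

lemma sqrt2_power_sq: "(sqrt 2 ^ q)\<^sup>2 = 2 ^ q"
  by (metis power_mult power_mult mult.commute real_sqrt_pow2 zero_le_numeral)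

lemma norm_fstep_le: "norm (fstep q) \<le> 2 / sqrt 2 ^ q"
proof (rule power2_le_imp_le)
  show "(norm (fstep q))\<^sup>2 \<le> (2 / sqrt 2 ^ q)\<^sup>2"
    using norm_sq_le_qform[of "fstep q"] by (simp add: qform_fstep power_divide sqrt2_power_sq divide_simps)
qed simp

lemma norm_cstep_le: "norm (cstep q) \<le> 2 / sqrt 2 ^ q"
proof (rule power2_le_imp_le)
  show "(norm (cstep q))\<^sup>2 \<le> (2 / sqrt 2 ^ q)\<^sup>2"
    using norm_sq_le_qform[of "cstep q"] by (simp add: qform_cstep power_divide sqrt2_power_sq)
qed simp

lemma norm_fstep_ge: "1 / (2 * sqrt 2 ^ q) \<le> norm (fstep q)"
proof (rule power2_le_imp_le)
  show "(1 / (2 * sqrt 2 ^ q))\<^sup>2 \<le> (norm (fstep q))\<^sup>2"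
    using qform_le_norm_sq[of "fstep q"]
    by (simp add: qform_fstep power_divide power_mult_distrib sqrt2_power_sq field_simps)
qed simp

section \<open>Finite differences and translation-invariant difference operators\<close>

definition fdiff :: "real ^ 2 \<Rightarrow> (real ^ 2 \<Rightarrow> real) \<Rightarrow> real ^ 2 \<Rightarrow> real" where
  "fdiff v g x = g (x + v) - g x"

abbreviation fdiffs :: "(real ^ 2) list \<Rightarrow> (real ^ 2 \<Rightarrow> real) \<Rightarrow> real ^ 2 \<Rightarrow> real" where
  "fdiffs vs g \<equiv> foldr fdiff vs g"

text \<open>\<open>diff_op q m C T\<close> abstracts a linear combination of \<open>m\<close>-fold differences along the lattice
  generated by \<open>fstep q\<close> and \<open>cstep q\<close>, with coefficients of total size at most \<open>C\<close>.\<close>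

definition small_diffs :: "nat \<Rightarrow> nat \<Rightarrow> real \<Rightarrow> (real ^ 2 \<Rightarrow> real) \<Rightarrow> bool" where
  "small_diffs q m B g \<longleftrightarrow>
     (\<forall>vs. set vs \<subseteq> {fstep q, cstep q} \<longrightarrow> length vs = m \<longrightarrow> (\<forall>x. \<bar>fdiffs vs g x\<bar> \<le> B))"

definition diff_op :: "nat \<Rightarrow> nat \<Rightarrow> real \<Rightarrow> ((real ^ 2 \<Rightarrow> real) \<Rightarrow> real ^ 2 \<Rightarrow> real) \<Rightarrow> bool" where
  "diff_op q m C T \<longleftrightarrow> 0 \<le> C \<and>
     (\<forall>g h x. T (\<lambda>x. g x - h x) x = T g x - T h x) \<and>
     (\<forall>g v x. T (\<lambda>x. g (x + v)) x = T g (x + v)) \<and>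
     (\<forall>g B x. small_diffs q m B g \<longrightarrow> \<bar>T g x\<bar> \<le> C * B)"

lemma small_diffs_nonneg: "small_diffs q m B g \<Longrightarrow> 0 \<le> B"
  unfolding small_diffs_def
  by (drule spec[of _ "replicate m (fstep q)"]) (auto dest: order_trans[OF abs_ge_zero])

lemma small_diffs_fdiffs:
  assumes "small_diffs q (m + k) B g" "set vs \<subseteq> {fstep q, cstep q}" "length vs = m"
  shows "small_diffs q k B (fdiffs vs g)"
  unfolding small_diffs_def
proof (intro allI impI)
  fix us x assume "set us \<subseteq> {fstep q, cstep q}" "length us = k"
  then show "\<bar>fdiffs us (fdiffs vs g) x\<bar> \<le> B"
    using assms unfolding small_diffs_def by (auto simp flip: foldr_append dest!: spec[of _ "us @ vs"])
qed

lemma diff_op_mono: "diff_op q m C T \<Longrightarrow> C \<le> D \<Longrightarrow> diff_op q m D T"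
  unfolding diff_op_def by (meson mult_right_mono order_trans small_diffs_nonneg)

lemma diff_op_bound: "diff_op q m C T \<Longrightarrow> small_diffs q m B g \<Longrightarrow> \<bar>T g x\<bar> \<le> C * B"
  by (simp add: diff_op_def)

lemma diff_op_fdiff: "v \<in> {fstep q, cstep q} \<Longrightarrow> diff_op q 1 1 (fdiff v)"
  unfolding diff_op_def
proof (intro conjI allI impI)
  fix g B x assume "v \<in> {fstep q, cstep q}" "small_diffs q 1 B g"
  then show "\<bar>fdiff v g x\<bar> \<le> 1 * B"
    unfolding small_diffs_def by (auto dest!: spec[of _ "[v]"])
qed (simp_all add: fdiff_def algebra_simps)

lemma diff_op_shift: "diff_op q m C T \<Longrightarrow> diff_op q m C (\<lambda>g x. T g (x + w))"
  unfolding diff_op_def by (simp add: algebra_simps)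

lemma diff_opI:
  assumes "0 \<le> C" "\<And>g h x. T (\<lambda>x. g x - h x) x = T g x - T h x"
    "\<And>g v x. T (\<lambda>x. g (x + v)) x = T g (x + v)"
    "\<And>g B x. small_diffs q m B g \<Longrightarrow> \<bar>T g x\<bar> \<le> C * B"
  shows "diff_op q m C T"
  using assms by (simp add: diff_op_def)

lemma diff_opD:
  assumes "diff_op q m C T"
  shows "0 \<le> C" "T (\<lambda>x. g x - h x) x = T g x - T h x" "T (\<lambda>x. g (x + v)) x = T g (x + v)"
  using assms by (simp_all add: diff_op_def)

lemma diff_op_scale:
  assumes "diff_op q m C T" shows "diff_op q m (\<bar>c\<bar> * C) (\<lambda>g x. c * T g x)"
proof (rule diff_opI)
  fix g B x assume "small_diffs q m B g"
  then show "\<bar>c * T g x\<bar> \<le> \<bar>c\<bar> * C * B"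
    using diff_op_bound[OF assms] by (simp add: abs_mult mult_left_mono mult.assoc)
qed (use diff_opD[OF assms] in \<open>simp_all add: right_diff_distrib\<close>)

lemma diff_op_add:
  assumes "diff_op q m C T" "diff_op q m D S" shows "diff_op q m (C + D) (\<lambda>g x. T g x + S g x)"
proof (rule diff_opI)
  fix g B x assume "small_diffs q m B g"
  then show "\<bar>T g x + S g x\<bar> \<le> (C + D) * B"
    using diff_op_bound[OF assms(1), of B g x] diff_op_bound[OF assms(2), of B g x]
    by (simp add: distrib_right)
qed (use diff_opD[OF assms(1)] diff_opD[OF assms(2)] in simp_all)

lemma diff_op_fdiffs_commute:
  assumes "diff_op q m C T"
  shows "fdiffs vs (T g) = T (fdiffs vs g)"
proof (induction vs)
  case (Cons v vs)
  have "fdiff v (T h) = T (fdiff v h)" for h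
    using assms unfolding diff_op_def by (auto simp: fdiff_def[abs_def] fun_eq_iff)
  with Cons show ?case by simp
qed simp

text \<open>Since \<open>S\<close> commutes with differences, the \<open>m\<close>-fold differences
  of \<open>S g\<close> are \<open>S\<close> applied to \<open>m\<close>-fold differences of
  \<open>g\<close>, which in turn have small \<open>k\<close>-fold differences. So orders add and
  constants multiply.\<close>

lemma diff_op_comp:
  assumes T: "diff_op q m C T" and S: "diff_op q k D S"
  shows "diff_op q (m + k) (C * D) (\<lambda>g. T (S g))"
  unfolding diff_op_def
proof (intro conjI allI impI)
  show "0 \<le> C * D" using T S by (simp add: diff_op_def)
  show "T (S (\<lambda>x. g x - h x)) x = T (S g) x - T (S h) x" for g h x
  proof -
    have "S (\<lambda>x. g x - h x) = (\<lambda>x. S g x - S h x)" using S by (simp add: diff_op_def fun_eq_iff)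
    then show ?thesis using T by (simp add: diff_op_def)
  qed
  show "T (S (\<lambda>x. g (x + v))) x = T (S g) (x + v)" for g v x
  proof -
    have "S (\<lambda>x. g (x + v)) = (\<lambda>x. S g (x + v))" using S by (simp add: diff_op_def fun_eq_iff)
    then show ?thesis using T by (simp add: diff_op_def)
  qed
  fix g B x assume g: "small_diffs q (m + k) B g"
  have "small_diffs q m (D * B) (S g)"
    unfolding small_diffs_def
  proof (intro allI impI)
    fix vs y assume "set vs \<subseteq> {fstep q, cstep q}" "length vs = m"
    then have "small_diffs q k B (fdiffs vs g)" using g by (rule small_diffs_fdiffs[rotated])
    then show "\<bar>fdiffs vs (S g) y\<bar> \<le> D * B"
      using diff_op_bound[OF S] by (simp add: diff_op_fdiffs_commute[OF S])
  qed
  then show "\<bar>T (S g) x\<bar> \<le> C * D * B"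
    using diff_op_bound[OF T] by (simp add: mult.assoc)
qed

text \<open>The \<open>i\<close>-th unit vector is \<open>fine_coord i q *\<^sub>R fstep q + coarse_coord i q *\<^sub>R cstep q\<close>, so
  \<open>pdiff i q\<close> below approximates the \<open>i\<close>-th partial derivative on the lattice of scale \<open>q\<close>.\<close>

fun fine_coord :: "2 \<Rightarrow> nat \<Rightarrow> int" and coarse_coord :: "2 \<Rightarrow> nat \<Rightarrow> int" where
  "fine_coord i 0 = (if i = 1 then 1 else - 1)"
| "coarse_coord i 0 = (if i = 1 then 0 else 1)"
| "fine_coord i (Suc q) = - 2 * coarse_coord i q"
| "coarse_coord i (Suc q) = fine_coord i q + coarse_coord i q"

text \<open>The form on the left is dual to \<open>qform\<close> and doubles exactly under the
  recursion; its starting values are 1 for the first unit vector and 2 for the second.\<close>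

lemma coord_form: "(fine_coord i q)\<^sup>2 + fine_coord i q * coarse_coord i q + 2 * (coarse_coord i q)\<^sup>2 \<le> 2 * 2 ^ q"
  by (induction q) (auto simp: power2_eq_square algebra_simps)

lemma coord_bound: "\<bar>real_of_int (fine_coord i q)\<bar> \<le> 2 * sqrt 2 ^ q" "\<bar>real_of_int (coarse_coord i q)\<bar> \<le> 2 * sqrt 2 ^ q"
proof -
  define a b where "a = real_of_int (fine_coord i q)" and "b = real_of_int (coarse_coord i q)"
  have "real_of_int ((fine_coord i q)\<^sup>2 + fine_coord i q * coarse_coord i q + 2 * (coarse_coord i q)\<^sup>2) \<le> real_of_int (2 * 2 ^ q)"
    by (subst of_int_le_iff) (rule coord_form)
  then have *: "a\<^sup>2 + a * b + 2 * b\<^sup>2 \<le> 2 * 2 ^ q" by (simp add: a_def b_def)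
  \<comment> \<open>Completing squares: eight times the form is 7 a^2 + (a + 4 b)^2, and four times
    the form is 7 b^2 + (2 a + b)^2.\<close>
  have "(a + 4 * b)\<^sup>2 = a\<^sup>2 + 8 * (a * b) + 16 * b\<^sup>2"
    "(2 * a + b)\<^sup>2 = 4 * a\<^sup>2 + 4 * (a * b) + b\<^sup>2"
    by (simp_all add: power2_eq_square algebra_simps)
  moreover have "0 \<le> (a + 4 * b)\<^sup>2" "0 \<le> (2 * a + b)\<^sup>2" "(0::real) \<le> 2 ^ q"
    by simp_all
  ultimately have "a\<^sup>2 \<le> 4 * 2 ^ q" "b\<^sup>2 \<le> 4 * 2 ^ q"
    using * by linarith+
  then have "\<bar>a\<bar>\<^sup>2 \<le> (2 * sqrt 2 ^ q)\<^sup>2" "\<bar>b\<bar>\<^sup>2 \<le> (2 * sqrt 2 ^ q)\<^sup>2"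
    by (simp_all add: power_mult_distrib sqrt2_power_sq)
  then show "\<bar>real_of_int (fine_coord i q)\<bar> \<le> 2 * sqrt 2 ^ q" "\<bar>real_of_int (coarse_coord i q)\<bar> \<le> 2 * sqrt 2 ^ q"
    unfolding a_def b_def by (auto intro: power2_le_imp_le)
qed

text \<open>The matrix of integer coordinates is inverse to the matrix of the frame. From M^(-1) =
  (1 - M) / 2 the fine step becomes half of \<open>fstep q - cstep q\<close>, and the recursion of
  the coordinates is dual to this move of the frame.\<close>

lemma coord_dual:
  "fstep q $ 1 * fine_coord 1 q + fstep q $ 2 * fine_coord 2 q = 1"
  "fstep q $ 1 * coarse_coord 1 q + fstep q $ 2 * coarse_coord 2 q = 0"
  "cstep q $ 1 * fine_coord 1 q + cstep q $ 2 * fine_coord 2 q = 0"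
  "cstep q $ 1 * coarse_coord 1 q + cstep q $ 2 * coarse_coord 2 q = 1"
proof (induction q)
  case (Suc q)
  have e: "fstep (Suc q) = (1/2) *\<^sub>R (fstep q - cstep q)" "cstep (Suc q) = fstep q"
    by (simp_all add: cstep_Suc) (simp add: vec2_eq_iff fstep_Suc cstep_def field_simps)
  case 1 show ?case using Suc by (simp add: e algebra_simps)
  case 2 show ?case using Suc by (simp add: e algebra_simps)
  case 3 show ?case using Suc by (simp add: e algebra_simps)
  case 4 show ?case using Suc by (simp add: e algebra_simps)
qed (simp_all add: fstep_0 cstep_0)

lemma axis_coords: "h = (h $ 1 * fine_coord 1 q + h $ 2 * fine_coord 2 q) *\<^sub>R fstep q + (h $ 1 * coarse_coord 1 q + h $ 2 * coarse_coord 2 q) *\<^sub>R cstep q"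
proof (induction q)
  case 0
  then show ?case by (simp add: fstep_0 cstep_0 vec2_eq_iff)
next
  case (Suc q)
  have e: "fstep q = cstep (Suc q)" "cstep q = cstep (Suc q) - 2 *\<^sub>R fstep (Suc q)" by (simp add: cstep_Suc) (rule cstep_eq)
  show ?case by (subst Suc) (simp add: e(2), simp add: e(1) algebra_simps)
qed

definition pdiff :: "2 \<Rightarrow> nat \<Rightarrow> (real ^ 2 \<Rightarrow> real) \<Rightarrow> real ^ 2 \<Rightarrow> real" where
  "pdiff i q g x = fine_coord i q * fdiff (fstep q) g x + coarse_coord i q * fdiff (cstep q) g x"

abbreviation "pdiffs w q g \<equiv> foldr (\<lambda>i. pdiff i q) w g"

text \<open>Inverts the definition of \<open>pdiff\<close>: a difference along a frame vector is the
  inner product of that vector with an approximate gradient. The path estimates use it in this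
  form.\<close>

lemma pdiff_dual:
  "fdiff (fstep q) g x = fstep q $ 1 * pdiff 1 q g x + fstep q $ 2 * pdiff 2 q g x"
  "fdiff (cstep q) g x = cstep q $ 1 * pdiff 1 q g x + cstep q $ 2 * pdiff 2 q g x"
proof -
  have "fstep q $ 1 * pdiff 1 q g x + fstep q $ 2 * pdiff 2 q g x
    = (fstep q $ 1 * fine_coord 1 q + fstep q $ 2 * fine_coord 2 q) * fdiff (fstep q) g x + (fstep q $ 1 * coarse_coord 1 q + fstep q $ 2 * coarse_coord 2 q) * fdiff (cstep q) g x"
    by (simp add: pdiff_def algebra_simps)
  then show "fdiff (fstep q) g x = fstep q $ 1 * pdiff 1 q g x + fstep q $ 2 * pdiff 2 q g x"
    by (simp add: coord_dual)
  have "cstep q $ 1 * pdiff 1 q g x + cstep q $ 2 * pdiff 2 q g x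
    = (cstep q $ 1 * fine_coord 1 q + cstep q $ 2 * fine_coord 2 q) * fdiff (fstep q) g x + (cstep q $ 1 * coarse_coord 1 q + cstep q $ 2 * coarse_coord 2 q) * fdiff (cstep q) g x"
    by (simp add: pdiff_def algebra_simps)
  then show "fdiff (cstep q) g x = cstep q $ 1 * pdiff 1 q g x + cstep q $ 2 * pdiff 2 q g x"
    by (simp add: coord_dual)
qed

lemma diff_op_pdiff: "diff_op q 1 (4 * sqrt 2 ^ q) (pdiff i q)"
proof -
  have "diff_op q 1 (\<bar>real_of_int (fine_coord i q)\<bar> * 1 + \<bar>real_of_int (coarse_coord i q)\<bar> * 1) (pdiff i q)"
    unfolding pdiff_def[abs_def] by (intro diff_op_add diff_op_scale diff_op_fdiff) simp_all
  then show ?thesis by (rule diff_op_mono) (use coord_bound[of i q] in linarith)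
qed

lemma diff_op_pdiff_Suc: "diff_op (Suc q) 1 (10 * sqrt 2 ^ q) (pdiff i (Suc q))"
proof -
  have "sqrt 2 \<le> 2" by (rule real_le_lsqrt) simp_all
  then have "4 * sqrt 2 ^ Suc q \<le> 10 * sqrt 2 ^ q" by simp
  then show ?thesis by (rule diff_op_mono[OF diff_op_pdiff])
qed

text \<open>A coarse difference is telescoped through the finer lattice: \<open>fstep q\<close> is
  \<open>cstep (Suc q)\<close>, and \<open>cstep q\<close> is one step along
  \<open>cstep (Suc q)\<close> followed by two steps back along \<open>fstep (Suc q)\<close>. The
  cost is 2 + 2 * 3 = 8; the constant 10 is the one that the comparison of two levels
  requires.\<close>

lemma diff_op_pdiff_coarse: "diff_op (Suc q) 1 (10 * sqrt 2 ^ q) (pdiff i q)"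
proof -
  let ?p = "fstep (Suc q)" and ?r = "cstep (Suc q)"
  have eq: "pdiff i q = (\<lambda>g x. fine_coord i q * fdiff ?r g x + coarse_coord i q * (fdiff ?r g (x + (- 2 *\<^sub>R ?p))
      + (- 1) * (fdiff ?p g (x + (- 2 *\<^sub>R ?p)) + fdiff ?p g (x + (- ?p)))))"
    unfolding fun_eq_iff pdiff_def cstep_eq[of q] by (auto simp: fdiff_def cstep_Suc algebra_simps scaleR_2)
  have "diff_op (Suc q) 1 (\<bar>real_of_int (fine_coord i q)\<bar> * 1 + \<bar>real_of_int (coarse_coord i q)\<bar> * (1 + \<bar>- 1\<bar> * (1 + 1))) (pdiff i q)"
    unfolding eq by (intro diff_op_add diff_op_scale diff_op_shift diff_op_fdiff) simp_all
  then show ?thesis by (rule diff_op_mono) (use coord_bound[of i q] in simp)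
qed

text \<open>Successive approximations of a partial derivative differ by second differences only, because
  \<open>cstep q = cstep (Suc q) - 2 *\<^sub>R fstep (Suc q)\<close> makes the first-order parts cancel.\<close>

lemma diff_op_pdiff_diff: "diff_op (Suc q) 2 (10 * sqrt 2 ^ q) (\<lambda>g x. pdiff i (Suc q) g x - pdiff i q g x)"
proof -
  let ?p = "fstep (Suc q)" and ?r = "cstep (Suc q)"
  have eq: "(\<lambda>g x. pdiff i (Suc q) g x - pdiff i q g x) = (\<lambda>g x. coarse_coord i q *
     ((fdiff ?p (fdiff ?r g) (x + (- 2 *\<^sub>R ?p)) + fdiff ?p (fdiff ?r g) (x + (- ?p))) +
     (- 1) * (fdiff ?p (fdiff ?p g) (x + (- 2 *\<^sub>R ?p)) + (fdiff ?p (fdiff ?p g) (x + (- ?p)) + fdiff ?p (fdiff ?p g) (x + (- ?p))))))"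
    unfolding fun_eq_iff pdiff_def cstep_eq[of q] by (auto simp: fdiff_def cstep_Suc algebra_simps scaleR_2)
  have two: "diff_op (Suc q) 2 1 (\<lambda>g. fdiff u (fdiff v g))" if "u \<in> {?p, ?r}" "v \<in> {?p, ?r}" for u v
    using diff_op_comp[OF diff_op_fdiff[OF that(1)] diff_op_fdiff[OF that(2)]] by (simp add: numeral_2_eq_2)
  \<comment> \<open>Five second differences, each with coefficient at most 2 *
    \<open>sqrt 2 ^ q\<close>, give the constant 10.\<close>
  have "diff_op (Suc q) 2 (\<bar>real_of_int (coarse_coord i q)\<bar> * ((1 + 1) + \<bar>- 1\<bar> * (1 + (1 + 1)))) (\<lambda>g x. pdiff i (Suc q) g x - pdiff i q g x)"
    unfolding eq by (intro diff_op_add diff_op_scale diff_op_shift two) simp_all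
  then show ?thesis by (rule diff_op_mono) (use coord_bound[of i q] in simp)
qed

section \<open>Iterated difference quotients and their increments between levels\<close>

lemma sqrt2_power_ge_1: "1 \<le> sqrt 2 ^ q"
  by (simp add: one_le_power)

lemma diff_op_id: "diff_op q 0 1 (\<lambda>g. g)"
proof (rule diff_opI)
  fix g B x assume "small_diffs q 0 B g"
  then show "\<bar>g x\<bar> \<le> 1 * B"
    unfolding small_diffs_def by (auto dest!: spec[of _ "[]"])
qed simp_all

lemma diff_op_pdiffs:
  assumes "\<And>i. diff_op p 1 c (pdiff i q)"
  shows "diff_op p (length w) (c ^ length w) (pdiffs w q)"
proof (induction w)
  case Nil
  show ?case using diff_op_id by simp
next
  case (Cons i w)
  have "diff_op p (1 + length w) (c * c ^ length w) (\<lambda>g. pdiff i q (pdiffs w q g))"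
    by (rule diff_op_comp[OF assms Cons])
  then show ?case by simp
qed

text \<open>The factors of the product are moved from level \<open>q\<close> to level
  \<open>Suc q\<close> one at a time. The factor being moved contributes a second difference instead
  of a first, so each of the \<open>length w\<close> terms has one order more than the quotient
  itself.\<close>

lemma diff_op_pdiffs_diff:
  "diff_op (Suc q) (Suc (length w)) (length w * (10 * sqrt 2 ^ q) ^ length w)
     (\<lambda>g x. pdiffs w (Suc q) g x - pdiffs w q g x)"
proof (induction w)
  case Nil
  show ?case by (rule diff_opI) simp_all
next
  case (Cons i w)
  let ?c = "10 * sqrt 2 ^ q" and ?n = "length w"
  have "(\<lambda>g x. pdiffs (i # w) (Suc q) g x - pdiffs (i # w) q g x) =
      (\<lambda>g x. pdiff i (Suc q) (\<lambda>x. pdiffs w (Suc q) g x - pdiffs w q g x) x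
        + (pdiff i (Suc q) (pdiffs w q g) x - pdiff i q (pdiffs w q g) x))"
    by (simp add: fun_eq_iff diff_opD(2)[OF diff_op_pdiff])
  moreover have "diff_op (Suc q) (1 + Suc ?n) (?c * (?n * ?c ^ ?n))
      (\<lambda>g. pdiff i (Suc q) (\<lambda>x. pdiffs w (Suc q) g x - pdiffs w q g x))"
    by (rule diff_op_comp[OF diff_op_pdiff_Suc Cons])
  moreover have "diff_op (Suc q) (2 + ?n) (?c * ?c ^ ?n)
      (\<lambda>g x. pdiff i (Suc q) (pdiffs w q g) x - pdiff i q (pdiffs w q g) x)"
    by (rule diff_op_comp[OF diff_op_pdiff_diff diff_op_pdiffs[OF diff_op_pdiff_coarse]])
  ultimately have "diff_op (Suc q) (Suc (length (i # w))) (?c * (?n * ?c ^ ?n) + ?c * ?c ^ ?n)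
      (\<lambda>g x. pdiffs (i # w) (Suc q) g x - pdiffs (i # w) q g x)"
    using diff_op_add by simp
  then show ?case by (simp add: algebra_simps)
qed

section \<open>Supports and descent to lower-order differences\<close>

lemma norm_step_le_2: "v \<in> {fstep q, cstep q} \<Longrightarrow> norm v \<le> 2"
proof -
  assume "v \<in> {fstep q, cstep q}"
  then have "norm v \<le> 2 / sqrt 2 ^ q" using norm_fstep_le norm_cstep_le by auto
  also have "\<dots> \<le> 2" using sqrt2_power_ge_1[of q] by (simp add: divide_simps)
  finally show ?thesis .
qed

text \<open>Frame vectors have length at most 2 at every level, so the support grows by a radius
  that does not depend on \<open>q\<close>.\<close>

lemma fdiffs_support:
  assumes "\<And>x. R < norm x \<Longrightarrow> f x = 0" "set vs \<subseteq> {fstep q, cstep q}" "R + 2 * length vs < norm x"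
  shows "fdiffs vs f x = 0"
  using assms(2,3)
proof (induction vs arbitrary: x)
  case Nil
  then show ?case using assms(1) by simp
next
  case (Cons v vs)
  have "norm x \<le> norm (x + v) + norm v"
    using norm_triangle_ineq4[of "x + v" v] by simp
  moreover have "norm v \<le> 2" using Cons.prems by (intro norm_step_le_2[of v q]) simp
  ultimately have "fdiffs vs f (x + v) = 0" "fdiffs vs f x = 0"
    using Cons.prems by (auto intro!: Cons.IH)
  then show ?case by (simp add: fdiff_def[of _ "fdiffs vs f" x])
qed

lemma pdiffs_support:
  assumes "\<And>x. R < norm x \<Longrightarrow> f x = 0" "R + 2 * length w < norm x"
  shows "pdiffs w q f x = 0"
  using assms(2)
proof (induction w arbitrary: x)
  case Nil
  then show ?case using assms(1) by simp
next
  case (Cons i w)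
  have "norm x \<le> norm (x + v) + norm v" for v
    using norm_triangle_ineq4[of "x + v" v] by simp
  from this[of "fstep q"] this[of "cstep q"]
  have "pdiffs w q f (x + fstep q) = 0" "pdiffs w q f (x + cstep q) = 0" "pdiffs w q f x = 0"
    using Cons.prems norm_step_le_2[of "fstep q" q] norm_step_le_2[of "cstep q" q]
    by (auto intro!: Cons.IH)
  then show ?case by (simp add: pdiff_def[of i q "pdiffs w q f" x] fdiff_def[of _ "pdiffs w q f" x])
qed

text \<open>Lower-order differences are recovered by summing along \<open>fstep q\<close> until the support is left,
  which takes of the order of \<open>sqrt 2 ^ q\<close> steps.\<close>

lemma small_diffs_descend:
  assumes small_diffs: "small_diffs q (Suc m) B f" and supp: "\<And>x. R < norm x \<Longrightarrow> f x = 0" and "0 \<le> R"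
  shows "small_diffs q m ((4 * (R + 2 * m) + 2) * sqrt 2 ^ q * B) f"
  unfolding small_diffs_def
proof (intro allI impI)
  fix vs x assume vs: "set vs \<subseteq> {fstep q, cstep q}" "length vs = m"
  define g where "g = fdiffs vs f"
  define R' where "R' = R + 2 * m"
  \<comment> \<open>As \<open>fstep q\<close> has length at least 1 / (2 *
    \<open>sqrt 2 ^ q\<close>), more than 4 R' * \<open>sqrt 2 ^ q\<close> steps cover a distance
    above the diameter 2 R' of the ball outside which \<open>g\<close> vanishes.\<close>
  define N where "N = nat \<lceil>4 * R' * sqrt 2 ^ q\<rceil> + 1"
  have R': "0 \<le> R'" using \<open>0 \<le> R\<close> by (simp add: R'_def)
  have B: "0 \<le> B" using small_diffs by (rule small_diffs_nonneg)
  have g0: "g y = 0" if "R' < norm y" for y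
    unfolding g_def by (rule fdiffs_support[OF supp]) (use vs that in \<open>auto simp: R'_def\<close>)
  have step: "\<bar>g (y + fstep q) - g y\<bar> \<le> B" for y
    using small_diffs vs unfolding small_diffs_def g_def
    by (auto simp: fdiff_def dest!: spec[of _ "fstep q # vs"])
  have N: "4 * R' * sqrt 2 ^ q < N" "N \<le> (4 * R' + 2) * sqrt 2 ^ q"
  proof -
    have "0 \<le> 4 * R' * sqrt 2 ^ q" using R' by simp
    then have "real N = of_int \<lceil>4 * R' * sqrt 2 ^ q\<rceil> + 1" by (simp add: N_def)
    then show "4 * R' * sqrt 2 ^ q < N" "N \<le> (4 * R' + 2) * sqrt 2 ^ q"
      using sqrt2_power_ge_1[of q] unfolding distrib_right by linarith+
  qed
  have "\<bar>g x\<bar> \<le> N * B"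
  proof (cases "R' < norm x")
    case True
    then show ?thesis using g0 B by simp
  next
    case False
    have "\<bar>g (x + real k *\<^sub>R fstep q) - g x\<bar> \<le> k * B" for k
    proof (induction k)
      case (Suc k)
      have "x + real (Suc k) *\<^sub>R fstep q = (x + real k *\<^sub>R fstep q) + fstep q"
        by (simp add: algebra_simps)
      then show ?case using Suc step[of "x + real k *\<^sub>R fstep q"] by (simp add: algebra_simps)
    qed simp
    moreover have "2 * R' < real N * norm (fstep q)"
    proof -
      have "2 * R' = 4 * R' * sqrt 2 ^ q * (1 / (2 * sqrt 2 ^ q))" by simp
      also have "\<dots> < N * (1 / (2 * sqrt 2 ^ q))"
        using N(1) by (intro mult_strict_right_mono) simp_all
      also have "\<dots> \<le> N * norm (fstep q)"
        by (intro mult_left_mono norm_fstep_ge) simp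
      finally show ?thesis .
    qed
    then have "R' < norm (x + real N *\<^sub>R fstep q)"
      using False norm_triangle_ineq4[of "x + real N *\<^sub>R fstep q" x] by simp
    ultimately show ?thesis using g0 by (metis abs_minus_cancel diff_0)
  qed
  also have "\<dots> \<le> (4 * R' + 2) * sqrt 2 ^ q * B"
    using N(2) B by (rule mult_right_mono)
  finally show "\<bar>fdiffs vs f x\<bar> \<le> (4 * (R + 2 * m) + 2) * sqrt 2 ^ q * B"
    by (simp add: g_def R'_def)
qed

lemma small_diffs_mono: "small_diffs q m B f \<Longrightarrow> B \<le> B' \<Longrightarrow> small_diffs q m B' f"
  unfolding small_diffs_def using order_trans by blast

lemma small_diffs_descend_iter:
  assumes "small_diffs q r B f" "\<And>x. R < norm x \<Longrightarrow> f x = 0" "0 \<le> R" "j \<le> r"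
  shows "small_diffs q (r - j) (((4 * (R + 2 * r) + 2) * sqrt 2 ^ q) ^ j * B) f"
  using \<open>j \<le> r\<close>
proof (induction j)
  case 0
  then show ?case using assms(1) by simp
next
  case (Suc j)
  let ?D = "(4 * (R + 2 * r) + 2) * sqrt 2 ^ q"
  have *: "small_diffs q (Suc (r - Suc j)) (?D ^ j * B) f"
    using Suc by (simp add: Suc_diff_Suc)
  have "small_diffs q (r - Suc j) ((4 * (R + 2 * (r - Suc j)) + 2) * sqrt 2 ^ q * (?D ^ j * B)) f"
    using small_diffs_descend[OF * assms(2,3)] by simp
  moreover have "(4 * (R + 2 * (r - Suc j)) + 2) * sqrt 2 ^ q * (?D ^ j * B) \<le> ?D * (?D ^ j * B)"
    using small_diffs_nonneg[OF *] by (intro mult_right_mono) auto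
  ultimately show ?case
    using small_diffs_mono by (simp add: mult.assoc)
qed

text \<open>With m = \<open>length w\<close>, the increment is an operator of order m + 1 and size
  of order \<open>sqrt 2 ^ (q * m)\<close>, while the descent from order r + 1 to m + 1 costs
  \<open>sqrt 2 ^ (q * (r - m))\<close>. The product depends on r alone, hence one ratio for all
  words.\<close>

lemma pdiffs_step:
  assumes small_diffs: "\<And>q. small_diffs q (Suc r) (K * \<rho> ^ q) f"
    and supp: "\<And>x. R < norm x \<Longrightarrow> f x = 0" and "0 \<le> R" and w: "length w \<le> r"
  shows "\<exists>L. \<forall>q x. \<bar>pdiffs w (Suc q) f x - pdiffs w q f x\<bar> \<le> L * (\<rho> * sqrt 2 ^ r) ^ q"
proof (intro exI allI)
  fix q x
  define m D s where "m = length w" and "D = 4 * (R + 2 * Suc r) + 2" and "s = sqrt 2"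
  have "small_diffs (Suc q) (Suc r - (r - m)) ((D * s ^ Suc q) ^ (r - m) * (K * \<rho> ^ Suc q)) f"
    unfolding D_def s_def by (rule small_diffs_descend_iter[OF small_diffs supp \<open>0 \<le> R\<close>]) simp_all
  then have "small_diffs (Suc q) (Suc m) ((D * s ^ Suc q) ^ (r - m) * (K * \<rho> ^ Suc q)) f"
    using w by (simp add: m_def Suc_diff_le)
  then have "\<bar>pdiffs w (Suc q) f x - pdiffs w q f x\<bar>
      \<le> m * (10 * s ^ q) ^ m * ((D * s ^ Suc q) ^ (r - m) * (K * \<rho> ^ Suc q))"
    using diff_op_bound[OF diff_op_pdiffs_diff] by (simp add: m_def s_def)
  also have "\<dots> = m * 10 ^ m * (D * s) ^ (r - m) * K * \<rho> * (\<rho> ^ q * (s ^ m * s ^ (r - m)) ^ q)"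
    by (simp add: power_mult_distrib mult_ac flip: power_mult)
  also have "s ^ m * s ^ (r - m) = s ^ r"
    using w by (simp add: m_def flip: power_add)
  finally show "\<bar>pdiffs w (Suc q) f x - pdiffs w q f x\<bar>
      \<le> (m * 10 ^ m * (D * s) ^ (r - m) * K * \<rho>) * (\<rho> * sqrt 2 ^ r) ^ q"
    by (simp add: s_def power_mult_distrib)
qed

section \<open>Limits of the quotients and sums along lattice paths\<close>

lemma pdiffs_limit:
  assumes "\<And>q. small_diffs q (Suc r) (K * \<rho> ^ q) f"
    and "\<And>x. R < norm x \<Longrightarrow> f x = 0" "0 \<le> R" "length w \<le> r"
    and \<rho>: "0 \<le> \<rho>" "\<rho> * sqrt 2 ^ r < 1"
  shows "\<exists>G. uniform_limit UNIV (\<lambda>q. pdiffs w q f) G sequentially"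
proof -
  obtain L where L: "\<And>q x. \<bar>pdiffs w (Suc q) f x - pdiffs w q f x\<bar> \<le> L * (\<rho> * sqrt 2 ^ r) ^ q"
    using pdiffs_step[OF assms(1-4)] by blast
  have "uniform_limit UNIV (\<lambda>n x. \<Sum>q<n. pdiffs w (Suc q) f x - pdiffs w q f x)
      (\<lambda>x. \<Sum>q. pdiffs w (Suc q) f x - pdiffs w q f x) sequentially"
    using L \<rho> by (intro Weierstrass_m_test) (auto intro!: summable_mult summable_geometric)
  then have "uniform_limit UNIV (\<lambda>n x. pdiffs w 0 f x + (\<Sum>q<n. pdiffs w (Suc q) f x - pdiffs w q f x))
      (\<lambda>x. pdiffs w 0 f x + (\<Sum>q. pdiffs w (Suc q) f x - pdiffs w q f x)) sequentially"
    by (intro uniform_limit_add uniform_limit_const)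
  moreover have "(\<lambda>n x. pdiffs w 0 f x + (\<Sum>q<n. pdiffs w (Suc q) f x - pdiffs w q f x)) = (\<lambda>n. pdiffs w n f)"
    unfolding fun_eq_iff
  proof (intro allI)
    fix n x
    show "pdiffs w 0 f x + (\<Sum>q<n. pdiffs w (Suc q) f x - pdiffs w q f x) = pdiffs w n f x"
      using sum_lessThan_telescope[of "\<lambda>q. pdiffs w q f x" n] by simp
  qed
  ultimately show ?thesis by auto
qed

text \<open>A discrete mean value estimate. Each step adds the inner product of \<open>u\<close>
  with an approximate gradient within \<eta> of \<open>c\<close> in both components, whence the
  factor 2.\<close>

lemma path_nat:
  fixes n :: nat and d :: "2 \<Rightarrow> real ^ 2 \<Rightarrow> real"
  assumes fdiff: "\<And>y. fdiff u g y = u $ 1 * d 1 y + u $ 2 * d 2 y"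
    and d: "\<And>i j. j < n \<Longrightarrow> \<bar>d i (y + real j *\<^sub>R u) - c i\<bar> \<le> \<eta>"
  shows "\<bar>g (y + real n *\<^sub>R u) - g y - n * (u $ 1 * c 1 + u $ 2 * c 2)\<bar> \<le> n * (2 * norm u * \<eta>)"
  using d
proof (induction n)
  case (Suc n)
  let ?z = "y + real n *\<^sub>R u"
  have z: "\<bar>d i ?z - c i\<bar> \<le> \<eta>" for i using Suc.prems by simp
  have e: "g (y + real (Suc n) *\<^sub>R u) - g y - Suc n * (u $ 1 * c 1 + u $ 2 * c 2)
    = (g ?z - g y - n * (u $ 1 * c 1 + u $ 2 * c 2)) + (u $ 1 * (d 1 ?z - c 1) + u $ 2 * (d 2 ?z - c 2))"
    using fdiff[of ?z] by (simp add: fdiff_def algebra_simps)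
  have "\<bar>u $ i * (d i ?z - c i)\<bar> \<le> norm u * \<eta>" for i
    unfolding abs_mult using component_le_norm_cart[of u i] z[of i] by (intro mult_mono) auto
  from this[of 1] this[of 2] Suc show ?case
    unfolding e by (simp add: algebra_simps)
qed simp

lemma path_int:
  fixes a :: int and d :: "2 \<Rightarrow> real ^ 2 \<Rightarrow> real"
  assumes fdiff: "\<And>y. fdiff u g y = u $ 1 * d 1 y + u $ 2 * d 2 y"
    and d: "\<And>i z. norm (z - y) \<le> \<bar>of_int a\<bar> * norm u \<Longrightarrow> \<bar>d i z - c i\<bar> \<le> \<eta>"
  shows "\<bar>g (y + of_int a *\<^sub>R u) - g y - a * (u $ 1 * c 1 + u $ 2 * c 2)\<bar> \<le> \<bar>of_int a\<bar> * (2 * norm u * \<eta>)"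
proof (cases "0 \<le> a")
  case True
  have "\<bar>d i (y + real j *\<^sub>R u) - c i\<bar> \<le> \<eta>" if "j < nat a" for i j
    using that by (intro d) (auto intro!: mult_right_mono)
  from path_nat[where n = "nat a", OF fdiff this] True show ?thesis by simp
next
  case False
  \<comment> \<open>A negative count is handled by walking forward from the end point
    \<open>z\<close> back to \<open>y\<close>; this path stays within the same distance of
    \<open>y\<close>.\<close>
  define z where "z = y + of_int a *\<^sub>R u"
  have "\<bar>d i (z + real j *\<^sub>R u) - c i\<bar> \<le> \<eta>" if "j < nat (- a)" for i j
  proof (rule d)
    have "z + real j *\<^sub>R u - y = (of_int a + real j) *\<^sub>R u" by (simp add: z_def algebra_simps)
    moreover have "\<bar>of_int a + real j\<bar> \<le> \<bar>real_of_int a\<bar>" using that False by linarith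
    ultimately show "norm (z + real j *\<^sub>R u - y) \<le> \<bar>of_int a\<bar> * norm u"
      using mult_right_mono[OF _ norm_ge_zero[of u]] by simp
  qed
  from path_nat[OF fdiff this]
  have "\<bar>g (z + real (nat (- a)) *\<^sub>R u) - g z - nat (- a) * (u $ 1 * c 1 + u $ 2 * c 2)\<bar> \<le> nat (- a) * (2 * norm u * \<eta>)" .
  moreover have "z + real (nat (- a)) *\<^sub>R u = y" using False by (simp add: z_def)
  ultimately show ?thesis using False by (simp add: z_def abs_minus_commute algebra_simps)
qed

section \<open>Smoothness from differences\<close>

text \<open>The frame coordinates of \<open>h\<close> are rounded down. They grow like
  \<open>sqrt 2 ^ q\<close> while the steps shrink at the inverse rate, so the path to the rounded
  point has length bounded by a multiple of \<open>norm h\<close>, up to a vanishing rounding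
  term.\<close>

lemma lattice_approx:
  fixes h :: "real ^ 2"
  defines "a q \<equiv> \<lfloor>h $ 1 * fine_coord 1 q + h $ 2 * fine_coord 2 q\<rfloor>" and "b q \<equiv> \<lfloor>h $ 1 * coarse_coord 1 q + h $ 2 * coarse_coord 2 q\<rfloor>"
  shows "norm (h - (of_int (a q) *\<^sub>R fstep q + of_int (b q) *\<^sub>R cstep q)) \<le> 4 / sqrt 2 ^ q"
    and "\<bar>of_int (a q)\<bar> * norm (fstep q) \<le> 8 * norm h + 2 / sqrt 2 ^ q"
    and "\<bar>of_int (b q)\<bar> * norm (cstep q) \<le> 8 * norm h + 2 / sqrt 2 ^ q"
proof -
  define A B where "A = h $ 1 * fine_coord 1 q + h $ 2 * fine_coord 2 q" and "B = h $ 1 * coarse_coord 1 q + h $ 2 * coarse_coord 2 q"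
  have ab: "a q = \<lfloor>A\<rfloor>" "b q = \<lfloor>B\<rfloor>" by (simp_all add: a_def b_def A_def B_def)
  have s: "0 < sqrt 2 ^ q" "0 < 2 / sqrt 2 ^ q" by simp_all
  have "h - (of_int (a q) *\<^sub>R fstep q + of_int (b q) *\<^sub>R cstep q)
      = (A - of_int \<lfloor>A\<rfloor>) *\<^sub>R fstep q + (B - of_int \<lfloor>B\<rfloor>) *\<^sub>R cstep q"
    by (subst axis_coords[of h q]) (simp add: ab A_def[symmetric] B_def[symmetric] algebra_simps)
  also have "norm \<dots> \<le> \<bar>A - of_int \<lfloor>A\<rfloor>\<bar> * norm (fstep q) + \<bar>B - of_int \<lfloor>B\<rfloor>\<bar> * norm (cstep q)"
    by (metis norm_scaleR norm_triangle_ineq)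
  also have "\<dots> \<le> 1 * (2 / sqrt 2 ^ q) + 1 * (2 / sqrt 2 ^ q)"
    by (intro add_mono mult_mono norm_fstep_le norm_cstep_le) (auto, linarith+)
  finally show "norm (h - (of_int (a q) *\<^sub>R fstep q + of_int (b q) *\<^sub>R cstep q)) \<le> 4 / sqrt 2 ^ q"
    by simp
  have prod: "\<bar>h $ i * c\<bar> \<le> norm h * (2 * sqrt 2 ^ q)" if "\<bar>c\<bar> \<le> 2 * sqrt 2 ^ q" for c i
    unfolding abs_mult using component_le_norm_cart[of h i] that by (intro mult_mono) auto
  have AB: "\<bar>A\<bar> \<le> 4 * norm h * sqrt 2 ^ q" "\<bar>B\<bar> \<le> 4 * norm h * sqrt 2 ^ q"
    unfolding A_def B_def
    using prod[OF coord_bound(1)[of 1 q], of 1] prod[OF coord_bound(1)[of 2 q], of 2]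
      prod[OF coord_bound(2)[of 1 q], of 1] prod[OF coord_bound(2)[of 2 q], of 2]
    by linarith+
  have fl: "\<bar>of_int \<lfloor>C\<rfloor>\<bar> * n \<le> 8 * norm h + 2 / sqrt 2 ^ q"
    if "\<bar>C\<bar> \<le> 4 * norm h * sqrt 2 ^ q" "n \<le> 2 / sqrt 2 ^ q" "0 \<le> n" for C n :: real
  proof -
    have "\<bar>of_int \<lfloor>C\<rfloor>\<bar> \<le> \<bar>C\<bar> + 1" by linarith
    then have "\<bar>of_int \<lfloor>C\<rfloor>\<bar> * n \<le> (4 * norm h * sqrt 2 ^ q + 1) * (2 / sqrt 2 ^ q)"
      using that by (intro mult_mono) auto
    also have "\<dots> = 8 * norm h + 2 / sqrt 2 ^ q" by (simp add: field_simps)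
    finally show ?thesis .
  qed
  show "\<bar>of_int (a q)\<bar> * norm (fstep q) \<le> 8 * norm h + 2 / sqrt 2 ^ q"
    "\<bar>of_int (b q)\<bar> * norm (cstep q) \<le> 8 * norm h + 2 / sqrt 2 ^ q"
    unfolding ab using AB by (auto intro!: fl norm_fstep_le norm_cstep_le)
qed

lemma inverse_sqrt2_power_tendsto_0: "(\<lambda>q. c / sqrt 2 ^ q) \<longlonglongrightarrow> 0"
proof -
  have "(\<lambda>q. c * (1 / sqrt 2) ^ q) \<longlonglongrightarrow> c * 0"
    by (intro tendsto_mult tendsto_const LIMSEQ_power_zero) (simp add: real_less_rsqrt)
  then show ?thesis by (simp add: power_divide)
qed

text \<open>Increments of \<open>g q\<close> are summed along a lattice path that goes first along \<open>fstep q\<close> and then along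
  \<open>cstep q\<close>; its length is comparable to that of the increment.\<close>

lemma has_derivative_of_difference_limits:
  fixes g :: "nat \<Rightarrow> real ^ 2 \<Rightarrow> real" and d :: "2 \<Rightarrow> nat \<Rightarrow> real ^ 2 \<Rightarrow> real"
  assumes g: "uniform_limit UNIV g g' sequentially" "continuous_on UNIV g'"
    and d: "\<And>i. uniform_limit UNIV (d i) (d' i) sequentially" "\<And>i. continuous_on UNIV (d' i)"
    and fdp: "\<And>q x. fdiff (fstep q) (g q) x = fstep q $ 1 * d 1 q x + fstep q $ 2 * d 2 q x"
    and fdr: "\<And>q x. fdiff (cstep q) (g q) x = cstep q $ 1 * d 1 q x + cstep q $ 2 * d 2 q x"
  shows "(g' has_derivative (\<lambda>h. h $ 1 * d' 1 x + h $ 2 * d' 2 x)) (at x)"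
  unfolding has_derivative_at_alt
proof (intro conjI allI impI)
  show "bounded_linear (\<lambda>h. h $ 1 * d' 1 x + h $ 2 * d' 2 x)"
    by (intro bounded_linear_add bounded_linear_mult_const bounded_linear_vec_nth)
  fix e :: real assume "0 < e"
  \<comment> \<open>The final estimate is 4 \<eta> * 16 * \<open>norm h\<close>, so \<eta> = e / 64
    turns it into e * \<open>norm h\<close>.\<close>
  define c \<eta> where "c = (\<lambda>i. d' i x)" and "\<eta> = e / 64"
  have \<eta>: "0 < \<eta>" using \<open>0 < e\<close> by (simp add: \<eta>_def)
  have "\<forall>i. \<exists>\<delta>>0. \<forall>y. dist y x < \<delta> \<longrightarrow> dist (d' i y) (d' i x) < \<eta>"
    using d(2) \<eta> by (simp add: continuous_on_iff)
  then obtain \<delta>' where \<delta>': "\<And>i. \<delta>' i > 0" "\<And>i y. dist y x < \<delta>' i \<Longrightarrow> dist (d' i y) (d' i x) < \<eta>"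
    by metis
  define \<delta> where "\<delta> = min (\<delta>' 1) (\<delta>' 2)"
  have \<delta>: "0 < \<delta>" using \<delta>'(1) by (simp add: \<delta>_def)
  have \<delta>c: "\<bar>d' i y - c i\<bar> < \<eta>" if "norm (y - x) < \<delta>" for i y
  proof -
    have "norm (y - x) < \<delta>' i" using that exhaust_2[of i] by (auto simp: \<delta>_def)
    then show ?thesis using \<delta>'(2)[of y i] by (simp add: dist_norm c_def)
  qed
  \<comment> \<open>The whole path has length at most 16 * \<open>norm h\<close> + 4 /
    \<open>sqrt 2 ^ q\<close>. With both \<open>norm h\<close> and the last term below \<delta> / 20
    this is less than \<delta>, where the gradient is controlled.\<close>
  have near: "\<bar>g' (x + h) - g' x - (h $ 1 * c 1 + h $ 2 * c 2)\<bar> \<le> e * norm h"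
    if h: "norm h < \<delta> / 20" for h
  proof -
    define a b where "a q = \<lfloor>h $ 1 * fine_coord 1 q + h $ 2 * fine_coord 2 q\<rfloor>"
      and "b q = \<lfloor>h $ 1 * coarse_coord 1 q + h $ 2 * coarse_coord 2 q\<rfloor>" for q
    define hq where "hq q = of_int (a q) *\<^sub>R fstep q + of_int (b q) *\<^sub>R cstep q" for q
    note approx = lattice_approx[of h, folded a_def b_def, folded hq_def]
    have hq: "hq \<longlonglongrightarrow> h"
    proof -
      have "(\<lambda>q. hq q - h) \<longlonglongrightarrow> 0"
        by (rule Lim_null_comparison[OF _ inverse_sqrt2_power_tendsto_0[of 4]])
          (use approx(1) in \<open>simp add: norm_minus_commute\<close>)
      then show ?thesis by (simp add: LIM_zero_iff)
    qed
    have "eventually (\<lambda>q. 4 / sqrt 2 ^ q < \<delta> / 20) sequentially"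
      by (rule order_tendstoD(2)[OF inverse_sqrt2_power_tendsto_0]) (use \<delta> in simp)
    moreover have "eventually (\<lambda>q. \<forall>i y. dist (d i q y) (d' i y) < \<eta>) sequentially"
      unfolding forall_2 using uniform_limitD[OF d(1)[of 1] \<eta>] uniform_limitD[OF d(1)[of 2] \<eta>]
      by (simp add: eventually_conj_iff)
    ultimately have "eventually (\<lambda>q. \<bar>g q (x + hq q) - g q x - (hq q $ 1 * c 1 + hq q $ 2 * c 2)\<bar>
        \<le> 4 * \<eta> * (16 * norm h + 4 / sqrt 2 ^ q)) sequentially"
    proof (eventually_elim)
      fix q assume q: "4 / sqrt 2 ^ q < \<delta> / 20" and dd: "\<forall>i y. dist (d i q y) (d' i y) < \<eta>"
      let ?p = "\<bar>of_int (a q)\<bar> * norm (fstep q)" and ?r = "\<bar>of_int (b q)\<bar> * norm (cstep q)"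
      have "4 / sqrt 2 ^ q = 2 * (2 / sqrt 2 ^ q)" by simp
      then have len: "?p + ?r < \<delta>" using approx(2,3)[of q] q h \<delta> by linarith
      have close: "\<bar>d i q z - c i\<bar> \<le> 2 * \<eta>" if "norm (z - x) \<le> ?p + ?r" for i z
      proof -
        have "\<bar>d i q z - d' i z\<bar> < \<eta>" using dd by (simp add: dist_real_def)
        moreover have "\<bar>d' i z - c i\<bar> < \<eta>" using that len by (intro \<delta>c) simp
        ultimately show ?thesis by linarith
      qed
      have 1: "\<bar>g q (x + of_int (a q) *\<^sub>R fstep q) - g q x - a q * (fstep q $ 1 * c 1 + fstep q $ 2 * c 2)\<bar>
          \<le> \<bar>of_int (a q)\<bar> * (2 * norm (fstep q) * (2 * \<eta>))"
        by (rule path_int[OF fdp]) (rule close, simp add: add_increasing2)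
      have 2: "\<bar>g q (x + of_int (a q) *\<^sub>R fstep q + of_int (b q) *\<^sub>R cstep q) - g q (x + of_int (a q) *\<^sub>R fstep q)
            - b q * (cstep q $ 1 * c 1 + cstep q $ 2 * c 2)\<bar> \<le> \<bar>of_int (b q)\<bar> * (2 * norm (cstep q) * (2 * \<eta>))"
      proof (rule path_int[OF fdr], rule close)
        fix z assume "norm (z - (x + of_int (a q) *\<^sub>R fstep q)) \<le> ?r"
        then show "norm (z - x) \<le> ?p + ?r"
          using norm_triangle_ineq[of "z - (x + of_int (a q) *\<^sub>R fstep q)" "of_int (a q) *\<^sub>R fstep q"] by simp
      qed
      have e: "g q (x + hq q) - g q x - (hq q $ 1 * c 1 + hq q $ 2 * c 2)
        = (g q (x + of_int (a q) *\<^sub>R fstep q) - g q x - a q * (fstep q $ 1 * c 1 + fstep q $ 2 * c 2))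
        + (g q (x + of_int (a q) *\<^sub>R fstep q + of_int (b q) *\<^sub>R cstep q) - g q (x + of_int (a q) *\<^sub>R fstep q)
            - b q * (cstep q $ 1 * c 1 + cstep q $ 2 * c 2))"
        by (simp add: hq_def algebra_simps)
      have "\<bar>g q (x + hq q) - g q x - (hq q $ 1 * c 1 + hq q $ 2 * c 2)\<bar> \<le> 4 * \<eta> * (?p + ?r)"
        unfolding e using 1 2 by (simp add: algebra_simps)
      also have "\<dots> \<le> 4 * \<eta> * (16 * norm h + 4 / sqrt 2 ^ q)"
        using approx(2,3)[of q] \<eta> by (intro mult_left_mono) (auto simp: add_divide_distrib)
      finally show "\<bar>g q (x + hq q) - g q x - (hq q $ 1 * c 1 + hq q $ 2 * c 2)\<bar>
        \<le> 4 * \<eta> * (16 * norm h + 4 / sqrt 2 ^ q)" .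
    qed
    moreover have "(\<lambda>q. \<bar>g q (x + hq q) - g q x - (hq q $ 1 * c 1 + hq q $ 2 * c 2)\<bar>)
      \<longlonglongrightarrow> \<bar>g' (x + h) - g' x - (h $ 1 * c 1 + h $ 2 * c 2)\<bar>"
    proof -
      \<comment> \<open>Uniform convergence is what permits the evaluation point to move with
        \<open>q\<close>.\<close>
      have lim0: "(\<lambda>q. g q (y q) - g' (y q)) \<longlonglongrightarrow> 0" for y
      proof (rule LIMSEQ_I)
        fix r :: real assume "0 < r"
        from uniform_limitD[OF g(1) this] show "\<exists>N. \<forall>q\<ge>N. norm (g q (y q) - g' (y q) - 0) < r"
          by (auto simp: eventually_sequentially dist_norm)
      qed
      have "isCont g' (x + h)" using g(2) by (simp add: continuous_on_eq_continuous_at)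
      then have "(\<lambda>q. g' (x + hq q)) \<longlonglongrightarrow> g' (x + h)"
        by (rule isCont_tendsto_compose) (intro tendsto_intros hq)
      from tendsto_add[OF lim0[of "\<lambda>q. x + hq q"] this]
      have "(\<lambda>q. g q (x + hq q)) \<longlonglongrightarrow> g' (x + h)" by simp
      moreover from tendsto_add[OF lim0[of "\<lambda>_. x"] tendsto_const[of "g' x"]]
      have "(\<lambda>q. g q x) \<longlonglongrightarrow> g' x" by simp
      ultimately show ?thesis by (intro tendsto_intros hq)
    qed
    moreover have "(\<lambda>q. 4 * \<eta> * (16 * norm h + 4 / sqrt 2 ^ q)) \<longlonglongrightarrow> 4 * \<eta> * (16 * norm h + 0)"
      by (intro tendsto_intros inverse_sqrt2_power_tendsto_0)
    ultimately have "\<bar>g' (x + h) - g' x - (h $ 1 * c 1 + h $ 2 * c 2)\<bar> \<le> 4 * \<eta> * (16 * norm h + 0)"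
      by (intro tendsto_le[OF _ _ _]) auto
    then show ?thesis by (simp add: \<eta>_def)
  qed
  show "\<exists>d>0. \<forall>y. norm (y - x) < d \<longrightarrow>
      norm (g' y - g' x - ((y - x) $ 1 * d' 1 x + (y - x) $ 2 * d' 2 x)) \<le> e * norm (y - x)"
  proof (intro exI conjI allI impI)
    show "0 < \<delta> / 20" using \<delta> by simp
    fix y assume "norm (y - x) < \<delta> / 20"
    from near[OF this] show "norm (g' y - g' x - ((y - x) $ 1 * d' 1 x + (y - x) $ 2 * d' 2 x)) \<le> e * norm (y - x)"
      by (simp add: c_def)
  qed
qed

text \<open>All iterated derivatives at once, indexed by words in the two directions; the head of
  the word is the derivative taken last. Words make one more derivative a \<open>Cons\<close> and
  keep the symmetry of mixed derivatives out of the induction.\<close>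

definition deriv_family :: "nat \<Rightarrow> (2 list \<Rightarrow> real ^ 2 \<Rightarrow> 'b::real_normed_vector) \<Rightarrow> bool" where
  "deriv_family r g \<longleftrightarrow> (\<forall>w. length w \<le> r \<longrightarrow> continuous_on UNIV (g w)) \<and>
     (\<forall>w x. length w < r \<longrightarrow>
        (g w has_derivative (\<lambda>h. (h $ 1) *\<^sub>R g (1 # w) x + (h $ 2) *\<^sub>R g (2 # w) x)) (at x))"

text \<open>The candidate derivative for a word is the uniform limit of its difference quotients. A
  word shorter than \<open>r\<close> and its two extensions then supply the function and the
  gradient of \<open>has_derivative_of_difference_limits\<close>. The scheme enters only through the
  rate \<rho>.\<close>

theorem regularity_from_differences:
  assumes small_diffs: "\<And>q. small_diffs q (Suc r) (K * \<rho> ^ q) f"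
    and supp: "\<And>x. R < norm x \<Longrightarrow> f x = 0" and "0 \<le> R"
    and \<rho>: "0 \<le> \<rho>" "\<rho> * sqrt 2 ^ r < 1" and cont: "continuous_on UNIV f"
  shows "\<exists>g. deriv_family r g \<and> g [] = f \<and> (\<forall>w x. length w \<le> r \<longrightarrow> R + 2 * r < norm x \<longrightarrow> g w x = 0)"
proof -
  have "\<forall>w. \<exists>G. length w \<le> r \<longrightarrow> uniform_limit UNIV (\<lambda>q. pdiffs w q f) G sequentially"
    using pdiffs_limit[OF small_diffs supp \<open>0 \<le> R\<close> _ \<rho>] by blast
  then obtain g where g: "\<And>w. length w \<le> r \<Longrightarrow> uniform_limit UNIV (\<lambda>q. pdiffs w q f) (g w) sequentially"
    by metis
  have pw: "(\<lambda>q. pdiffs w q f x) \<longlonglongrightarrow> g w x" if "length w \<le> r" for w x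
    using tendsto_uniform_limitI[OF g[OF that]] by simp
  have cont_pdiffs: "continuous_on UNIV (pdiffs w q f)" for w q
  proof (induction w)
    case (Cons i w)
    have "continuous_on UNIV (pdiff i q h)" if "continuous_on UNIV h" for h
    proof -
      have "continuous_on UNIV (\<lambda>x. h (x + v))" for v
        by (rule continuous_on_compose2[OF that]) (auto intro!: continuous_intros)
      then show ?thesis
        unfolding pdiff_def[abs_def] fdiff_def using that by (intro continuous_intros)
    qed
    then show ?case using Cons by simp
  qed (use cont in simp)
  have cont_g: "continuous_on UNIV (g w)" if "length w \<le> r" for w
    by (rule uniform_limit_theorem[OF _ g[OF that]]) (simp_all add: cont_pdiffs)
  have "(g w has_derivative (\<lambda>h. (h $ 1) *\<^sub>R g (1 # w) x + (h $ 2) *\<^sub>R g (2 # w) x)) (at x)"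
    if "length w < r" for w x
  proof -
    have w: "length w \<le> r" "length (i # w) \<le> r" for i using that by simp_all
    show ?thesis
      unfolding real_scaleR_def
      using g[OF w(1)] cont_g[OF w(1)] g[OF w(2)] cont_g[OF w(2)]
      by (rule has_derivative_of_difference_limits[where d = "\<lambda>i q. pdiffs (i # w) q f"]) (simp_all add: pdiff_dual)
  qed
  moreover have "g [] = f"
  proof
    fix x
    have "(\<lambda>q. f x) \<longlonglongrightarrow> g [] x" using pw[of "[]" x] by simp
    then show "g [] x = f x" using LIMSEQ_unique tendsto_const by blast
  qed
  moreover have "g w x = 0" if "length w \<le> r" "R + 2 * r < norm x" for w x
  proof -
    have "pdiffs w q f x = 0" for q
      by (rule pdiffs_support[OF supp]) (use that in auto)
    then have "(\<lambda>q. 0) \<longlonglongrightarrow> g w x" using pw[OF that(1), of x] by simp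
    then show ?thesis using LIMSEQ_unique tendsto_const by blast
  qed
  ultimately show ?thesis unfolding deriv_family_def using cont_g by blast
qed

section \<open>Change of variables\<close>

lemma bear_matrix_mult: "bear_matrix *v x = bear x"
  by (simp add: bear_matrix_def bear_def vec2_eq_iff matrix_vector_mult_def sum_2)

lemma linear_unbear: "linear unbear"
  by (rule linearI) (simp_all add: vec2_eq_iff algebra_simps add_divide_distrib diff_divide_distrib)

lemma linear_bear: "linear bear"
  by (rule linearI) (simp_all add: vec2_eq_iff algebra_simps)

lemma matrix_inv_bear_matrix: "matrix_inv bear_matrix *v x = unbear x"
proof -
  have "bear_matrix = matrix bear"
    by (simp add: matrix_def bear_matrix_def axis_def vec_eq_iff forall_2)
  moreover have "matrix unbear ** matrix bear = mat 1" "matrix bear ** matrix unbear = mat 1"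
    by (simp_all add: matrix_eq flip: matrix_vector_mul_assoc) (simp_all add: matrix_works linear_unbear linear_bear)
  ultimately have inv: "bear_matrix ** matrix unbear = mat 1" "matrix unbear ** bear_matrix = mat 1"
    by simp_all
  then have "matrix_inv bear_matrix ** (bear_matrix :: real ^ 2 ^ 2) = mat 1"
    unfolding matrix_inv_def by (metis (mono_tags, lifting) someI)
  then have "matrix_inv bear_matrix = matrix unbear"
    using inv by (metis matrix_mul_assoc matrix_mul_lid matrix_mul_rid)
  then show ?thesis by (simp add: matrix_works linear_unbear)
qed

lemma det_unbear: "det (matrix unbear) = 1 / 2"
  by (simp add: det_2 matrix_def axis_def)

lemma bear_measurable [measurable]: "bear \<in> borel_measurable borel"
  by (intro borel_measurable_continuous_onI linear_continuous_on linear_conv_bounded_linear[THEN iffD1] linear_bear)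

text \<open>Lebesgue measure is determined by its values on boxes; there the density 2 is det M,
  read off from the linear image under \<open>unbear\<close>.\<close>

lemma lborel_bear: "lborel = density (distr lborel borel bear) (\<lambda>_. 2)"
proof (rule lborel_eqI)
  fix l u :: "real ^ 2" assume lu: "\<And>b. b \<in> Basis \<Longrightarrow> l \<bullet> b \<le> u \<bullet> b"
  have pre: "bear -` box l u = unbear ` box l u"
    by (auto simp: image_iff) (metis unbear_bear)
  have m: "measure lebesgue (unbear ` box l u) = (1 / 2) * measure lebesgue (box l u)"
    using measure_linear_image[OF linear_unbear, of "box l u"] by (simp add: det_unbear)
  have fin: "unbear ` box l u \<in> lmeasurable"
    by (rule measurable_linear_image[OF linear_unbear]) simp
  have "bear -` box l u \<in> sets borel"
    using measurable_sets[OF bear_measurable, of "box l u"] by simp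
  then have "emeasure lborel (bear -` box l u) = emeasure lebesgue (unbear ` box l u)"
    by (simp add: pre)
  also have "\<dots> = ennreal ((1 / 2) * measure lebesgue (box l u))"
    using emeasure_eq_measure2[OF fin] m by simp
  finally have "emeasure lborel (bear -` box l u) = ennreal ((1 / 2) * (\<Prod>b\<in>Basis. (u - l) \<bullet> b))"
    using lu by (simp add: measure_def inner_diff_left prod_nonneg)
  then show "emeasure (density (distr lborel borel bear) (\<lambda>_. 2)) (box l u) = (\<Prod>b\<in>Basis. (u - l) \<bullet> b)"
    by (simp add: emeasure_density emeasure_distr nn_integral_cmult ennreal_numeral[symmetric]
        del: ennreal_numeral flip: ennreal_mult')
qed simp

lemma integral_bear:
  fixes f :: "real ^ 2 \<Rightarrow> 'b::{banach, second_countable_topology}"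
  assumes [measurable]: "f \<in> borel_measurable borel"
  shows "(LINT x|lborel. f x) = 2 *\<^sub>R (LINT x|lborel. f (bear x))"
proof -
  have "(LINT x|lborel. f x) = (LINT x|density (distr lborel borel bear) (\<lambda>_. 2). f x)"
    by (rule arg_cong[OF lborel_bear])
  also have "\<dots> = 2 *\<^sub>R (LINT x|lborel. f (bear x))"
    using integral_density[of f "distr lborel borel bear" "\<lambda>_. 2"] by (simp add: integral_distr)
  finally show ?thesis .
qed

lemma integral_translate:
  fixes f :: "real ^ 2 \<Rightarrow> 'b::{banach, second_countable_topology}"
  assumes "f \<in> borel_measurable borel"
  shows "(LINT x|lborel. f (x + a)) = (LINT x|lborel. f x)"
proof -
  have "(LINT x|lborel. f x) = (LINT x|distr lborel borel ((+) a). f x)"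
    by (simp add: lborel_distr_plus)
  also have "\<dots> = (LINT x|lborel. f (a + x))"
    using assms by (simp add: integral_distr)
  finally show ?thesis by (simp add: add.commute)
qed

lemma AE_translate:
  assumes "AE x in lborel. P (x :: real ^ 2)" 
  shows "AE x in lborel. P (x + a)"
proof -
  have "AE x in distr lborel borel ((+) a). P x" using assms by (simp only: lborel_distr_plus)
  then have "AE x in lborel. P (a + x)" by (rule AE_distrD[rotated]) simp
  then show ?thesis by (simp add: add.commute)
qed

section \<open>The tile\<close>

abbreviation e1 :: "real ^ 2" where "e1 \<equiv> vector [1, 0]"

lemma norm_unbear_funpow_le: "norm ((unbear ^^ k) x) \<le> 3 * norm x / sqrt 2 ^ k"
proof (rule power2_le_imp_le)
  have "qform ((unbear ^^ k) x) = qform x / 2 ^ k" by (induction k) (simp_all add: qform_unbear)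
  then have "(norm ((unbear ^^ k) x))\<^sup>2 \<le> 2 * (qform x / 2 ^ k)"
    using norm_sq_le_qform[of "(unbear ^^ k) x"] by simp
  also have "\<dots> \<le> 2 * (4 * (norm x)\<^sup>2 / 2 ^ k)"
    using qform_le_norm_sq[of x] by (intro mult_left_mono divide_right_mono) simp_all
  \<comment> \<open>The constants of the two norm comparisons multiply to 8, rounded up to
    3^2.\<close>
  also have "\<dots> \<le> (3 * norm x / sqrt 2 ^ k)\<^sup>2"
    by (simp add: power_divide power_mult_distrib sqrt2_power_sq divide_right_mono)
  finally show "(norm ((unbear ^^ k) x))\<^sup>2 \<le> (3 * norm x / sqrt 2 ^ k)\<^sup>2" .
qed simp

lemma unbear_funpow_add: "(unbear ^^ k) (x + y) = (unbear ^^ k) x + (unbear ^^ k) y"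
  by (induction k) (simp_all add: linear_add[OF linear_unbear])

lemma unbear_funpow_diff: "(unbear ^^ k) (x - y) = (unbear ^^ k) x - (unbear ^^ k) y"
  by (induction k) (simp_all add: linear_diff[OF linear_unbear])

lemma unbear_funpow_0 [simp]: "(unbear ^^ k) 0 = 0"
  by (induction k) (simp_all add: linear_0[OF linear_unbear])

lemma bear_tile_eq:
  "bear_tile = {x. \<exists>\<delta>. (\<forall>k. \<delta> k \<in> {0, e1}) \<and> (\<lambda>k. (unbear ^^ Suc k) (\<delta> k)) sums x}"
proof -
  have "vector [0, 0] = (0 :: real ^ 2)" by (simp add: vec2_eq_iff)
  then have D: "bear_digits = {0, e1}" by (simp add: bear_digits_def)
  have M: "(\<lambda>y. matrix_inv bear_matrix *v y) = unbear" by (simp add: fun_eq_iff matrix_inv_bear_matrix)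
  show ?thesis
    unfolding bear_tile_def D M
  proof (intro Collect_cong iffI)
    fix x assume "\<exists>\<Delta>. (\<forall>k\<ge>1. \<Delta> k \<in> {0, e1}) \<and> (\<lambda>k. (unbear ^^ Suc k) (\<Delta> (Suc k))) sums x"
    then obtain \<Delta> where "\<forall>k\<ge>1. \<Delta> k \<in> {0, e1}" "(\<lambda>k. (unbear ^^ Suc k) (\<Delta> (Suc k))) sums x" by blast
    then show "\<exists>\<delta>. (\<forall>k. \<delta> k \<in> {0, e1}) \<and> (\<lambda>k. (unbear ^^ Suc k) (\<delta> k)) sums x"
      by (intro exI[of _ "\<lambda>k. \<Delta> (Suc k)"]) auto
  next
    fix x assume "\<exists>\<delta>. (\<forall>k. \<delta> k \<in> {0, e1}) \<and> (\<lambda>k. (unbear ^^ Suc k) (\<delta> k)) sums x"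
    then obtain \<delta> where "\<forall>k. \<delta> k \<in> {0, e1}" "(\<lambda>k. (unbear ^^ Suc k) (\<delta> k)) sums x" by blast
    then show "\<exists>\<Delta>. (\<forall>k\<ge>1. \<Delta> k \<in> {0, e1}) \<and> (\<lambda>k. (unbear ^^ Suc k) (\<Delta> (Suc k))) sums x"
      by (intro exI[of _ "\<lambda>k. \<delta> (k - 1)"]) auto
  qed
qed

lemma bear_sums:
  assumes "(\<lambda>k. (unbear ^^ Suc k) (\<delta> k)) sums x"
  shows "(\<lambda>k. (unbear ^^ Suc k) (\<delta> (Suc k))) sums (bear x - \<delta> 0)"
proof -
  have "(\<lambda>k. bear ((unbear ^^ Suc k) (\<delta> k))) sums bear x"
    using bounded_linear.sums[OF linear_conv_bounded_linear[THEN iffD1, OF linear_bear] assms] .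
  then have "(\<lambda>k. (unbear ^^ k) (\<delta> k)) sums bear x" by simp
  then show ?thesis using sums_Suc_iff[of "\<lambda>k. (unbear ^^ k) (\<delta> k)" "bear x - \<delta> 0"] by simp
qed

lemma bear_tile_expand:
  assumes "x \<in> bear_tile" shows "bear x \<in> bear_tile \<or> bear x - e1 \<in> bear_tile"
proof -
  obtain \<delta> where \<delta>: "\<And>k. \<delta> k \<in> {0, e1}" "(\<lambda>k. (unbear ^^ Suc k) (\<delta> k)) sums x"
    using assms unfolding bear_tile_eq by blast
  have "bear x - \<delta> 0 \<in> bear_tile"
    unfolding bear_tile_eq using \<delta>(1) bear_sums[OF \<delta>(2)] by (intro CollectI exI[of _ "\<lambda>k. \<delta> (Suc k)"]) auto
  then show ?thesis using \<delta>(1)[of 0] by auto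
qed

text \<open>The tile is the largest bounded set with the property of \<open>bear_tile_expand\<close>.\<close>

lemma bear_tileI:
  assumes "bounded B" and B: "\<And>x. x \<in> B \<Longrightarrow> bear x \<in> B \<or> bear x - e1 \<in> B" and "x \<in> B"
  shows "x \<in> bear_tile"
proof -
  \<comment> \<open>The digit is 0 whenever that keeps the orbit in \<open>B\<close>, and
    \<open>e1\<close> otherwise. Since the orbit stays bounded, its contraction by M^(-n) tends to 0
    and the chosen digits represent \<open>x\<close>.\<close>
  define d where "d y = (if bear y \<in> B then 0 else e1)" for y
  define orbit where "orbit k = ((\<lambda>y. bear y - d y) ^^ k) x" for k
  have orbit: "orbit k \<in> B" for k
    by (induction k) (use \<open>x \<in> B\<close> B in \<open>auto simp: orbit_def d_def\<close>)
  have step: "orbit k = unbear (orbit (Suc k)) + unbear (d (orbit k))" for k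
    by (simp add: orbit_def linear_diff[OF linear_unbear])
  have part: "x - (unbear ^^ n) (orbit n) = (\<Sum>k<n. (unbear ^^ Suc k) (d (orbit k)))" for n
  proof (induction n)
    case 0
    then show ?case by (simp add: orbit_def)
  next
    case (Suc n)
    have "(unbear ^^ n) (orbit n) = (unbear ^^ Suc n) (orbit (Suc n)) + (unbear ^^ Suc n) (d (orbit n))"
      by (subst step) (simp add: unbear_funpow_add funpow_swap1)
    with Suc show ?case by (simp add: algebra_simps)
  qed
  obtain R where R: "\<And>y. y \<in> B \<Longrightarrow> norm y \<le> R" using \<open>bounded B\<close> by (auto simp: bounded_iff)
  have "(\<lambda>n. (unbear ^^ n) (orbit n)) \<longlonglongrightarrow> 0"
  proof (rule Lim_null_comparison)
    show "\<forall>\<^sub>F n in sequentially. norm ((unbear ^^ n) (orbit n)) \<le> 3 * R * (1 / sqrt 2) ^ n"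
    proof (intro always_eventually allI)
      fix n
      have "norm ((unbear ^^ n) (orbit n)) \<le> 3 * norm (orbit n) / sqrt 2 ^ n" by (rule norm_unbear_funpow_le)
      also have "\<dots> \<le> 3 * R / sqrt 2 ^ n" using R[OF orbit[of n]] by (intro divide_right_mono) simp_all
      finally show "norm ((unbear ^^ n) (orbit n)) \<le> 3 * R * (1 / sqrt 2) ^ n" by (simp add: power_divide)
    qed
    have "(\<lambda>n. 3 * R * (1 / sqrt 2) ^ n) \<longlonglongrightarrow> 3 * R * 0"
      by (intro tendsto_mult tendsto_const LIMSEQ_power_zero) (simp add: real_less_rsqrt)
    then show "(\<lambda>n. 3 * R * (1 / sqrt 2) ^ n) \<longlonglongrightarrow> 0" by simp
  qed
  from tendsto_diff[OF tendsto_const[of x] this] have "(\<lambda>n. x - (unbear ^^ n) (orbit n)) \<longlonglongrightarrow> x" by simp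
  then have "(\<lambda>k. (unbear ^^ Suc k) (d (orbit k))) sums x" unfolding sums_def part .
  then show ?thesis unfolding bear_tile_eq
    by (intro CollectI exI[of _ "\<lambda>k. d (orbit k)"]) (auto simp: d_def)
qed

lemma bounded_bear_tile: "bounded bear_tile"
  unfolding bounded_iff
proof (intro exI ballI)
  fix x assume "x \<in> bear_tile"
  then obtain \<delta> where \<delta>: "\<And>k. \<delta> k \<in> {0, e1}" "(\<lambda>k. (unbear ^^ Suc k) (\<delta> k)) sums x"
    unfolding bear_tile_eq by blast
  have e1: "norm e1 = 1" by (simp add: norm_vec_def L2_set_def UNIV_2)
  have le: "norm ((unbear ^^ Suc k) (\<delta> k)) \<le> 3 * (1 / sqrt 2) ^ k" for k
  proof -
    have "norm (\<delta> k) \<le> 1" using \<delta>(1)[of k] e1 by auto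
    then have "3 * norm (\<delta> k) / sqrt 2 ^ Suc k \<le> 3 * 1 / sqrt 2 ^ k"
      by (intro frac_le) (auto simp: mult_le_cancel_right1)
    then show ?thesis using norm_unbear_funpow_le[of "Suc k" "\<delta> k"] by (simp add: power_divide)
  qed
  have s: "summable (\<lambda>k. 3 * (1 / sqrt 2) ^ k)"
    by (intro summable_mult summable_geometric) (simp add: real_less_rsqrt)
  have "norm (\<Sum>k. (unbear ^^ Suc k) (\<delta> k)) \<le> (\<Sum>k. 3 * (1 / sqrt 2) ^ k)"
    by (rule norm_suminf_le[OF le s])
  then show "norm x \<le> (\<Sum>k. 3 * (1 / sqrt 2) ^ k)"
    using sums_unique[OF \<delta>(2)] by simp
qed


lemma norm_e1: "norm e1 = 1"
  by (simp add: norm_vec_def L2_set_def UNIV_2)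

lemma bear_continuous: "continuous_on UNIV bear"
  by (intro linear_continuous_on linear_conv_bounded_linear[THEN iffD1] linear_bear)

text \<open>The expansion property is inherited by the closure, because the two preimages of the
  closure form a closed set. The closure is bounded, so the maximality in \<open>bear_tileI\<close>
  puts it inside the tile. This replaces a compactness argument on digit sequences.\<close>

lemma closed_bear_tile: "closed bear_tile"
proof -
  let ?C = "bear -` closure bear_tile \<union> (\<lambda>x. bear x - e1) -` closure bear_tile"
  have "closed ?C"
    by (intro closed_Un closed_vimage continuous_intros bear_continuous closed_closure)
  moreover have "bear_tile \<subseteq> ?C" using bear_tile_expand closure_subset by fastforce
  ultimately have "closure bear_tile \<subseteq> ?C" by (rule closure_minimal[rotated])
  then have "closure bear_tile \<subseteq> bear_tile"
    using bear_tileI[OF bounded_closure[OF bounded_bear_tile]] by blast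
  then show ?thesis using closure_subset_eq by blast
qed

text \<open>For the converse, adjoining \<open>x\<close> to the tile preserves both boundedness and
  the expansion property, so maximality applies to the enlarged set.\<close>

lemma bear_tile_iff: "x \<in> bear_tile \<longleftrightarrow> bear x \<in> bear_tile \<or> bear x - e1 \<in> bear_tile"
proof
  assume *: "bear x \<in> bear_tile \<or> bear x - e1 \<in> bear_tile"
  show "x \<in> bear_tile"
    by (rule bear_tileI[of "insert x bear_tile"])
      (use * bear_tile_expand bounded_bear_tile in \<open>auto simp: bounded_insert\<close>)
qed (rule bear_tile_expand)

lemma zero_in_bear_tile: "0 \<in> bear_tile"
  by (rule bear_tileI[of "{0}"]) (simp_all add: linear_0[OF linear_bear])

section \<open>Covering of the plane by lattice translates of the tile\<close>

lemma lattice_point_nth [simp]: "lattice_point k $ i = of_int (k $ i)"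
  by (simp add: lattice_point_def)

lemma finite_lattice_ball: "finite {k. norm (lattice_point k - x) \<le> r}"
proof -
  let ?N = "\<lceil>\<bar>x $ 1\<bar> + \<bar>x $ 2\<bar> + \<bar>r\<bar>\<rceil>"
  let ?f = "\<lambda>k :: int ^ 2. (k $ 1, k $ 2)"
  have "?f ` {k. norm (lattice_point k - x) \<le> r} \<subseteq> {- ?N..?N} \<times> {- ?N..?N}"
  proof clarify
    fix k assume k: "norm (lattice_point k - x) \<le> r"
    have "\<bar>of_int (k $ i)\<bar> \<le> \<bar>x $ i\<bar> + \<bar>r\<bar>" for i
      using component_le_norm_cart[of "lattice_point k - x" i] k by auto
    from this[of 1] this[of 2] have "\<bar>real_of_int (k $ 1)\<bar> \<le> of_int ?N" "\<bar>real_of_int (k $ 2)\<bar> \<le> of_int ?N"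
      by linarith+
    then show "k $ 1 \<in> {- ?N..?N} \<and> k $ 2 \<in> {- ?N..?N}"
      by (simp only: atLeastAtMost_iff of_int_abs[symmetric] of_int_le_iff) linarith
  qed
  then have "finite (?f ` {k. norm (lattice_point k - x) \<le> r})"
    by (rule finite_subset) simp
  then show ?thesis
    by (rule finite_imageD) (auto simp: inj_on_def vec2_eq_iff)
qed

definition ibear :: "int ^ 2 \<Rightarrow> int ^ 2" where "ibear k = vector [k $ 1 - 2 * k $ 2, k $ 1]"

lemma ibear_nth [simp]: "ibear k $ 1 = k $ 1 - 2 * k $ 2" "ibear k $ 2 = k $ 1"
  by (simp_all add: ibear_def)

lemma bear_matrix_mult_int: "bear_matrix *v k = ibear k"
  by (simp add: bear_matrix_def vec2_eq_iff matrix_vector_mult_def sum_2)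

lemma lattice_point_ibear: "lattice_point (ibear k) = bear (lattice_point k)"
  by (simp add: vec2_eq_iff)

lemma lattice_point_add: "lattice_point (k + l) = lattice_point k + lattice_point l"
  and lattice_point_0 [simp]: "lattice_point 0 = 0"
  by (simp_all add: vec2_eq_iff)

text \<open>The digits form a complete residue system modulo M: the image of the integer lattice
  consists of the points whose coordinates have equal parity.\<close>

lemma digit_expansion:
  fixes k :: "int ^ 2"
  obtains l where "k = ibear l \<or> k = ibear l + vector [1, 0]"
proof (cases "even (k $ 2 - k $ 1)")
  case True
  then have "k = ibear (vector [k $ 2, (k $ 2 - k $ 1) div 2])" by (simp add: vec2_eq_iff)
  then show ?thesis using that by blast
next
  case False
  then have "k = ibear (vector [k $ 2, (k $ 2 - k $ 1 + 1) div 2]) + vector [1, 0]"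
    by (simp add: vec2_eq_iff) presburger
  then show ?thesis using that by blast
qed

lemma tile_translates_unbear:
  assumes "bear x - lattice_point k \<in> bear_tile"
  shows "\<exists>l. x - lattice_point l \<in> bear_tile"
proof -
  obtain l where l: "k = ibear l \<or> k = ibear l + vector [1, 0]" by (rule digit_expansion)
  have e: "lattice_point (vector [1, 0]) = e1" by (simp add: vec2_eq_iff)
  have "bear (x - lattice_point l) = bear x - lattice_point (ibear l)"
    by (simp add: lattice_point_ibear linear_diff[OF linear_bear])
  then have "bear (x - lattice_point l) \<in> bear_tile \<or> bear (x - lattice_point l) - e1 \<in> bear_tile"
    using assms l by (auto simp: lattice_point_add e diff_diff_eq)
  then show ?thesis using bear_tile_iff by blast
qed

text \<open>Lattice points are covered because 0 lies in the tile, and coverings pull back along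
  M^(-1). So the points of M^(-q) Z^2 are covered for every \<open>q\<close>; they come arbitrarily
  close to \<open>x\<close>, and a closed union of nearby translates catches the limit.\<close>

lemma tile_covers: "\<exists>k. x - lattice_point k \<in> bear_tile"
proof -
  define y where "y q = (unbear ^^ q) (\<chi> i. of_int \<lfloor>((bear ^^ q) x) $ i\<rfloor>)" for q
  have mn: "(bear ^^ q) ((unbear ^^ q) z) = z" "(unbear ^^ q) ((bear ^^ q) z) = z" for q z
    by (induction q arbitrary: z) (simp_all add: funpow_swap1)
  have cov: "\<exists>l. z - lattice_point l \<in> bear_tile" if "(bear ^^ q) z - lattice_point k \<in> bear_tile" for q k z
    using that
  proof (induction q arbitrary: z k)
    case (Suc q)
    then show ?case using tile_translates_unbear by (metis funpow.simps(2) comp_apply funpow_swap1)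
  qed auto
  have "\<exists>l. y q - lattice_point l \<in> bear_tile" for q
  proof (rule cov[of q _ "\<chi> i. \<lfloor>((bear ^^ q) x) $ i\<rfloor>"])
    show "(bear ^^ q) (y q) - lattice_point (\<chi> i. \<lfloor>((bear ^^ q) x) $ i\<rfloor>) \<in> bear_tile"
      using zero_in_bear_tile by (simp add: y_def mn lattice_point_def)
  qed
  then obtain l where l: "\<And>q. y q - lattice_point (l q) \<in> bear_tile" by metis
  have dist: "norm (y q - x) \<le> 6 / sqrt 2 ^ q" for q
  proof -
    define t where "t = (\<chi> i. of_int \<lfloor>((bear ^^ q) x) $ i\<rfloor>) - (bear ^^ q) x"
    have "norm t \<le> \<bar>t $ 1\<bar> + \<bar>t $ 2\<bar>"
      using norm_le_l1_cart[of t] by (simp add: sum_2)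
    also have "\<dots> \<le> 2" by (simp add: t_def) linarith
    finally have "3 * norm t / sqrt 2 ^ q \<le> 6 / sqrt 2 ^ q" by (intro divide_right_mono) simp_all
    moreover have "y q - x = (unbear ^^ q) t" by (simp add: t_def y_def unbear_funpow_diff mn)
    ultimately show ?thesis using norm_unbear_funpow_le[of q t] by simp
  qed
  have lim: "y \<longlonglongrightarrow> x"
  proof -
    have "(\<lambda>q. y q - x) \<longlonglongrightarrow> 0"
      by (rule Lim_null_comparison[OF _ inverse_sqrt2_power_tendsto_0[of 6]]) (use dist in simp)
    then show ?thesis by (simp add: LIM_zero_iff)
  qed
  obtain R where R: "\<And>z. z \<in> bear_tile \<Longrightarrow> norm z \<le> R" using bounded_bear_tile by (auto simp: bounded_iff)
  \<comment> \<open>All approximants lie within 6 of \<open>x\<close>, so only translates indexed by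
    this finite set can contain them. Finiteness makes their union closed.\<close>
  define F where "F = {k. norm (lattice_point k - x) \<le> R + 6}"
  define C where "C = (\<Union>k\<in>F. (\<lambda>z. z - lattice_point k) -` bear_tile)"
  have "closed C" unfolding C_def F_def
    by (intro closed_UN finite_lattice_ball ballI closed_vimage closed_bear_tile continuous_intros)
  moreover have "y q \<in> C" for q
  proof -
    have "6 / sqrt 2 ^ q \<le> 6" using sqrt2_power_ge_1[of q] by (simp add: divide_simps)
    then have "norm (y q - x) \<le> 6" using dist[of q] by linarith
    moreover have "lattice_point (l q) - x = (y q - x) - (y q - lattice_point (l q))" by simp
    then have "norm (lattice_point (l q) - x) \<le> norm (y q - x) + norm (y q - lattice_point (l q))"
      by (metis norm_triangle_ineq4)
    ultimately have "l q \<in> F" using R[OF l[of q]] by (simp add: F_def)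
    then show ?thesis using l by (auto simp: C_def)
  qed
  ultimately have "x \<in> C" using lim by (rule closed_sequentially)
  then show ?thesis by (auto simp: C_def)
qed

section \<open>Measure of the tile\<close>

lemma bear_tile_borel [measurable]: "bear_tile \<in> sets borel"
  using closed_bear_tile by (rule borel_closed)

lemma emeasure_bear_tile_finite: "emeasure lborel bear_tile < \<infinity>"
  using bounded_bear_tile by (rule emeasure_bounded_finite)

text \<open>Countably many null translates cannot cover the plane. Positivity is what allows the
  spline to be normalised by its integral.\<close>

lemma measure_bear_tile_pos: "0 < measure lborel bear_tile"
proof (rule ccontr)
  assume "\<not> 0 < measure lborel bear_tile"
  then have "emeasure lborel bear_tile = 0"
    using emeasure_bear_tile_finite
    by (simp add: measure_def enn2real_positive_iff)
  then have "bear_tile \<in> null_sets lborel" by (simp add: null_sets_def)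
  then have "AE x in lborel. x \<notin> bear_tile" by (rule AE_not_in)
  then have "AE x in lborel. x + (- lattice_point k) \<notin> bear_tile" for k by (rule AE_translate)
  then have "AE x in lborel. \<forall>k \<in> UNIV. x + (- lattice_point k) \<notin> bear_tile"
    by (intro AE_ball_countable[THEN iffD2]) auto
  then have "AE x in (lborel :: (real ^ 2) measure). False"
    by eventually_elim (use tile_covers in auto)
  then show False using emeasure_lborel_UNIV[where 'a = "real ^ 2"] by (auto simp: AE_iff_null null_sets_def)
qed

section \<open>Bounded measurable functions with bounded support\<close>

definition tame :: "(real ^ 2 \<Rightarrow> 'b::{banach, second_countable_topology}) \<Rightarrow> bool" where
  "tame f \<longleftrightarrow> f \<in> borel_measurable borel \<and>
     (\<exists>C R. \<forall>x. norm (f x) \<le> C \<and> (R < norm x \<longrightarrow> f x = 0))"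

lemma tameI:
  assumes "f \<in> borel_measurable borel" "\<And>x. norm (f x) \<le> C" "\<And>x. R < norm x \<Longrightarrow> f x = 0"
  shows "tame f"
  unfolding tame_def using assms by blast

lemma tameE:
  assumes "tame f"
  obtains C R where "f \<in> borel_measurable borel" "\<And>x. norm (f x) \<le> C" "\<And>x. R < norm x \<Longrightarrow> f x = 0"
    "0 \<le> C" "0 \<le> R"
proof -
  obtain C R where *: "f \<in> borel_measurable borel" "\<And>x. norm (f x) \<le> C" "\<And>x. R < norm x \<Longrightarrow> f x = 0"
    using assms unfolding tame_def by blast
  show ?thesis
    by (rule that[of C "max R 0"]) (use * order_trans[OF norm_ge_zero *(2)] in auto)
qed

lemma tame_measurable [measurable_dest]: "tame f \<Longrightarrow> f \<in> borel_measurable borel"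
  by (simp add: tame_def)

lemma tame_integrable: "tame f \<Longrightarrow> integrable lborel f"
proof (erule tameE)
  fix C R assume f: "f \<in> borel_measurable borel" "\<And>x. norm (f x) \<le> C" "\<And>x. R < norm x \<Longrightarrow> f x = 0"
  show "integrable lborel f"
  proof (rule integrableI_bounded_set[of "cball 0 R" _ _ C])
    show "emeasure lborel (cball 0 R :: (real ^ 2) set) < \<infinity>"
      by (rule emeasure_bounded_finite) simp
  qed (use f in auto)
qed

lemma norm_le_bear: "norm x \<le> 2 * norm (bear x)"
proof (rule power2_le_imp_le)
  show "(norm x)\<^sup>2 \<le> (2 * norm (bear x))\<^sup>2"
    using norm_sq_le_qform[of x] qform_le_norm_sq[of "bear x"] by (simp add: qform_bear power_mult_distrib)
qed simp

lemma tame_compose: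
  assumes f: "tame f" and [measurable]: "h \<in> borel_measurable borel"
    and h: "\<And>x. norm x \<le> a * norm (h x) + b" and "0 \<le> a"
  shows "tame (\<lambda>x. f (h x))"
proof -
  obtain C R where [measurable]: "f \<in> borel_measurable borel"
    and fR: "\<And>x. norm (f x) \<le> C" "\<And>x. R < norm x \<Longrightarrow> f x = 0"
    using tameE[OF f] by metis
  show ?thesis
  proof (rule tameI[of _ C "a * R + b"])
    fix x :: "real ^ 2" assume "a * R + b < norm x"
    then have "a * R < a * norm (h x)" using h[of x] by linarith
    then have "R < norm (h x)" using \<open>0 \<le> a\<close> by (simp add: mult_less_cancel_left)
    then show "f (h x) = 0" by (rule fR(2))
  qed (simp_all add: fR)
qed

lemma tame_bear: "tame f \<Longrightarrow> tame (\<lambda>x. f (bear x))"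
  by (rule tame_compose[of _ _ 2 0]) (use norm_le_bear in auto)

lemma tame_translate: "tame f \<Longrightarrow> tame (\<lambda>x. f (x + a))"
  by (rule tame_compose[of _ _ 1 "norm a"]) (use norm_triangle_ineq4[of "x + a" a for x] in auto)

lemma tame_reflect: "tame f \<Longrightarrow> tame (\<lambda>x. f (a - x))"
  by (rule tame_compose[of _ _ 1 "norm a"]) (use norm_triangle_ineq4[of a "a - x" for x] in \<open>auto simp: add.commute\<close>)

lemma tame_mult_bounded:
  fixes f g :: "real ^ 2 \<Rightarrow> 'b::{banach, second_countable_topology, real_normed_algebra}"
  assumes "tame f" "g \<in> borel_measurable borel" "\<And>x. norm (g x) \<le> D"
  shows "tame (\<lambda>x. f x * g x)"
proof -
  obtain C R where f: "f \<in> borel_measurable borel" "\<And>x. norm (f x) \<le> C" "\<And>x. R < norm x \<Longrightarrow> f x = 0" "0 \<le> C" "0 \<le> R"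
    using tameE[OF \<open>tame f\<close>] by metis
  show ?thesis
  proof (rule tameI[of _ "C * D" R])
    show "norm (f x * g x) \<le> C * D" for x
      using norm_mult_ineq[of "f x" "g x"] mult_mono[OF f(2)[of x] assms(3)[of x] f(4)] by simp
  qed (use f assms(2) in auto)
qed

lemma tame_bounded: "tame f \<Longrightarrow> \<exists>C. \<forall>x. norm (f x) \<le> C"
  by (auto simp: tame_def)

lemma tame_tile: "tame (indicator bear_tile :: real ^ 2 \<Rightarrow> real)"
proof -
  obtain R where R: "\<And>z. z \<in> bear_tile \<Longrightarrow> norm z \<le> R" using bounded_bear_tile by (auto simp: bounded_iff)
  show ?thesis
    by (rule tameI[of _ 1 R]) (use R in \<open>force simp: indicator_def\<close>)+
qed

text \<open>The overlap of the two halves of \<open>bear ` bear_tile\<close> is null because both sides of the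
  self-similarity have the same measure, as \<open>det bear_matrix = 2\<close>.\<close>

lemma bear_tile_refinement:
  "AE x in lborel. indicator bear_tile x =
     (indicator bear_tile (bear x) + indicator bear_tile (bear x + (- e1)) :: real)"
proof -
  let ?c = "indicator bear_tile :: real ^ 2 \<Rightarrow> real"
  let ?d = "\<lambda>x. ?c (bear x) + ?c (bear x + (- e1)) - ?c x"
  have int: "integrable lborel ?c" "integrable lborel (\<lambda>x. ?c (bear x))" "integrable lborel (\<lambda>x. ?c (bear x + (- e1)))"
    by (intro tame_integrable tame_tile tame_bear tame_bear[of "\<lambda>x. ?c (x + (- e1))"] tame_translate)+
  have "(LINT x|lborel. ?c x) = 2 * (LINT x|lborel. ?c (bear x))"
    "(LINT x|lborel. ?c (x + (- e1))) = 2 * (LINT x|lborel. ?c (bear x + (- e1)))"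
    using integral_bear[of ?c] integral_bear[of "\<lambda>x. ?c (x + (- e1))"] by simp_all
  moreover have "(LINT x|lborel. ?c (x + (- e1))) = (LINT x|lborel. ?c x)"
    by (rule integral_translate) simp
  ultimately have "(LINT x|lborel. ?d x) = 0" using int by simp
  \<comment> \<open>The indicator of a union is at most the sum of the indicators; with equal
    integrals the nonnegative defect vanishes almost everywhere.\<close>
  moreover have "0 \<le> ?d x" for x using bear_tile_iff[of x] by (auto simp: indicator_def)
  ultimately have "AE x in lborel. ?d x = 0"
    using int by (subst integral_nonneg_eq_0_iff_AE[symmetric]) auto
  then show ?thesis by eventually_elim simp
qed

section \<open>Tile splines\<close>

lemma lborel_reflect: "distr lborel borel (\<lambda>x. a - x) = lborel" for a :: "real ^ 2"
  using lborel_affine[of "- 1" a, symmetric] by (simp add: density_1)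

lemma integral_reflect:
  fixes f :: "real ^ 2 \<Rightarrow> 'b::{banach, second_countable_topology}"
  assumes "f \<in> borel_measurable borel"
  shows "(LINT x|lborel. f (a - x)) = (LINT x|lborel. f x)"
proof -
  have "(LINT x|lborel. f x) = (LINT x|distr lborel borel (\<lambda>x. a - x). f x)"
    by (simp add: lborel_reflect)
  also have "\<dots> = (LINT x|lborel. f (a - x))"
    using assms by (simp add: integral_distr)
  finally show ?thesis ..
qed

lemma AE_reflect:
  assumes "AE x in lborel. P (x :: real ^ 2)"
  shows "AE x in lborel. P (a - x)"
proof -
  have "AE x in distr lborel borel (\<lambda>x. a - x). P x" using assms by (simp only: lborel_reflect)
  then show ?thesis by (rule AE_distrD[rotated]) simp
qed

lemma tame_convolution_integrand:
  assumes "tame f" "tame g"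
  shows "tame (\<lambda>y. f y * g (x - y) :: real)"
proof -
  obtain C where "\<And>x. norm (g x) \<le> C" using tame_bounded[OF \<open>tame g\<close>] by blast
  then show ?thesis
    using assms by (intro tame_mult_bounded) (auto dest!: tame_measurable)
qed

text \<open>The estimate of a convolution by a supremum times an integral, uniform in
  \<open>x\<close>: approximation of the kernel in mean becomes uniform approximation of the
  convolution.\<close>

lemma convolution_diff_le:
  assumes f: "tame f" "\<And>x. \<bar>f x\<bar> \<le> C" and g: "tame g" and h: "tame h"
  shows "\<bar>convolution f g x - convolution f h x\<bar> \<le> C * (LINT y|lborel. \<bar>g y - h y\<bar>)"
proof -
  have [measurable]: "g \<in> borel_measurable borel" "h \<in> borel_measurable borel"
    using g h by (auto dest: tame_measurable)
  have gh: "integrable lborel (\<lambda>y. g (x - y) - h (x - y))"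
    using g h by (intro Bochner_Integration.integrable_diff tame_integrable tame_reflect)
  have "convolution f g x - convolution f h x = (LINT y|lborel. f y * g (x - y) - f y * h (x - y))"
    unfolding convolution_def
    by (intro Bochner_Integration.integral_diff[symmetric] tame_integrable tame_convolution_integrand f g h)
  also have "\<bar>\<dots>\<bar> \<le> (LINT y|lborel. C * \<bar>g (x - y) - h (x - y)\<bar>)"
    unfolding real_norm_def[symmetric]
  proof (rule Bochner_Integration.integral_norm_bound_integral)
    show "integrable lborel (\<lambda>y. f y * g (x - y) - f y * h (x - y))"
      by (intro Bochner_Integration.integrable_diff tame_integrable tame_convolution_integrand f g h)
    show "integrable lborel (\<lambda>y. C * norm (g (x - y) - h (x - y)))"
      using gh by simp
    show "norm (f y * g (x - y) - f y * h (x - y)) \<le> C * norm (g (x - y) - h (x - y))" for y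
      unfolding right_diff_distrib[symmetric] real_norm_def abs_mult using f(2) by (rule mult_right_mono) simp
  qed
  also have "\<dots> = C * (LINT y|lborel. \<bar>g (x - y) - h (x - y)\<bar>)" by simp
  also have "(LINT y|lborel. \<bar>g (x - y) - h (x - y)\<bar>) = (LINT y|lborel. \<bar>g y - h y\<bar>)"
    by (rule integral_reflect) measurable
  finally show ?thesis .
qed

lemma continuous_convolution_Lipschitz:
  assumes f: "tame f" and g: "tame g" "\<And>x y. \<bar>g x - g y\<bar> \<le> L * norm (x - y)"
  shows "continuous_on UNIV (convolution f g)"
proof -
  have fi: "integrable lborel f" using f by (rule tame_integrable)
  have "\<bar>convolution f g x - convolution f g x'\<bar> \<le> L * norm (x - x') * (LINT y|lborel. \<bar>f y\<bar>)" for x x'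
  proof -
    have "convolution f g x - convolution f g x' = (LINT y|lborel. f y * g (x - y) - f y * g (x' - y))"
      unfolding convolution_def
      by (intro Bochner_Integration.integral_diff[symmetric] tame_integrable tame_convolution_integrand f g)
    also have "\<bar>\<dots>\<bar> \<le> (LINT y|lborel. L * norm (x - x') * \<bar>f y\<bar>)"
      unfolding real_norm_def[symmetric]
    proof (rule Bochner_Integration.integral_norm_bound_integral)
      show "integrable lborel (\<lambda>y. f y * g (x - y) - f y * g (x' - y))"
        by (intro Bochner_Integration.integrable_diff tame_integrable tame_convolution_integrand f g)
      show "integrable lborel (\<lambda>y. L * norm (x - x') * norm (f y))" using fi by simp
      show "norm (f y * g (x - y) - f y * g (x' - y)) \<le> L * norm (x - x') * norm (f y)" for y
        using mult_right_mono[OF g(2)[of "x - y" "x' - y"], of "\<bar>f y\<bar>"]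
        by (simp add: right_diff_distrib[symmetric] abs_mult mult.commute)
    qed
    finally show ?thesis by simp
  qed
  then have "dist (convolution f g x) (convolution f g x') \<le> L * (LINT y|lborel. \<bar>f y\<bar>) * dist x x'" for x x'
    by (simp add: dist_norm mult_ac)
  moreover have "0 \<le> L"
    using order_trans[OF abs_ge_zero g(2)[of 0 e1]] by (simp add: norm_e1)
  ultimately have "(L * (LINT y|lborel. \<bar>f y\<bar>))-lipschitz_on UNIV (convolution f g)"
    by (intro lipschitz_onI) auto
  then show ?thesis by (rule lipschitz_on_continuous_on)
qed

text \<open>The indicator of the tile is an \<open>L\<^sup>1\<close> limit of Lipschitz functions.\<close>

lemma continuous_convolution_tile:
  assumes f: "tame f"
  shows "continuous_on UNIV (convolution f (indicator bear_tile))"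
proof -
  obtain C where C: "\<And>x. \<bar>f x\<bar> \<le> C" using tame_bounded[OF f] by auto
  obtain R where R: "\<And>z. z \<in> bear_tile \<Longrightarrow> norm z \<le> R" using bounded_bear_tile by (auto simp: bounded_iff)
  \<comment> \<open>Truncated distance functions of slope m + 1. Because the tile is closed they
    tend pointwise to its indicator, and they are supported in its 1-neighbourhood for every
    m.\<close>
  define \<psi> where "\<psi> m x = max 0 (1 - real (Suc m) * infdist x bear_tile)" for m x
  let ?c = "indicator bear_tile :: real ^ 2 \<Rightarrow> real"
  have in_tile: "x \<in> bear_tile \<longleftrightarrow> infdist x bear_tile = 0" for x
    using in_closed_iff_infdist_zero[OF closed_bear_tile] zero_in_bear_tile by blast
  have meas: "\<psi> m \<in> borel_measurable borel" for m
    unfolding \<psi>_def by (intro borel_measurable_continuous_onI continuous_intros)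
  have bnd: "norm (\<psi> m x) \<le> 1" for m x
    by (simp add: \<psi>_def infdist_nonneg)
  have supp: "\<psi> m x = 0" if "R + 1 < norm x" for m x
  proof -
    have ne: "bear_tile \<noteq> {}" using zero_in_bear_tile by blast
    have "1 \<le> infdist x bear_tile"
      unfolding infdist_notempty[OF ne]
    proof (rule cINF_greatest[OF ne])
      fix z assume "z \<in> bear_tile"
      then show "1 \<le> dist x z" using R[of z] that norm_triangle_ineq2[of x z] by (simp add: dist_norm)
    qed
    then have "1 \<le> real (Suc m) * infdist x bear_tile"
      using mult_mono[of 1 "real (Suc m)" 1 "infdist x bear_tile"] by simp
    then show ?thesis by (simp add: \<psi>_def)
  qed
  have tame\<psi>: "tame (\<psi> m)" for m by (rule tameI[OF meas bnd supp])
  have lip: "\<bar>\<psi> m x - \<psi> m y\<bar> \<le> real (Suc m) * norm (x - y)" for m x y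
  proof -
    have "\<bar>infdist x bear_tile - infdist y bear_tile\<bar> \<le> norm (x - y)"
      using infdist_triangle_abs[of x bear_tile y] by (simp add: dist_norm)
    then have "\<bar>real (Suc m) * infdist x bear_tile - real (Suc m) * infdist y bear_tile\<bar> \<le> real (Suc m) * norm (x - y)"
      unfolding right_diff_distrib[symmetric] abs_mult by (simp add: mult_left_mono)
    moreover have "\<bar>max 0 (1 - a) - max 0 (1 - b)\<bar> \<le> \<bar>a - b\<bar>" for a b :: real by linarith
    ultimately show ?thesis unfolding \<psi>_def by (rule order_trans[rotated])
  qed
  have pt: "(\<lambda>m. \<psi> m x) \<longlonglongrightarrow> ?c x" for x
  proof (cases "x \<in> bear_tile")
    case True
    then show ?thesis using in_tile by (simp add: \<psi>_def)
  next
    case False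
    then have p: "0 < infdist x bear_tile" using in_tile infdist_nonneg[of x bear_tile] by force
    obtain N :: nat where N: "1 / infdist x bear_tile < N" using reals_Archimedean2 by blast
    have "\<psi> m x = ?c x" if "N \<le> m" for m
    proof -
      have "1 / infdist x bear_tile < real (Suc m)" using N that by linarith
      then have "1 < real (Suc m) * infdist x bear_tile" using p by (simp add: divide_less_eq)
      then show ?thesis using False by (simp add: \<psi>_def)
    qed
    then show ?thesis by (intro tendsto_eventually) (auto simp: eventually_sequentially)
  qed
  have lim: "(\<lambda>m. LINT y|lborel. \<bar>?c y - \<psi> m y\<bar>) \<longlonglongrightarrow> (LINT y|(lborel :: (real ^ 2) measure). (0 :: real))"
  proof (rule integral_dominated_convergence[where w = "\<lambda>y. 2 * indicator (cball 0 (R + 1)) y"])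
    show "integrable lborel (\<lambda>y :: real ^ 2. 2 * indicator (cball 0 (R + 1)) y :: real)"
      by (intro tame_integrable tameI[of _ 2 "R + 1"]) (auto simp: indicator_def)
    show "AE y in lborel. (\<lambda>m. \<bar>?c y - \<psi> m y\<bar>) \<longlonglongrightarrow> 0"
    proof (rule AE_I2)
      fix y
      have "(\<lambda>m. \<bar>?c y - \<psi> m y\<bar>) \<longlonglongrightarrow> \<bar>?c y - ?c y\<bar>" by (intro tendsto_intros pt)
      then show "(\<lambda>m. \<bar>?c y - \<psi> m y\<bar>) \<longlonglongrightarrow> 0" by simp
    qed
    show "AE y in lborel. norm \<bar>?c y - \<psi> m y\<bar> \<le> 2 * indicator (cball 0 (R + 1)) y" for m
    proof (rule AE_I2)
      fix y show "norm \<bar>?c y - \<psi> m y\<bar> \<le> 2 * indicator (cball 0 (R + 1)) y"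
      proof (cases "norm y \<le> R + 1")
        case True
        then show ?thesis using bnd[of m y] by (auto simp: indicator_def)
      next
        case False
        then show ?thesis using supp[of y m] R[of y] by (auto simp: indicator_def)
      qed
    qed
  qed (use meas in measurable)
  have "uniform_limit UNIV (\<lambda>m. convolution f (\<psi> m)) (convolution f ?c) sequentially"
  proof (rule uniform_limitI)
    fix e :: real assume "0 < e"
    have "(\<lambda>m. C * (LINT y|lborel. \<bar>?c y - \<psi> m y\<bar>)) \<longlonglongrightarrow> C * 0"
      using lim by (intro tendsto_mult tendsto_const) simp
    then have "\<forall>\<^sub>F m in sequentially. C * (LINT y|lborel. \<bar>?c y - \<psi> m y\<bar>) < e"
      using \<open>0 < e\<close> by (intro order_tendstoD) simp_all
    then show "\<forall>\<^sub>F m in sequentially. \<forall>x\<in>UNIV. dist (convolution f (\<psi> m) x) (convolution f ?c x) < e"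
    proof eventually_elim
      fix m assume m: "C * (LINT y|lborel. \<bar>?c y - \<psi> m y\<bar>) < e"
      show "\<forall>x\<in>UNIV. dist (convolution f (\<psi> m) x) (convolution f ?c x) < e"
        using le_less_trans[OF convolution_diff_le[OF f C tame_tile tame\<psi>] m]
        by (simp add: dist_real_def abs_minus_commute)
    qed
  qed
  then show ?thesis
    by (rule uniform_limit_theorem[rotated]) (simp_all add: continuous_convolution_Lipschitz[OF f tame\<psi> lip])
qed

lemma tame_convolution_tile:
  assumes f: "tame f"
  shows "tame (convolution f (indicator bear_tile))"
proof -
  obtain C R where fR: "\<And>x. norm (f x) \<le> C" "\<And>x. R < norm x \<Longrightarrow> f x = 0" "0 \<le> C" "0 \<le> R"
    using tameE[OF f] by metis
  obtain R' where R': "\<And>z. z \<in> bear_tile \<Longrightarrow> norm z \<le> R'" using bounded_bear_tile by (auto simp: bounded_iff)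
  let ?c = "indicator bear_tile :: real ^ 2 \<Rightarrow> real"
  have z: "tame (\<lambda>_. 0 :: real)" by (rule tameI[of _ 0 0]) simp_all
  show ?thesis
  proof (rule tameI)
    show "convolution f ?c \<in> borel_measurable borel"
      by (intro borel_measurable_continuous_onI continuous_convolution_tile f)
    show "norm (convolution f ?c x) \<le> C * (LINT y|lborel. \<bar>?c y - 0\<bar>)" for x
      using convolution_diff_le[OF f _ tame_tile z, of C x] fR(1) by (simp add: convolution_def)
    fix x :: "real ^ 2" assume x: "R + R' < norm x"
    have "f y * ?c (x - y) = 0" for y
    proof (cases "R < norm y")
      case False
      then have "R' < norm (x - y)" using x norm_triangle_ineq2[of x y] by linarith
      then show ?thesis using R'[of "x - y"] by (auto simp: indicator_def)
    qed (use fR in simp)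
    then have "(\<lambda>y. f y * ?c (x - y)) = (\<lambda>_. 0)" by auto
    then show "convolution f ?c x = 0" by (simp add: convolution_def)
  qed
qed

section \<open>The refinement equation of the splines\<close>

abbreviation "spline n \<equiv> tile_bspline bear_tile n"

lemma tame_spline: "tame (spline n)"
  by (induction n) (simp_all add: tame_tile tame_convolution_tile)

lemma continuous_spline: "continuous_on UNIV (spline (Suc n))"
  by (simp add: continuous_convolution_tile tame_spline)

text \<open>Pascal's rule: on coefficients, (1 + z)^m (1 + z) = (1 + z)^(m + 1).\<close>

lemma binomial_shift_sum:
  fixes X :: "nat \<Rightarrow> real"
  shows "(\<Sum>j\<le>m. real (m choose j) * (X j + X (Suc j))) = (\<Sum>j\<le>Suc m. real (Suc m choose j) * X j)"
proof -
  have "(\<Sum>j\<le>Suc m. real (Suc m choose j) * X j) = X 0 + (\<Sum>j\<le>m. real (Suc m choose Suc j) * X (Suc j))"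
    by (subst sum.atMost_Suc_shift) simp
  also have "\<dots> = (\<Sum>j\<le>m. real (m choose j) * X (Suc j)) + (X 0 + (\<Sum>j\<le>m. real (m choose Suc j) * X (Suc j)))"
    by (simp add: distrib_right sum.distrib)
  also have "X 0 + (\<Sum>j\<le>m. real (m choose Suc j) * X (Suc j)) = (\<Sum>j\<le>Suc m. real (m choose j) * X j)"
    using sum.atMost_Suc_shift[of "\<lambda>j. real (m choose j) * X j" m] by (simp del: sum.atMost_Suc)
  also have "\<dots> = (\<Sum>j\<le>m. real (m choose j) * X j)" by simp
  finally show ?thesis by (simp add: distrib_left sum.distrib)
qed

text \<open>Both factors of the convolution are refined under the integral and the substitution by M
  contributes 1/2, so 2^(-n) becomes 2^(-(n+1)). An almost everywhere identity suffices under the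
  integral, while the conclusion holds at every point.\<close>

lemma spline_refinement_step:
  assumes "AE x in lborel. spline n x = (\<Sum>j\<le>n + 1. real ((n + 1) choose j) / 2 ^ n * spline n (bear x - real j *\<^sub>R e1))"
  shows "spline (Suc n) x = (\<Sum>j\<le>Suc n + 1. real ((Suc n + 1) choose j) / 2 ^ Suc n * spline (Suc n) (bear x - real j *\<^sub>R e1))"
proof -
  let ?c = "indicator bear_tile :: real ^ 2 \<Rightarrow> real"
  let ?b = "\<lambda>j. real ((n + 1) choose j) / 2 ^ n"
  define T where "T j z = spline n (z - real j *\<^sub>R e1) * (?c (bear x - z) + ?c (bear x - e1 - z))" for j z
  have [measurable]: "spline n \<in> borel_measurable borel" using tame_spline by (rule tame_measurable)
  have Tmeas [measurable]: "T j \<in> borel_measurable borel" for j unfolding T_def by measurable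
  have cptT: "tame (T j)" for j
    unfolding T_def using tame_translate[OF tame_spline, of n "- (real j *\<^sub>R e1)"]
    by (intro tame_mult_bounded[of _ _ 2]) (auto simp: indicator_def)
  have "spline (Suc n) x = (LINT y|lborel. spline n y * ?c (x - y))" by (simp add: convolution_def)
  also have "\<dots> = (LINT y|lborel. (\<Sum>j\<le>n + 1. ?b j * T j (bear y)))"
  proof (rule integral_cong_AE)
    show "(\<lambda>y. spline n y * ?c (x - y)) \<in> borel_measurable lborel" by measurable
    show "(\<lambda>y. \<Sum>j\<le>n + 1. ?b j * T j (bear y)) \<in> borel_measurable lborel" by measurable
    show "AE y in lborel. spline n y * ?c (x - y) = (\<Sum>j\<le>n + 1. ?b j * T j (bear y))"
      using assms AE_reflect[OF bear_tile_refinement, of x]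
    proof eventually_elim
      fix y assume 1: "spline n y = (\<Sum>j\<le>n + 1. ?b j * spline n (bear y - real j *\<^sub>R e1))"
        and 2: "?c (x - y) = ?c (bear (x - y)) + ?c (bear (x - y) + - e1)"
      have "bear (x - y) + - e1 = bear x - e1 - bear y" "bear (x - y) = bear x - bear y"
        by (simp_all add: linear_diff[OF linear_bear])
      then have "spline n y * ?c (x - y) = (\<Sum>j\<le>n + 1. ?b j * spline n (bear y - real j *\<^sub>R e1)) * (?c (bear x - bear y) + ?c (bear x - e1 - bear y))"
        using 1 2 by (simp only:)
      then show "spline n y * ?c (x - y) = (\<Sum>j\<le>n + 1. ?b j * T j (bear y))"
        unfolding T_def sum_distrib_right by (simp add: mult.assoc)
    qed
  qed
  also have "\<dots> = (\<Sum>j\<le>n + 1. ?b j * (LINT y|lborel. T j (bear y)))"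
    using tame_integrable[OF tame_bear[OF cptT]] by simp
  also have "\<dots> = (\<Sum>j\<le>n + 1. ?b j / 2 * (spline (Suc n) (bear x - real j *\<^sub>R e1) + spline (Suc n) (bear x - real (Suc j) *\<^sub>R e1)))"
  proof (intro sum.cong refl)
    fix j
    have "2 * (LINT y|lborel. T j (bear y)) = (LINT z|lborel. T j z)"
      using integral_bear[OF Tmeas, of j] by simp
    also have "\<dots> = (LINT z|lborel. T j (z + real j *\<^sub>R e1))"
      by (rule integral_translate[symmetric]) measurable
    also have "\<dots> = (LINT z|lborel. spline n z * ?c (bear x - real j *\<^sub>R e1 - z) + spline n z * ?c (bear x - real (Suc j) *\<^sub>R e1 - z))"
      by (simp add: T_def algebra_simps)
    also have "\<dots> = spline (Suc n) (bear x - real j *\<^sub>R e1) + spline (Suc n) (bear x - real (Suc j) *\<^sub>R e1)"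
      unfolding tile_bspline.simps convolution_def
      by (intro Bochner_Integration.integral_add tame_integrable tame_convolution_integrand tame_spline tame_tile)
    finally have e: "2 * (LINT y|lborel. T j (bear y)) = spline (Suc n) (bear x - real j *\<^sub>R e1) + spline (Suc n) (bear x - real (Suc j) *\<^sub>R e1)" .
    show "?b j * (LINT y|lborel. T j (bear y)) = ?b j / 2 * (spline (Suc n) (bear x - real j *\<^sub>R e1) + spline (Suc n) (bear x - real (Suc j) *\<^sub>R e1))"
      unfolding e[symmetric] by simp
  qed
  also have "\<dots> = (\<Sum>j\<le>n + 1. real ((n + 1) choose j) * (spline (Suc n) (bear x - real j *\<^sub>R e1) + spline (Suc n) (bear x - real (Suc j) *\<^sub>R e1))) / 2 ^ Suc n"
    unfolding sum_divide_distrib by (intro sum.cong) (simp_all add: mult.commute)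
  also have "\<dots> = (\<Sum>j\<le>Suc n + 1. real ((Suc n + 1) choose j) * spline (Suc n) (bear x - real j *\<^sub>R e1)) / 2 ^ Suc n"
    using binomial_shift_sum[of "n + 1" "\<lambda>j. spline (Suc n) (bear x - real j *\<^sub>R e1)"] by simp
  also have "\<dots> = (\<Sum>j\<le>Suc n + 1. real ((Suc n + 1) choose j) / 2 ^ Suc n * spline (Suc n) (bear x - real j *\<^sub>R e1))"
    unfolding sum_divide_distrib by (intro sum.cong) simp_all
  finally show ?thesis .
qed

lemma spline_refinement_AE:
  "AE x in lborel. spline n x = (\<Sum>j\<le>n + 1. real ((n + 1) choose j) / 2 ^ n * spline n (bear x - real j *\<^sub>R e1))"
proof (induction n)
  case 0
  have two: "(\<Sum>j\<le>0 + 1. g j) = g 0 + g 1" for g :: "nat \<Rightarrow> real" by simp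
  show ?case unfolding two using bear_tile_refinement by eventually_elim simp
next
  case (Suc n)
  show ?case by (rule AE_I2) (rule spline_refinement_step[OF Suc])
qed

lemmas spline_refinement = spline_refinement_step[OF spline_refinement_AE]

section \<open>Contraction of the difference schemes\<close>

text \<open>Sequences are written in the lattice basis \<open>e\<^sub>1, M e\<^sub>1\<close>. Subdivision maps a difference along
  \<open>e\<^sub>1\<close>, together with one factor of the mask, to a difference along \<open>e\<^sub>1 - M e\<^sub>1\<close>, since
  \<open>2 e\<^sub>1 = M (e\<^sub>1 - M e\<^sub>1)\<close>. Hence, separately at each parity of the first index, the products
  of differences below are small combinations of each other. Their weights come from a
  linear program and make the order \<open>n + 1\<close> differences contract faster than \<open>2 powr (- n / 2)\<close>.\<close>

definition dif :: "int \<Rightarrow> int \<Rightarrow> (int \<Rightarrow> int \<Rightarrow> real) \<Rightarrow> int \<Rightarrow> int \<Rightarrow> real" where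
  "dif s t u i j = u (i + s) (j + t) - u i j"

abbreviation "dX \<equiv> dif 1 0"
abbreviation "dY \<equiv> dif 0 1"
abbreviation "dZ \<equiv> dif 1 (- 1)"
abbreviation "dW \<equiv> dif 2 (- 1)"

definition bounded_by :: "real \<Rightarrow> (int \<Rightarrow> int \<Rightarrow> real) \<Rightarrow> bool" where
  "bounded_by c v \<longleftrightarrow> (\<forall>i j. \<bar>v i j\<bar> \<le> c)"

lemma bounded_byD: "bounded_by c v \<Longrightarrow> \<bar>v i j\<bar> \<le> c"
  by (simp add: bounded_by_def)

text \<open>In the basis e1, M e1 the point M (i e1 + j M e1) has coordinates (-2 j, i + j), by M^2
  = M - 2. The two hypotheses are therefore the two cosets of the image of the lattice, on which
  subdivision has different coefficients.\<close>

lemma bounded_by_parity: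
  assumes "\<And>i j. \<bar>v (- (2 * j)) (i + j)\<bar> \<le> c" "\<And>i j. \<bar>v (1 - 2 * j) (i + j)\<bar> \<le> c"
  shows "bounded_by c v"
  unfolding bounded_by_def
proof (intro allI)
  fix A B :: int
  show "\<bar>v A B\<bar> \<le> c"
  proof (cases "even A")
    case True
    then have "A = - (2 * (- (A div 2)))" by simp
    then show ?thesis using assms(1)[of "- (A div 2)" "B + A div 2"] by simp
  next
    case False
    then have "A = 1 - 2 * (- (A div 2))" using odd_two_times_div_two_succ[of A] by linarith
    then show ?thesis using assms(2)[of "- (A div 2)" "B + A div 2"] by simp
  qed
qed

lemma div_shift:
  fixes j :: int
  shows "(- (2 * j)) div 2 = - j" "(1 - 2 * j) div 2 = - j" "(2 - 2 * j) div 2 = 1 - j"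
    "(3 - 2 * j) div 2 = 1 - j" "(4 - 2 * j) div 2 = 2 - j" "(5 - 2 * j) div 2 = 2 - j"
    "(6 - 2 * j) div 2 = 3 - j"
  by presburger+

section \<open>Third differences under the mask (1, 3, 3, 1) / 4\<close>

definition subdivide2 :: "(int \<Rightarrow> int \<Rightarrow> real) \<Rightarrow> int \<Rightarrow> int \<Rightarrow> real" where
  "subdivide2 u A B = (let j = - (A div 2); i = B - j in
     if even A then u i j / 4 + 3 * u (i - 1) (j + 1) / 4
     else 3 * u i j / 4 + u (i - 1) (j + 1) / 4)"

lemma subdivide2_simps:
  "subdivide2 u (- (2 * j)) B = u (B - j) j / 4 + 3 * u (B - j - 1) (j + 1) / 4"
  "subdivide2 u (1 - 2 * j) B = 3 * u (B - j) j / 4 + u (B - j - 1) (j + 1) / 4"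
  "subdivide2 u (2 - 2 * j) B = u (B - j + 1) (j - 1) / 4 + 3 * u (B - j) j / 4"
  "subdivide2 u (3 - 2 * j) B = 3 * u (B - j + 1) (j - 1) / 4 + u (B - j) j / 4"
  "subdivide2 u (4 - 2 * j) B = u (B - j + 2) (j - 2) / 4 + 3 * u (B - j + 1) (j - 1) / 4"
  "subdivide2 u (5 - 2 * j) B = 3 * u (B - j + 2) (j - 2) / 4 + u (B - j + 1) (j - 1) / 4"
  by (simp_all add: subdivide2_def Let_def div_shift; simp add: algebra_simps)+

definition diff_bounds2 :: "real \<Rightarrow> (int \<Rightarrow> int \<Rightarrow> real) \<Rightarrow> bool" where
  "diff_bounds2 K u \<longleftrightarrow>
     bounded_by (65 * K) (dX (dX (dX u))) \<and>
     bounded_by (40 * K) (dX (dX (dY u))) \<and>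
     bounded_by (50 * K) (dX (dX (dZ u))) \<and>
     bounded_by (51 * K) (dX (dY (dY u))) \<and>
     bounded_by (52 * K) (dX (dY (dZ u))) \<and>
     bounded_by (79 * K) (dX (dZ (dZ u))) \<and>
     bounded_by (131 * K) (dY (dY (dY u))) \<and>
     bounded_by (106 * K) (dY (dY (dZ u))) \<and>
     bounded_by (99 * K) (dY (dZ (dZ u))) \<and>
     bounded_by (127 * K) (dZ (dZ (dZ u)))"

text \<open>For each of the ten cubic products, the weights on the right-hand side of its identity,
  divided by 4, amount to at most 0.497 times its own weight. The product XXZ shows how tight the
  choice is: 99 / 4 = 24.75 against 24.85.\<close>

lemma diff_bounds2_step:
  assumes "diff_bounds2 K u"
  shows "diff_bounds2 (497 / 1000 * K) (subdivide2 u)"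
proof -
  have K: "0 \<le> K"
    using assms bounded_byD[of "65 * K" "dX (dX (dX u))" 0 0] by (simp add: diff_bounds2_def)
  have b: "\<And>i j. \<bar>dX (dX (dX u)) i j\<bar> \<le> 65 * K"
    "\<And>i j. \<bar>dX (dX (dY u)) i j\<bar> \<le> 40 * K"
    "\<And>i j. \<bar>dX (dX (dZ u)) i j\<bar> \<le> 50 * K"
    "\<And>i j. \<bar>dX (dY (dY u)) i j\<bar> \<le> 51 * K"
    "\<And>i j. \<bar>dX (dY (dZ u)) i j\<bar> \<le> 52 * K"
    "\<And>i j. \<bar>dX (dZ (dZ u)) i j\<bar> \<le> 79 * K"
    "\<And>i j. \<bar>dY (dY (dY u)) i j\<bar> \<le> 131 * K"
    "\<And>i j. \<bar>dY (dY (dZ u)) i j\<bar> \<le> 106 * K"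
    "\<And>i j. \<bar>dY (dZ (dZ u)) i j\<bar> \<le> 99 * K"
    "\<And>i j. \<bar>dZ (dZ (dZ u)) i j\<bar> \<le> 127 * K"
    using assms by (simp_all add: diff_bounds2_def bounded_by_def)
  let ?K = "497 / 1000 * K"
  let ?v = "dX (dX (dX (subdivide2 u)))"
  have c1: "bounded_by (65 * ?K) ?v"
  proof (rule bounded_by_parity)
    fix i j :: int
    \<comment> \<open>Here (z - 1)^3 (1 + z)^3 = (z^2 - 1)^3 is supported on one coset only, and
      z^2, a step by 2 e1 = M (e1 - M e1), is a step along Z before subdivision.\<close>
    have "4 * ?v (- (2 * j)) (i + j) = 0"
      "4 * ?v (1 - 2 * j) (i + j) = dZ (dZ (dZ u)) (i - 1) (j + 1)"
      by (simp add: dif_def subdivide2_simps; simp add: ac_simps; linarith?)+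
    then show "\<bar>?v (- (2 * j)) (i + j)\<bar> \<le> 65 * ?K" "\<bar>?v (1 - 2 * j) (i + j)\<bar> \<le> 65 * ?K"
      using K b(10)[of "i - 1" "j + 1"]
      unfolding abs_le_iff by linarith+
  qed
  let ?v = "dX (dX (dY (subdivide2 u)))"
  have c2: "bounded_by (40 * ?K) ?v"
  proof (rule bounded_by_parity)
    fix i j :: int
    have "4 * ?v (- (2 * j)) (i + j) = dX (dZ (dZ u)) (i - 1) (j + 1)"
      "4 * ?v (1 - 2 * j) (i + j) = dX (dZ (dZ u)) (i - 1) (j + 1)"
      by (simp add: dif_def subdivide2_simps; simp add: ac_simps; linarith?)+
    then show "\<bar>?v (- (2 * j)) (i + j)\<bar> \<le> 40 * ?K" "\<bar>?v (1 - 2 * j) (i + j)\<bar> \<le> 40 * ?K"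
      using K b(6)[of "i - 1" "j + 1"]
      unfolding abs_le_iff by linarith+
  qed
  let ?v = "dX (dX (dZ (subdivide2 u)))"
  have c3: "bounded_by (50 * ?K) ?v"
  proof (rule bounded_by_parity)
    fix i j :: int
    have "4 * ?v (- (2 * j)) (i + j) = - dX (dZ (dZ u)) (i - 2) (j + 1)"
      "4 * ?v (1 - 2 * j) (i + j) = - dY (dZ (dZ u)) (i - 1) j"
      by (simp add: dif_def subdivide2_simps; simp add: ac_simps; linarith?)+
    then show "\<bar>?v (- (2 * j)) (i + j)\<bar> \<le> 50 * ?K" "\<bar>?v (1 - 2 * j) (i + j)\<bar> \<le> 50 * ?K"
      using K b(6)[of "i - 2" "j + 1"] b(9)[of "i - 1" "j"]
      unfolding abs_le_iff by linarith+
  qed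
  let ?v = "dX (dY (dY (subdivide2 u)))"
  have c4: "bounded_by (51 * ?K) ?v"
  proof (rule bounded_by_parity)
    fix i j :: int
    have "4 * ?v (- (2 * j)) (i + j) = 2 * dX (dX (dZ u)) (i - 1) (j + 1)"
      "4 * ?v (1 - 2 * j) (i + j) = dX (dX (dZ u)) i j + dX (dX (dZ u)) (i - 1) (j + 1)"
      by (simp add: dif_def subdivide2_simps; simp add: ac_simps; linarith?)+
    then show "\<bar>?v (- (2 * j)) (i + j)\<bar> \<le> 51 * ?K" "\<bar>?v (1 - 2 * j) (i + j)\<bar> \<le> 51 * ?K"
      using K b(3)[of "i - 1" "j + 1"] b(3)[of "i" "j"]
      unfolding abs_le_iff by linarith+
  qed
  let ?v = "dX (dY (dZ (subdivide2 u)))"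
  have c5: "bounded_by (52 * ?K) ?v"
  proof (rule bounded_by_parity)
    fix i j :: int
    have "4 * ?v (- (2 * j)) (i + j) = - dX (dX (dZ u)) (i - 2) (j + 1)
        - dX (dY (dZ u)) (i - 1) j"
      "4 * ?v (1 - 2 * j) (i + j) = - dX (dX (dZ u)) (i - 1) j - dX (dY (dZ u)) (i - 1) j"
      by (simp add: dif_def subdivide2_simps; simp add: ac_simps; linarith?)+
    then show "\<bar>?v (- (2 * j)) (i + j)\<bar> \<le> 52 * ?K" "\<bar>?v (1 - 2 * j) (i + j)\<bar> \<le> 52 * ?K"
      using K b(3)[of "i - 2" "j + 1"] b(5)[of "i - 1" "j"] b(3)[of "i - 1" "j"]
      unfolding abs_le_iff by linarith+
  qed
  let ?v = "dX (dZ (dZ (subdivide2 u)))"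
  have c6: "bounded_by (79 * ?K) ?v"
  proof (rule bounded_by_parity)
    fix i j :: int
    have "4 * ?v (- (2 * j)) (i + j) = 2 * dX (dY (dZ u)) (i - 2) j"
      "4 * ?v (1 - 2 * j) (i + j) = dX (dX (dZ u)) (i - 2) j + dY (dY (dZ u)) (i - 1) (j - 1)"
      by (simp add: dif_def subdivide2_simps; simp add: ac_simps; linarith?)+
    then show "\<bar>?v (- (2 * j)) (i + j)\<bar> \<le> 79 * ?K" "\<bar>?v (1 - 2 * j) (i + j)\<bar> \<le> 79 * ?K"
      using K b(5)[of "i - 2" "j"] b(3)[of "i - 2" "j"] b(8)[of "i - 1" "j - 1"]
      unfolding abs_le_iff by linarith+
  qed
  let ?v = "dY (dY (dY (subdivide2 u)))"
  have c7: "bounded_by (131 * ?K) ?v"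
  proof (rule bounded_by_parity)
    fix i j :: int
    \<comment> \<open>A step along M e1 is the image of a step along e1, so YYY after subdivision is
      the subdivision of XXX and no mask factor is consumed.\<close>
    have "4 * ?v (- (2 * j)) (i + j) = dX (dX (dX u)) i j
        + 3 * dX (dX (dX u)) (i - 1) (j + 1)"
      "4 * ?v (1 - 2 * j) (i + j) = 3 * dX (dX (dX u)) i j + dX (dX (dX u)) (i - 1) (j + 1)"
      by (simp add: dif_def subdivide2_simps; simp add: ac_simps; linarith?)+
    then show "\<bar>?v (- (2 * j)) (i + j)\<bar> \<le> 131 * ?K" "\<bar>?v (1 - 2 * j) (i + j)\<bar> \<le> 131 * ?K"
      using K b(1)[of "i" "j"] b(1)[of "i - 1" "j + 1"]
      unfolding abs_le_iff by linarith+
  qed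
  let ?v = "dY (dY (dZ (subdivide2 u)))"
  have c8: "bounded_by (106 * ?K) ?v"
  proof (rule bounded_by_parity)
    fix i j :: int
    have "4 * ?v (- (2 * j)) (i + j) = - dX (dX (dX u)) (i - 1) j
        - dX (dX (dX u)) (i - 2) (j + 1) - 2 * dX (dX (dY u)) (i - 1) j"
      "4 * ?v (1 - 2 * j) (i + j) = - 2 * dX (dX (dX u)) (i - 1) j
        - dX (dX (dY u)) (i) (j - 1) - dX (dX (dY u)) (i - 1) j"
      by (simp add: dif_def subdivide2_simps; simp add: ac_simps; linarith?)+
    then show "\<bar>?v (- (2 * j)) (i + j)\<bar> \<le> 106 * ?K" "\<bar>?v (1 - 2 * j) (i + j)\<bar> \<le> 106 * ?K"
      using K b(1)[of "i - 1" "j"] b(1)[of "i - 2" "j + 1"] b(2)[of "i - 1" "j"]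
        b(2)[of "i" "j - 1"]
      unfolding abs_le_iff by linarith+
  qed
  let ?v = "dY (dZ (dZ (subdivide2 u)))"
  have c9: "bounded_by (99 * ?K) ?v"
  proof (rule bounded_by_parity)
    fix i j :: int
    have "4 * ?v (- (2 * j)) (i + j) = dX (dX (dX u)) (i - 2) j
        + 2 * dX (dX (dY u)) (i - 2) j + dX (dY (dY u)) (i - 1) (j - 1)"
      "4 * ?v (1 - 2 * j) (i + j) = dX (dX (dX u)) (i - 2) j
        + 2 * dX (dX (dY u)) (i - 1) (j - 1) + dX (dY (dY u)) (i - 1) (j - 1)"
      by (simp add: dif_def subdivide2_simps; simp add: ac_simps; linarith?)+
    then show "\<bar>?v (- (2 * j)) (i + j)\<bar> \<le> 99 * ?K" "\<bar>?v (1 - 2 * j) (i + j)\<bar> \<le> 99 * ?K"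
      using K b(1)[of "i - 2" "j"] b(2)[of "i - 2" "j"] b(4)[of "i - 1" "j - 1"]
        b(2)[of "i - 1" "j - 1"]
      unfolding abs_le_iff by linarith+
  qed
  let ?v = "dZ (dZ (dZ (subdivide2 u)))"
  have c10: "bounded_by (127 * ?K) ?v"
  proof (rule bounded_by_parity)
    fix i j :: int
    \<comment> \<open>M^(-1) (e1 - M e1) = - (e1 + M e1) / 2. Accordingly, up to shifts, the terms
      are those of - (X + Y)^3, distributed over the cosets by the parity of the degree in
      Y.\<close>
    have "4 * ?v (- (2 * j)) (i + j) = - dX (dX (dX u)) (i - 3) j
        - 3 * dX (dY (dY u)) (i - 2) (j - 1)"
      "4 * ?v (1 - 2 * j) (i + j) = - 3 * dX (dX (dY u)) (i - 2) (j - 1)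
        - dY (dY (dY u)) (i - 1) (j - 2)"
      by (simp add: dif_def subdivide2_simps; simp add: ac_simps; linarith?)+
    then show "\<bar>?v (- (2 * j)) (i + j)\<bar> \<le> 127 * ?K" "\<bar>?v (1 - 2 * j) (i + j)\<bar> \<le> 127 * ?K"
      using K b(1)[of "i - 3" "j"] b(4)[of "i - 2" "j - 1"] b(2)[of "i - 2" "j - 1"]
        b(7)[of "i - 1" "j - 2"]
      unfolding abs_le_iff by linarith+
  qed
  show ?thesis
    unfolding diff_bounds2_def using c1 c2 c3 c4 c5 c6 c7 c8 c9 c10 by blast
qed

section \<open>Fourth differences under the mask (1, 4, 6, 4, 1) / 8\<close>

definition subdivide3 :: "(int \<Rightarrow> int \<Rightarrow> real) \<Rightarrow> int \<Rightarrow> int \<Rightarrow> real" where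
  "subdivide3 u A B = (let j = - (A div 2); i = B - j in
     if even A then u i j / 8 + 6 * u (i - 1) (j + 1) / 8 + u (i - 2) (j + 2) / 8
     else 4 * u i j / 8 + 4 * u (i - 1) (j + 1) / 8)"

lemma subdivide3_simps:
  "subdivide3 u (- (2 * j)) B = u (B - j) j / 8 + 6 * u (B - j - 1) (j + 1) / 8 + u (B - j - 2) (j + 2) / 8"
  "subdivide3 u (1 - 2 * j) B = 4 * u (B - j) j / 8 + 4 * u (B - j - 1) (j + 1) / 8"
  "subdivide3 u (2 - 2 * j) B = u (B - j + 1) (j - 1) / 8 + 6 * u (B - j) j / 8 + u (B - j - 1) (j + 1) / 8"
  "subdivide3 u (3 - 2 * j) B = 4 * u (B - j + 1) (j - 1) / 8 + 4 * u (B - j) j / 8"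
  "subdivide3 u (4 - 2 * j) B = u (B - j + 2) (j - 2) / 8 + 6 * u (B - j + 1) (j - 1) / 8 + u (B - j) j / 8"
  "subdivide3 u (5 - 2 * j) B = 4 * u (B - j + 2) (j - 2) / 8 + 4 * u (B - j + 1) (j - 1) / 8"
  "subdivide3 u (6 - 2 * j) B = u (B - j + 3) (j - 3) / 8 + 6 * u (B - j + 2) (j - 2) / 8 + u (B - j + 1) (j - 1) / 8"
  by (simp_all add: subdivide3_def Let_def div_shift; simp add: algebra_simps)+

text \<open>The fifteen quartic monomials in X, Y, Z and the extra product XXXW. Since 2 e1 - M e1 =
  - M^2 e1, a step along W is the image of a step along - M e1, so subdivision takes XXXW to YZZZ.
  The relation X(i, j) + X(i - 1, j + 1) = Y(i, j) + W(i - 1, j + 1) trades neighbouring values of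
  the heavily weighted XXXX for XXXY and XXXW.\<close>

definition diff_bounds3 :: "real \<Rightarrow> (int \<Rightarrow> int \<Rightarrow> real) \<Rightarrow> bool" where
  "diff_bounds3 K u \<longleftrightarrow>
     bounded_by (159 * K) (dX (dX (dX (dX u)))) \<and>
     bounded_by (72 * K) (dX (dX (dX (dY u)))) \<and>
     bounded_by (113 * K) (dX (dX (dX (dZ u)))) \<and>
     bounded_by (113 * K) (dX (dX (dX (dW u)))) \<and>
     bounded_by (121 * K) (dX (dX (dY (dY u)))) \<and>
     bounded_by (93 * K) (dX (dX (dY (dZ u)))) \<and>
     bounded_by (169 * K) (dX (dX (dZ (dZ u)))) \<and>
     bounded_by (147 * K) (dX (dY (dY (dY u)))) \<and>
     bounded_by (148 * K) (dX (dY (dY (dZ u)))) \<and>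
     bounded_by (152 * K) (dX (dY (dZ (dZ u)))) \<and>
     bounded_by (202 * K) (dX (dZ (dZ (dZ u)))) \<and>
     bounded_by (360 * K) (dY (dY (dY (dY u)))) \<and>
     bounded_by (283 * K) (dY (dY (dY (dZ u)))) \<and>
     bounded_by (304 * K) (dY (dY (dZ (dZ u)))) \<and>
     bounded_by (317 * K) (dY (dZ (dZ (dZ u)))) \<and>
     bounded_by (445 * K) (dZ (dZ (dZ (dZ u))))"

text \<open>Row by row, the weights on the right divided by 8 stay below 0.351 times the weight on
  the left. The product XXXW is close to equality: 317 / 8 = 39.625 against 39.663.\<close>

lemma diff_bounds3_step:
  assumes "diff_bounds3 K u"
  shows "diff_bounds3 (351 / 1000 * K) (subdivide3 u)"
proof -
  have K: "0 \<le> K"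
    using assms bounded_byD[of "159 * K" "dX (dX (dX (dX u)))" 0 0] by (simp add: diff_bounds3_def)
  have b: "\<And>i j. \<bar>dX (dX (dX (dX u))) i j\<bar> \<le> 159 * K"
    "\<And>i j. \<bar>dX (dX (dX (dY u))) i j\<bar> \<le> 72 * K"
    "\<And>i j. \<bar>dX (dX (dX (dZ u))) i j\<bar> \<le> 113 * K"
    "\<And>i j. \<bar>dX (dX (dX (dW u))) i j\<bar> \<le> 113 * K"
    "\<And>i j. \<bar>dX (dX (dY (dY u))) i j\<bar> \<le> 121 * K"
    "\<And>i j. \<bar>dX (dX (dY (dZ u))) i j\<bar> \<le> 93 * K"
    "\<And>i j. \<bar>dX (dX (dZ (dZ u))) i j\<bar> \<le> 169 * K"
    "\<And>i j. \<bar>dX (dY (dY (dY u))) i j\<bar> \<le> 147 * K"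
    "\<And>i j. \<bar>dX (dY (dY (dZ u))) i j\<bar> \<le> 148 * K"
    "\<And>i j. \<bar>dX (dY (dZ (dZ u))) i j\<bar> \<le> 152 * K"
    "\<And>i j. \<bar>dX (dZ (dZ (dZ u))) i j\<bar> \<le> 202 * K"
    "\<And>i j. \<bar>dY (dY (dY (dY u))) i j\<bar> \<le> 360 * K"
    "\<And>i j. \<bar>dY (dY (dY (dZ u))) i j\<bar> \<le> 283 * K"
    "\<And>i j. \<bar>dY (dY (dZ (dZ u))) i j\<bar> \<le> 304 * K"
    "\<And>i j. \<bar>dY (dZ (dZ (dZ u))) i j\<bar> \<le> 317 * K"
    "\<And>i j. \<bar>dZ (dZ (dZ (dZ u))) i j\<bar> \<le> 445 * K"
    using assms by (simp_all add: diff_bounds3_def bounded_by_def)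
  let ?K = "351 / 1000 * K"
  let ?v = "dX (dX (dX (dX (subdivide3 u))))"
  have c1: "bounded_by (159 * ?K) ?v"
  proof (rule bounded_by_parity)
    fix i j :: int
    have "8 * ?v (- (2 * j)) (i + j) = dZ (dZ (dZ (dZ u))) (i - 2) (j + 2)"
      "8 * ?v (1 - 2 * j) (i + j) = 0"
      by (simp add: dif_def subdivide3_simps; simp add: ac_simps; linarith?)+
    then show "\<bar>?v (- (2 * j)) (i + j)\<bar> \<le> 159 * ?K" "\<bar>?v (1 - 2 * j) (i + j)\<bar> \<le> 159 * ?K"
      using K b(16)[of "i - 2" "j + 2"]
      unfolding abs_le_iff by linarith+
  qed
  let ?v = "dX (dX (dX (dY (subdivide3 u))))"
  have c2: "bounded_by (72 * ?K) ?v"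
  proof (rule bounded_by_parity)
    fix i j :: int
    have "8 * ?v (- (2 * j)) (i + j) = dX (dZ (dZ (dZ u))) (i - 2) (j + 2)"
      "8 * ?v (1 - 2 * j) (i + j) = dX (dZ (dZ (dZ u))) (i - 1) (j + 1)"
      by (simp add: dif_def subdivide3_simps; simp add: ac_simps; linarith?)+
    then show "\<bar>?v (- (2 * j)) (i + j)\<bar> \<le> 72 * ?K" "\<bar>?v (1 - 2 * j) (i + j)\<bar> \<le> 72 * ?K"
      using K b(11)[of "i - 2" "j + 2"] b(11)[of "i - 1" "j + 1"]
      unfolding abs_le_iff by linarith+
  qed
  let ?v = "dX (dX (dX (dZ (subdivide3 u))))"
  have c3: "bounded_by (113 * ?K) ?v"
  proof (rule bounded_by_parity)
    fix i j :: int
    have "8 * ?v (- (2 * j)) (i + j) = - dY (dZ (dZ (dZ u))) (i - 2) (j + 1)"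
      "8 * ?v (1 - 2 * j) (i + j) = - dX (dZ (dZ (dZ u))) (i - 2) (j + 1)"
      by (simp add: dif_def subdivide3_simps; simp add: ac_simps; linarith?)+
    then show "\<bar>?v (- (2 * j)) (i + j)\<bar> \<le> 113 * ?K" "\<bar>?v (1 - 2 * j) (i + j)\<bar> \<le> 113 * ?K"
      using K b(15)[of "i - 2" "j + 1"] b(11)[of "i - 2" "j + 1"]
      unfolding abs_le_iff by linarith+
  qed
  let ?v = "dX (dX (dX (dW (subdivide3 u))))"
  have c4: "bounded_by (113 * ?K) ?v"
  proof (rule bounded_by_parity)
    fix i j :: int
    have "8 * ?v (- (2 * j)) (i + j) = - dY (dZ (dZ (dZ u))) (i - 2) (j + 1)"
      "8 * ?v (1 - 2 * j) (i + j) = - dY (dZ (dZ (dZ u))) (i - 1) j"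
      by (simp add: dif_def subdivide3_simps; simp add: ac_simps; linarith?)+
    then show "\<bar>?v (- (2 * j)) (i + j)\<bar> \<le> 113 * ?K" "\<bar>?v (1 - 2 * j) (i + j)\<bar> \<le> 113 * ?K"
      using K b(15)[of "i - 2" "j + 1"] b(15)[of "i - 1" "j"]
      unfolding abs_le_iff by linarith+
  qed
  let ?v = "dX (dX (dY (dY (subdivide3 u))))"
  have c5: "bounded_by (121 * ?K) ?v"
  proof (rule bounded_by_parity)
    fix i j :: int
    have "8 * ?v (- (2 * j)) (i + j) = dX (dX (dZ (dZ u))) (i - 1) (j + 1)
        + dX (dX (dZ (dZ u))) (i - 2) (j + 2)"
      "8 * ?v (1 - 2 * j) (i + j) = 2 * dX (dX (dZ (dZ u))) (i - 1) (j + 1)"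
      by (simp add: dif_def subdivide3_simps; simp add: ac_simps; linarith?)+
    then show "\<bar>?v (- (2 * j)) (i + j)\<bar> \<le> 121 * ?K" "\<bar>?v (1 - 2 * j) (i + j)\<bar> \<le> 121 * ?K"
      using K b(7)[of "i - 1" "j + 1"] b(7)[of "i - 2" "j + 2"]
      unfolding abs_le_iff by linarith+
  qed
  let ?v = "dX (dX (dY (dZ (subdivide3 u))))"
  have c6: "bounded_by (93 * ?K) ?v"
  proof (rule bounded_by_parity)
    fix i j :: int
    have "8 * ?v (- (2 * j)) (i + j) = - dX (dX (dX (dZ u))) (i - 2) j
        + dX (dY (dY (dZ u))) (i - 2) j"
      "8 * ?v (1 - 2 * j) (i + j) = - dX (dX (dX (dZ u))) (i - 2) (j + 1)
        + dX (dY (dY (dZ u))) (i) (j - 1)"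
      by (simp add: dif_def subdivide3_simps; simp add: ac_simps; linarith?)+
    then show "\<bar>?v (- (2 * j)) (i + j)\<bar> \<le> 93 * ?K" "\<bar>?v (1 - 2 * j) (i + j)\<bar> \<le> 93 * ?K"
      using K b(3)[of "i - 2" "j"] b(9)[of "i - 2" "j"] b(3)[of "i - 2" "j + 1"]
        b(9)[of "i" "j - 1"]
      unfolding abs_le_iff by linarith+
  qed
  let ?v = "dX (dX (dZ (dZ (subdivide3 u))))"
  have c7: "bounded_by (169 * ?K) ?v"
  proof (rule bounded_by_parity)
    fix i j :: int
    have "8 * ?v (- (2 * j)) (i + j) = dX (dX (dZ (dZ u))) (i - 3) (j + 1)
        + dY (dY (dZ (dZ u))) (i - 2) j"
      "8 * ?v (1 - 2 * j) (i + j) = 2 * dX (dY (dZ (dZ u))) (i - 2) j"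
      by (simp add: dif_def subdivide3_simps; simp add: ac_simps; linarith?)+
    then show "\<bar>?v (- (2 * j)) (i + j)\<bar> \<le> 169 * ?K" "\<bar>?v (1 - 2 * j) (i + j)\<bar> \<le> 169 * ?K"
      using K b(7)[of "i - 3" "j + 1"] b(14)[of "i - 2" "j"] b(10)[of "i - 2" "j"]
      unfolding abs_le_iff by linarith+
  qed
  let ?v = "dX (dY (dY (dY (subdivide3 u))))"
  have c8: "bounded_by (147 * ?K) ?v"
  proof (rule bounded_by_parity)
    fix i j :: int
    have "8 * ?v (- (2 * j)) (i + j) = - dX (dX (dX (dY u))) (i - 2) (j + 1)
        + 2 * dX (dX (dX (dZ u))) (i - 1) (j + 1) + dX (dX (dX (dW u))) (i - 2) (j + 1)"
      "8 * ?v (1 - 2 * j) (i + j) = - dX (dX (dX (dY u))) (i - 1) j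
        + 2 * dX (dX (dX (dZ u))) (i - 1) (j + 1) + dX (dX (dX (dW u))) (i - 1) j"
      by (simp add: dif_def subdivide3_simps; simp add: ac_simps; linarith?)+
    then show "\<bar>?v (- (2 * j)) (i + j)\<bar> \<le> 147 * ?K" "\<bar>?v (1 - 2 * j) (i + j)\<bar> \<le> 147 * ?K"
      using K b(2)[of "i - 2" "j + 1"] b(3)[of "i - 1" "j + 1"] b(4)[of "i - 2" "j + 1"]
        b(2)[of "i - 1" "j"] b(4)[of "i - 1" "j"]
      unfolding abs_le_iff by linarith+
  qed
  let ?v = "dX (dY (dY (dZ (subdivide3 u))))"
  have c9: "bounded_by (148 * ?K) ?v"
  proof (rule bounded_by_parity)
    fix i j :: int
    have "8 * ?v (- (2 * j)) (i + j) = - 2 * dX (dX (dX (dZ u))) (i - 2) (j + 1)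
        - dX (dX (dY (dZ u))) (i - 1) j - dX (dX (dY (dZ u))) (i - 2) (j + 1)"
      "8 * ?v (1 - 2 * j) (i + j) = dX (dX (dX (dY u))) (i) (j - 1)
        - dX (dX (dX (dW u))) (i - 2) (j + 1) - 2 * dX (dX (dY (dZ u))) (i - 1) j"
      by (simp add: dif_def subdivide3_simps; simp add: ac_simps; linarith?)+
    then show "\<bar>?v (- (2 * j)) (i + j)\<bar> \<le> 148 * ?K" "\<bar>?v (1 - 2 * j) (i + j)\<bar> \<le> 148 * ?K"
      using K b(3)[of "i - 2" "j + 1"] b(6)[of "i - 1" "j"] b(6)[of "i - 2" "j + 1"]
        b(2)[of "i" "j - 1"] b(4)[of "i - 2" "j + 1"]
      unfolding abs_le_iff by linarith+
  qed
  let ?v = "dX (dY (dZ (dZ (subdivide3 u))))"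
  have c10: "bounded_by (152 * ?K) ?v"
  proof (rule bounded_by_parity)
    fix i j :: int
    have "8 * ?v (- (2 * j)) (i + j) = dX (dX (dX (dY u))) (i - 2) (j - 1)
        + dX (dX (dX (dZ u))) (i - 3) (j + 1) + dX (dX (dY (dZ u))) (i - 2) j
        - dX (dY (dY (dY u))) (i - 2) (j - 1)"
      "8 * ?v (1 - 2 * j) (i + j) = dX (dX (dX (dY u))) (i - 2) j
        + dX (dX (dX (dZ u))) (i - 2) j + dX (dX (dY (dZ u))) (i - 2) j
        - dX (dY (dY (dY u))) (i) (j - 2)"
      by (simp add: dif_def subdivide3_simps; simp add: ac_simps; linarith?)+
    then show "\<bar>?v (- (2 * j)) (i + j)\<bar> \<le> 152 * ?K" "\<bar>?v (1 - 2 * j) (i + j)\<bar> \<le> 152 * ?K"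
      using K b(2)[of "i - 2" "j - 1"] b(3)[of "i - 3" "j + 1"] b(6)[of "i - 2" "j"]
        b(8)[of "i - 2" "j - 1"] b(2)[of "i - 2" "j"] b(3)[of "i - 2" "j"] b(8)[of "i" "j - 2"]
      unfolding abs_le_iff by linarith+
  qed
  let ?v = "dX (dZ (dZ (dZ (subdivide3 u))))"
  have c11: "bounded_by (202 * ?K) ?v"
  proof (rule bounded_by_parity)
    fix i j :: int
    have "8 * ?v (- (2 * j)) (i + j) = - 3 * dX (dX (dY (dZ u))) (i - 3) j
        - dY (dY (dY (dZ u))) (i - 2) (j - 1)"
      "8 * ?v (1 - 2 * j) (i + j) = - dX (dX (dX (dZ u))) (i - 3) j
        - 3 * dX (dY (dY (dZ u))) (i - 2) (j - 1)"
      by (simp add: dif_def subdivide3_simps; simp add: ac_simps; linarith?)+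
    then show "\<bar>?v (- (2 * j)) (i + j)\<bar> \<le> 202 * ?K" "\<bar>?v (1 - 2 * j) (i + j)\<bar> \<le> 202 * ?K"
      using K b(6)[of "i - 3" "j"] b(13)[of "i - 2" "j - 1"] b(3)[of "i - 3" "j"]
        b(9)[of "i - 2" "j - 1"]
      unfolding abs_le_iff by linarith+
  qed
  let ?v = "dY (dY (dY (dY (subdivide3 u))))"
  have c12: "bounded_by (360 * ?K) ?v"
  proof (rule bounded_by_parity)
    fix i j :: int
    \<comment> \<open>The plain identity, with XXXX weighted 1, 6, 1 and 4, 4, would cost 159 where
      only 0.351 * 360 = 126.36 is allowed. Pairing neighbours into XXXY + XXXW brings the cost down
      to 125.75.\<close>
    have "8 * ?v (- (2 * j)) (i + j) = 4 * dX (dX (dX (dX u))) (i - 1) (j + 1)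
        + dX (dX (dX (dY u))) i j + dX (dX (dX (dY u))) (i - 1) (j + 1)
        + dX (dX (dX (dW u))) (i - 1) (j + 1) + dX (dX (dX (dW u))) (i - 2) (j + 2)"
      "8 * ?v (1 - 2 * j) (i + j) = 4 * dX (dX (dX (dY u))) i j
        + 4 * dX (dX (dX (dW u))) (i - 1) (j + 1)"
      by (simp add: dif_def subdivide3_simps; simp add: ac_simps; linarith?)+
    then show "\<bar>?v (- (2 * j)) (i + j)\<bar> \<le> 360 * ?K" "\<bar>?v (1 - 2 * j) (i + j)\<bar> \<le> 360 * ?K"
      using K b(1)[of "i - 1" "j + 1"] b(2)[of "i" "j"] b(2)[of "i - 1" "j + 1"]
        b(4)[of "i - 1" "j + 1"] b(4)[of "i - 2" "j + 2"]
      unfolding abs_le_iff by linarith+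
  qed
  let ?v = "dY (dY (dY (dZ (subdivide3 u))))"
  have c13: "bounded_by (283 * ?K) ?v"
  proof (rule bounded_by_parity)
    fix i j :: int
    have "8 * ?v (- (2 * j)) (i + j) = - 2 * dX (dX (dX (dX u))) (i - 2) (j + 1)
        - 4 * dX (dX (dX (dY u))) (i - 1) j - dX (dX (dX (dY u))) (i - 2) (j + 1)
        - dX (dX (dX (dW u))) (i - 2) (j + 1)"
      "8 * ?v (1 - 2 * j) (i + j) = - 2 * dX (dX (dX (dX u))) (i - 1) j
        - dX (dX (dX (dY u))) (i) (j - 1) - 4 * dX (dX (dX (dY u))) (i - 1) j
        - dX (dX (dX (dW u))) (i - 2) (j + 1)"
      by (simp add: dif_def subdivide3_simps; simp add: ac_simps; linarith?)+
    then show "\<bar>?v (- (2 * j)) (i + j)\<bar> \<le> 283 * ?K" "\<bar>?v (1 - 2 * j) (i + j)\<bar> \<le> 283 * ?K"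
      using K b(1)[of "i - 2" "j + 1"] b(2)[of "i - 1" "j"] b(2)[of "i - 2" "j + 1"]
        b(4)[of "i - 2" "j + 1"] b(1)[of "i - 1" "j"] b(2)[of "i" "j - 1"]
      unfolding abs_le_iff by linarith+
  qed
  let ?v = "dY (dY (dZ (dZ (subdivide3 u))))"
  have c14: "bounded_by (304 * ?K) ?v"
  proof (rule bounded_by_parity)
    fix i j :: int
    have "8 * ?v (- (2 * j)) (i + j) = 5 * dX (dX (dX (dY u))) (i - 2) j
        + dX (dX (dX (dW u))) (i - 3) (j + 1) + dX (dX (dY (dY u))) (i - 1) (j - 1)
        + dX (dX (dY (dY u))) (i - 2) j"
      "8 * ?v (1 - 2 * j) (i + j) = 2 * dX (dX (dX (dX u))) (i - 2) j
        + 2 * dX (dX (dX (dY u))) (i - 1) (j - 1) + 2 * dX (dX (dX (dY u))) (i - 2) j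
        + 2 * dX (dX (dY (dY u))) (i - 1) (j - 1)"
      by (simp add: dif_def subdivide3_simps; simp add: ac_simps; linarith?)+
    then show "\<bar>?v (- (2 * j)) (i + j)\<bar> \<le> 304 * ?K" "\<bar>?v (1 - 2 * j) (i + j)\<bar> \<le> 304 * ?K"
      using K b(2)[of "i - 2" "j"] b(4)[of "i - 3" "j + 1"] b(5)[of "i - 1" "j - 1"]
        b(5)[of "i - 2" "j"] b(1)[of "i - 2" "j"] b(2)[of "i - 1" "j - 1"]
      unfolding abs_le_iff by linarith+
  qed
  let ?v = "dY (dZ (dZ (dZ (subdivide3 u))))"
  have c15: "bounded_by (317 * ?K) ?v"
  proof (rule bounded_by_parity)
    fix i j :: int
    have "8 * ?v (- (2 * j)) (i + j) = - dX (dX (dX (dX u))) (i - 3) j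
        - 3 * dX (dX (dX (dY u))) (i - 3) j - 3 * dX (dX (dY (dY u))) (i - 2) (j - 1)
        - dX (dY (dY (dY u))) (i - 2) (j - 1)"
      "8 * ?v (1 - 2 * j) (i + j) = - dX (dX (dX (dX u))) (i - 3) j
        - 3 * dX (dX (dX (dY u))) (i - 2) (j - 1) - 3 * dX (dX (dY (dY u))) (i - 2) (j - 1)
        - dX (dY (dY (dY u))) (i - 1) (j - 2)"
      by (simp add: dif_def subdivide3_simps; simp add: ac_simps; linarith?)+
    then show "\<bar>?v (- (2 * j)) (i + j)\<bar> \<le> 317 * ?K" "\<bar>?v (1 - 2 * j) (i + j)\<bar> \<le> 317 * ?K"
      using K b(1)[of "i - 3" "j"] b(2)[of "i - 3" "j"] b(5)[of "i - 2" "j - 1"]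
        b(8)[of "i - 2" "j - 1"] b(2)[of "i - 2" "j - 1"] b(8)[of "i - 1" "j - 2"]
      unfolding abs_le_iff by linarith+
  qed
  let ?v = "dZ (dZ (dZ (dZ (subdivide3 u))))"
  have c16: "bounded_by (445 * ?K) ?v"
  proof (rule bounded_by_parity)
    fix i j :: int
    \<comment> \<open>Up to shifts these are the terms of (X + Y)^4, even degrees in Y on one coset
      and odd degrees on the other.\<close>
    have "8 * ?v (- (2 * j)) (i + j) = dX (dX (dX (dX u))) (i - 4) j
        + 6 * dX (dX (dY (dY u))) (i - 3) (j - 1) + dY (dY (dY (dY u))) (i - 2) (j - 2)"
      "8 * ?v (1 - 2 * j) (i + j) = 4 * dX (dX (dX (dY u))) (i - 3) (j - 1)
        + 4 * dX (dY (dY (dY u))) (i - 2) (j - 2)"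
      by (simp add: dif_def subdivide3_simps; simp add: ac_simps; linarith?)+
    then show "\<bar>?v (- (2 * j)) (i + j)\<bar> \<le> 445 * ?K" "\<bar>?v (1 - 2 * j) (i + j)\<bar> \<le> 445 * ?K"
      using K b(1)[of "i - 4" "j"] b(5)[of "i - 3" "j - 1"] b(12)[of "i - 2" "j - 2"]
        b(2)[of "i - 3" "j - 1"] b(8)[of "i - 2" "j - 2"]
      unfolding abs_le_iff by linarith+
  qed
  show ?thesis
    unfolding diff_bounds3_def using c1 c2 c3 c4 c5 c6 c7 c8 c9 c10 c11 c12 c13 c14 c15 c16 by blast
qed

section \<open>Lattice sums and subdivision\<close>

definition lattice_sum :: "(real ^ 2 \<Rightarrow> real) \<Rightarrow> (int ^ 2 \<Rightarrow> real) \<Rightarrow> real ^ 2 \<Rightarrow> real" where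
  "lattice_sum f u x = (\<Sum>\<^sub>\<infinity>k. u k * f (x - lattice_point k))"

definition bounded_support :: "(real ^ 2 \<Rightarrow> 'b::zero) \<Rightarrow> bool" where
  "bounded_support f \<longleftrightarrow> (\<exists>R. \<forall>x. R < norm x \<longrightarrow> f x = 0)"

lemma tame_bounded_support: "tame f \<Longrightarrow> bounded_support f"
  by (auto simp: tame_def bounded_support_def)

lemma finite_lattice_support:
  assumes "bounded_support f"
  shows "finite {k. f (x - lattice_point k) \<noteq> 0}"
proof -
  obtain R where R: "\<And>x. R < norm x \<Longrightarrow> f x = 0" using assms by (auto simp: bounded_support_def)
  have "{k. f (x - lattice_point k) \<noteq> 0} \<subseteq> {k. norm (lattice_point k - x) \<le> R}"
    using R by (force simp: norm_minus_commute)
  then show ?thesis using finite_lattice_ball finite_subset by blast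
qed

lemma lattice_summable:
  fixes u :: "int ^ 2 \<Rightarrow> real"
  assumes "bounded_support f"
  shows "(\<lambda>k. u k * f (x - lattice_point k)) summable_on UNIV"
  by (rule finite_nonzero_values_imp_summable_on)
    (rule finite_subset[OF _ finite_lattice_support[OF assms, of x]], auto)

lemma lattice_sum_eq_sum:
  assumes "finite A" "\<And>k. k \<notin> A \<Longrightarrow> u k * f (x - lattice_point k) = 0"
  shows "lattice_sum f u x = (\<Sum>k\<in>A. u k * f (x - lattice_point k))"
proof -
  have "lattice_sum f u x = (\<Sum>\<^sub>\<infinity>k\<in>A. u k * f (x - lattice_point k))"
    unfolding lattice_sum_def by (rule infsum_cong_neutral) (use assms in auto)
  then show ?thesis using assms(1) by simp
qed

lemma lattice_sum_eq_support:
  assumes "bounded_support f"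
  shows "lattice_sum f u x = (\<Sum>k | f (x - lattice_point k) \<noteq> 0. u k * f (x - lattice_point k))"
  by (rule lattice_sum_eq_sum[OF finite_lattice_support[OF assms]]) auto

lemma lattice_sum_diff:
  assumes "bounded_support f"
  shows "lattice_sum f (\<lambda>k. u k - v k) x = lattice_sum f u x - lattice_sum f v x"
  by (simp add: lattice_sum_eq_support[OF assms] left_diff_distrib sum_subtractf)

lemma lattice_sum_sum:
  assumes "bounded_support f" "finite J"
  shows "lattice_sum f (\<lambda>k. \<Sum>j\<in>J. c j * v j k) x = (\<Sum>j\<in>J. c j * lattice_sum f (v j) x)"
  unfolding lattice_sum_eq_support[OF assms(1)] sum_distrib_right sum_distrib_left
  by (subst sum.swap) (simp add: mult.assoc)

lemma lattice_sum_sum_generator: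
  assumes "\<And>j. bounded_support (g j)" "finite J"
  shows "lattice_sum (\<lambda>x. \<Sum>j\<in>J. c j * g j x) u x = (\<Sum>j\<in>J. c j * lattice_sum (g j) u x)"
proof -
  let ?A = "\<Union>j\<in>J. {k. g j (x - lattice_point k) \<noteq> 0}"
  have fin: "finite ?A" using assms finite_lattice_support by blast
  have "lattice_sum (g j) u x = (\<Sum>k\<in>?A. u k * g j (x - lattice_point k))" if "j \<in> J" for j
    by (rule lattice_sum_eq_sum[OF fin]) (use that in auto)
  moreover have "lattice_sum (\<lambda>x. \<Sum>j\<in>J. c j * g j x) u x
      = (\<Sum>k\<in>?A. u k * (\<Sum>j\<in>J. c j * g j (x - lattice_point k)))"
    by (rule lattice_sum_eq_sum[OF fin]) (auto intro!: sum.neutral)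
  moreover have "\<dots> = (\<Sum>j\<in>J. c j * (\<Sum>k\<in>?A. u k * g j (x - lattice_point k)))"
    unfolding sum_distrib_left by (subst sum.swap) (simp add: mult_ac)
  ultimately show ?thesis by simp
qed

lemma lattice_sum_shift:
  "lattice_sum f (\<lambda>k. u (k + l)) x = lattice_sum f u (x + lattice_point l)"
proof -
  have "bij (\<lambda>k :: int ^ 2. k + l)" by (rule bij_plus_right)
  then have "(\<Sum>\<^sub>\<infinity>k. u (k + l) * f (x + lattice_point l - lattice_point (k + l))) =
      (\<Sum>\<^sub>\<infinity>k. u k * f (x + lattice_point l - lattice_point k))"
    using infsum_reindex_bij_betw[of "\<lambda>k. k + l" UNIV UNIV "\<lambda>k. u k * f (x + lattice_point l - lattice_point k)"] by simp
  then show ?thesis by (simp add: lattice_sum_def lattice_point_add)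
qed

text \<open>An integer translation moves \<open>x\<close> into the unit cell, after which one fixed
  finite set of lattice points carries the sum. Hence the constant is uniform in both
  \<open>x\<close> and \<open>u\<close>.\<close>

lemma lattice_sum_bound:
  assumes "bounded_support f" "bounded (range f)"
  shows "\<exists>N. \<forall>u C x. (\<forall>k. \<bar>u k\<bar> \<le> C) \<longrightarrow> \<bar>lattice_sum f u x\<bar> \<le> N * C"
proof -
  obtain R where R: "\<And>x. R < norm x \<Longrightarrow> f x = 0" using \<open>bounded_support f\<close> by (auto simp: bounded_support_def)
  obtain B where B: "\<And>x. \<bar>f x\<bar> \<le> B" using assms(2) by (auto simp: bounded_iff)
  define F where "F = {k. norm (lattice_point k - 0) \<le> R + 2}"
  have fin: "finite F" unfolding F_def by (rule finite_lattice_ball)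
  have "\<bar>lattice_sum f u x\<bar> \<le> card F * B * C" if u: "\<And>k. \<bar>u k\<bar> \<le> C" for u C x
  proof -
    define m :: "int ^ 2" where "m = (\<chi> i. \<lfloor>x $ i\<rfloor>)"
    define t where "t = x - lattice_point m"
    have "\<bar>t $ i\<bar> \<le> 1" for i by (simp add: t_def m_def) linarith
    from this[of 1] this[of 2] have t: "norm t \<le> 2"
      using norm_le_l1_cart[of t] by (simp add: sum_2)
    have "lattice_sum f u x = lattice_sum f (\<lambda>k. u (k + m)) t"
      by (simp add: lattice_sum_shift t_def)
    also have "\<dots> = (\<Sum>k\<in>F. u (k + m) * f (t - lattice_point k))"
    proof (rule lattice_sum_eq_sum[OF fin])
      fix k assume "k \<notin> F"
      then have "R + 2 < norm (lattice_point k)" by (simp add: F_def)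
      then have "R < norm (t - lattice_point k)"
        using t norm_triangle_ineq2[of "lattice_point k" t] by (simp add: norm_minus_commute)
      then show "u (k + m) * f (t - lattice_point k) = 0" using R by simp
    qed
    also have "\<bar>\<dots>\<bar> \<le> (\<Sum>k\<in>F. C * B)"
      unfolding abs_mult by (intro order_trans[OF sum_abs] sum_mono, unfold abs_mult, intro mult_mono u B)
        (use order_trans[OF abs_ge_zero u] in auto)
    finally show ?thesis by (simp add: mult_ac)
  qed
  then show ?thesis by blast
qed

section \<open>Subdivision as upsampling followed by convolution with the mask\<close>

definition upsample :: "(int ^ 2 \<Rightarrow> real) \<Rightarrow> int ^ 2 \<Rightarrow> real" where
  "upsample u p = (if \<exists>k. p = ibear k then u (THE k. p = ibear k) else 0)"

lemma ibear_inject [simp]: "ibear k = ibear l \<longleftrightarrow> k = l"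
  by (auto simp: vec2_eq_iff)

lemma upsample_ibear [simp]: "upsample u (ibear k) = u k"
  by (auto simp: upsample_def)

lemma upsample_outside: "p \<notin> range ibear \<Longrightarrow> upsample u p = 0"
  by (auto simp: upsample_def)

definition digit :: "nat \<Rightarrow> int ^ 2" where "digit j = vector [int j, 0]"

lemma lattice_point_digit: "lattice_point (digit j) = real j *\<^sub>R e1"
  by (simp add: digit_def vec2_eq_iff)

lemma bspline_mask_digit: "bspline_mask n (digit j) = real ((n + 1) choose j) / 2 ^ n"
  by (simp add: bspline_mask_def digit_def)

lemma bspline_mask_outside: "k \<notin> digit ` {..n + 1} \<Longrightarrow> bspline_mask n k = 0"
proof (rule ccontr)
  assume k: "k \<notin> digit ` {..n + 1}" and "bspline_mask n k \<noteq> 0"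
  then have "k $ 2 = 0" "0 \<le> k $ 1" "k $ 1 \<le> int (n + 1)"
    by (auto simp: bspline_mask_def split: if_splits)
  then have "k = digit (nat (k $ 1))" "nat (k $ 1) \<le> n + 1"
    by (auto simp: digit_def vec2_eq_iff)
  then show False using k by blast
qed

lemma inj_digit: "inj_on digit A"
  by (auto simp: inj_on_def digit_def vec2_eq_iff)

lemma subdivision_operator_eq:
  "subdivision_operator (bspline_mask n) u m =
     (\<Sum>j\<le>n + 1. real ((n + 1) choose j) / 2 ^ n * upsample u (m - digit j))"
proof -
  have "subdivision_operator (bspline_mask n) u m = (\<Sum>\<^sub>\<infinity>k. bspline_mask n (m - ibear k) * upsample u (ibear k))"
    by (simp add: subdivision_operator_def bear_matrix_mult_int)
  also have "\<dots> = (\<Sum>\<^sub>\<infinity>p\<in>range ibear. bspline_mask n (m - p) * upsample u p)"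
    by (subst infsum_reindex) (auto simp: inj_on_def o_def)
  also have "\<dots> = (\<Sum>\<^sub>\<infinity>p\<in>(\<lambda>j. m - digit j) ` {..n + 1}. bspline_mask n (m - p) * upsample u p)"
  proof (rule infsum_cong_neutral)
    fix p assume "p \<in> range ibear - (\<lambda>j. m - digit j) ` {..n + 1}"
    then have "m - p \<notin> digit ` {..n + 1}" by (auto simp: image_iff algebra_simps)
    then show "bspline_mask n (m - p) * upsample u p = 0" using bspline_mask_outside by simp
  qed (auto simp: upsample_outside)
  also have "\<dots> = (\<Sum>j\<le>n + 1. bspline_mask n (digit j) * upsample u (m - digit j))"
    using inj_digit[of "{..n + 1}"] by (simp add: sum.reindex inj_on_def)
  finally show ?thesis by (simp only: bspline_mask_digit)
qed

lemma refinement_equation_spline: "refinement_equation (bspline_mask (Suc n)) (spline (Suc n))"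
  unfolding refinement_equation_def
proof
  fix x
  have "(\<Sum>\<^sub>\<infinity>k. bspline_mask (Suc n) k * spline (Suc n) (bear x - lattice_point k)) =
      (\<Sum>\<^sub>\<infinity>k\<in>digit ` {..Suc n + 1}. bspline_mask (Suc n) k * spline (Suc n) (bear x - lattice_point k))"
    by (rule infsum_cong_neutral) (use bspline_mask_outside in auto)
  also have "\<dots> = (\<Sum>j\<le>Suc n + 1. bspline_mask (Suc n) (digit j) * spline (Suc n) (bear x - lattice_point (digit j)))"
    using inj_digit[of "{..Suc n + 1}"] by (simp add: sum.reindex)
  also have "\<dots> = spline (Suc n) x"
    unfolding bspline_mask_digit lattice_point_digit by (rule spline_refinement[symmetric])
  finally show "spline (Suc n) x =
      (\<Sum>\<^sub>\<infinity>k. bspline_mask (Suc n) k * spline (Suc n) (bear_matrix *v x - lattice_point k))"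
    by (simp add: bear_matrix_mult)
qed

lemma lattice_sum_upsample: "lattice_sum f (upsample u) (bear x - a) = lattice_sum (\<lambda>x. f (bear x - a)) u x"
proof -
  have "lattice_sum (\<lambda>x. f (bear x - a)) u x = (\<Sum>\<^sub>\<infinity>k. upsample u (ibear k) * f (bear x - a - lattice_point (ibear k)))"
    by (simp add: lattice_sum_def lattice_point_ibear linear_diff[OF linear_bear] algebra_simps)
  also have "\<dots> = (\<Sum>\<^sub>\<infinity>p\<in>range ibear. upsample u p * f (bear x - a - lattice_point p))"
    by (subst infsum_reindex) (auto simp: inj_on_def o_def)
  also have "\<dots> = lattice_sum f (upsample u) (bear x - a)"
    unfolding lattice_sum_def by (rule infsum_cong_neutral) (auto simp: upsample_outside)
  finally show ?thesis ..
qed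

lemma bounded_support_bear:
  assumes "bounded_support f" shows "bounded_support (\<lambda>x. f (bear x - a))"
proof -
  obtain R where R: "\<And>x. R < norm x \<Longrightarrow> f x = 0" using assms by (auto simp: bounded_support_def)
  have "f (bear x - a) = 0" if "2 * (R + norm a) < norm x" for x
  proof (rule R)
    show "R < norm (bear x - a)"
      using that norm_le_bear[of x] norm_triangle_ineq2[of "bear x" a] by argo
  qed
  then show ?thesis by (auto simp: bounded_support_def)
qed

lemma bounded_support_spline: "bounded_support (spline n)"
  by (rule tame_bounded_support) (rule tame_spline)

text \<open>The refinement equation in transposed form: the mask is moved from the generating
  function to the coefficients.\<close>

lemma lattice_sum_subdivide:
  "lattice_sum (spline (Suc n)) u x =
     lattice_sum (spline (Suc n)) (subdivision_operator (bspline_mask (Suc n)) u) (bear x)"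
proof -
  let ?f = "spline (Suc n)" and ?b = "\<lambda>j. real ((Suc n + 1) choose j) / 2 ^ Suc n"
  let ?g = "\<lambda>j x. ?f (bear x - real j *\<^sub>R e1)"
  have "lattice_sum ?f (subdivision_operator (bspline_mask (Suc n)) u) (bear x) =
      (\<Sum>j\<le>Suc n + 1. ?b j * lattice_sum ?f (\<lambda>m. upsample u (m + (- digit j))) (bear x))"
    unfolding subdivision_operator_eq
    by (subst lattice_sum_sum[OF bounded_support_spline]) simp_all
  also have "\<dots> = (\<Sum>j\<le>Suc n + 1. ?b j * lattice_sum (?g j) u x)"
  proof (intro sum.cong refl arg_cong2[where f = "(*)"])
    fix j
    have "lattice_point (- digit j) = - (real j *\<^sub>R e1)"
      using lattice_point_digit[of j] by (simp add: vec2_eq_iff)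
    then show "lattice_sum ?f (\<lambda>m. upsample u (m + (- digit j))) (bear x) = lattice_sum (?g j) u x"
      unfolding lattice_sum_shift lattice_sum_upsample[symmetric] by simp
  qed
  also have "\<dots> = lattice_sum (\<lambda>x. \<Sum>j\<le>Suc n + 1. ?b j * ?g j x) u x"
    by (rule lattice_sum_sum_generator[symmetric]) (simp_all only: bounded_support_bear bounded_support_spline finite_atMost)
  also have "\<dots> = lattice_sum ?f u x"
    by (simp only: spline_refinement[symmetric])
  finally show ?thesis ..
qed

lemma lattice_sum_subdivide_iter:
  "lattice_sum (spline (Suc n)) u x =
     lattice_sum (spline (Suc n)) ((subdivision_operator (bspline_mask (Suc n)) ^^ q) u) ((bear ^^ q) x)"
proof (induction q)
  case (Suc q)
  show ?case by (subst Suc) (simp add: lattice_sum_subdivide[of n _ "(bear ^^ q) x"] del: tile_bspline.simps)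
qed simp

section \<open>Smoothness of the splines\<close>

text \<open>Coefficients in the basis e1, M e1: as M e1 = (1, 1), the point i e1 + j M e1 is (i + j,
  j).\<close>

definition coords :: "(int ^ 2 \<Rightarrow> real) \<Rightarrow> int \<Rightarrow> int \<Rightarrow> real" where
  "coords u i j = u (vector [i + j, j])"

lemma upsample_vector:
  "upsample u (vector [a, b]) = (if even (b - a) then u (vector [b, (b - a) div 2]) else 0)"
proof (cases "even (b - a)")
  case True
  then have "vector [a, b] = ibear (vector [b, (b - a) div 2])" by (simp add: vec2_eq_iff)
  then show ?thesis using True by (metis upsample_ibear)
next
  case False
  have "vector [a, b] \<noteq> ibear k" for k
  proof
    assume "vector [a, b] = ibear k"
    then have "b - a = 2 * k $ 2" by (simp add: vec2_eq_iff)
    then show False using False by simp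
  qed
  then show ?thesis using False upsample_outside by auto
qed

lemma vector_minus_digit: "vector [a, b] - digit t = vector [a - int t, b]"
  by (simp add: digit_def vec2_eq_iff)

lemma coords_subdivision:
  "coords (subdivision_operator (bspline_mask n) u) A B =
     (\<Sum>t\<le>n + 1. if even (int t - A) then real ((n + 1) choose t) / 2 ^ n *
        coords u (B - (int t - A) div 2) ((int t - A) div 2) else 0)"
  unfolding coords_def subdivision_operator_eq vector_minus_digit upsample_vector
  by (intro sum.cong) (auto simp: algebra_simps)

text \<open>Equality is a bound by 0 on the difference, so the coset decomposition can be
  reused.\<close>

lemma parity_eqI:
  fixes v w :: "int \<Rightarrow> int \<Rightarrow> real"
  assumes "\<And>i j. v (- (2 * j)) (i + j) = w (- (2 * j)) (i + j)" "\<And>i j. v (1 - 2 * j) (i + j) = w (1 - 2 * j) (i + j)"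
  shows "v = w"
proof -
  have "bounded_by 0 (\<lambda>i j. v i j - w i j)"
    by (rule bounded_by_parity) (simp_all add: assms)
  then show ?thesis by (simp add: bounded_by_def fun_eq_iff)
qed

lemma coords_subdivide2: "coords (subdivision_operator (bspline_mask 2) u) = subdivide2 (coords u)"
proof -
  have sum: "(\<Sum>t\<le>3. g t) = g 0 + g 1 + g 2 + g 3" for g :: "nat \<Rightarrow> real"
    by (simp add: numeral_eq_Suc)
  have choose: "(3 :: nat) choose 2 = 3" by (simp add: numeral_eq_Suc)
  have div: "(2 + 2 * j) div 2 = 1 + j" "(2 * j + 2) div 2 = 1 + j" for j :: int by presburger+
  show ?thesis
  proof (rule parity_eqI)
    fix i j
    show "coords (subdivision_operator (bspline_mask 2) u) (- (2 * j)) (i + j) = subdivide2 (coords u) (- (2 * j)) (i + j)"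
      by (simp add: coords_subdivision sum choose subdivide2_simps div) (simp add: algebra_simps div)
    show "coords (subdivision_operator (bspline_mask 2) u) (1 - 2 * j) (i + j) = subdivide2 (coords u) (1 - 2 * j) (i + j)"
      by (simp add: coords_subdivision sum choose subdivide2_simps div) (simp add: algebra_simps div)
  qed
qed

lemma coords_subdivide3: "coords (subdivision_operator (bspline_mask 3) u) = subdivide3 (coords u)"
proof -
  have sum: "(\<Sum>t\<le>4. g t) = g 0 + g 1 + g 2 + g 3 + g 4" for g :: "nat \<Rightarrow> real"
    by (simp add: numeral_eq_Suc)
  have choose: "(4 :: nat) choose 2 = 6" "(4 :: nat) choose 3 = 4" by (simp_all add: numeral_eq_Suc)
  have div: "(2 + 2 * j) div 2 = 1 + j" "(4 + 2 * j) div 2 = 2 + j" "(2 * j + 2) div 2 = 1 + j"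
    "(2 * j + 4) div 2 = 2 + j" for j :: int by presburger+
  show ?thesis
  proof (rule parity_eqI)
    fix i j
    show "coords (subdivision_operator (bspline_mask 3) u) (- (2 * j)) (i + j) = subdivide3 (coords u) (- (2 * j)) (i + j)"
      by (simp add: coords_subdivision sum choose subdivide3_simps div) (simp add: algebra_simps div)
    show "coords (subdivision_operator (bspline_mask 3) u) (1 - 2 * j) (i + j) = subdivide3 (coords u) (1 - 2 * j) (i + j)"
      by (simp add: coords_subdivision sum choose subdivide3_simps div) (simp add: algebra_simps div)
  qed
qed

section \<open>Differences of lattice sums\<close>

definition shift_dif :: "int ^ 2 \<Rightarrow> (int ^ 2 \<Rightarrow> real) \<Rightarrow> int ^ 2 \<Rightarrow> real" where
  "shift_dif l u k = u (k + l) - u k"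

text \<open>After M^q the step M^(-q) l is the lattice vector l, and translating a lattice sum by a
  lattice vector shifts its coefficients. Fine differences of the spline thus become differences of
  sequences.\<close>

lemma fdiff_lattice_sum:
  assumes "bounded_support f"
  shows "fdiff ((unbear ^^ q) (lattice_point l)) (\<lambda>x. lattice_sum f u ((bear ^^ q) x)) =
     (\<lambda>x. lattice_sum f (shift_dif l u) ((bear ^^ q) x))"
proof
  fix x
  have "(bear ^^ q) (x + y) = (bear ^^ q) x + (bear ^^ q) y" for x y
    by (induction q) (simp_all add: linear_add[OF linear_bear])
  moreover have "(bear ^^ q) ((unbear ^^ q) y) = y" for y
    by (induction q arbitrary: y) (simp_all add: funpow_swap1)
  ultimately have "fdiff ((unbear ^^ q) (lattice_point l)) (\<lambda>x. lattice_sum f u ((bear ^^ q) x)) x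
    = lattice_sum f u ((bear ^^ q) x + lattice_point l) - lattice_sum f u ((bear ^^ q) x)"
    by (simp add: fdiff_def)
  then show "fdiff ((unbear ^^ q) (lattice_point l)) (\<lambda>x. lattice_sum f u ((bear ^^ q) x)) x
    = lattice_sum f (shift_dif l u) ((bear ^^ q) x)"
    by (simp add: shift_dif_def[abs_def] lattice_sum_diff[OF assms] lattice_sum_shift)
qed

lemma fdiffs_lattice_sum:
  assumes "bounded_support f"
  shows "fdiffs (map (\<lambda>l. (unbear ^^ q) (lattice_point l)) ls) (\<lambda>x. lattice_sum f u ((bear ^^ q) x)) =
     (\<lambda>x. lattice_sum f (foldr shift_dif ls u) ((bear ^^ q) x))"
  by (induction ls) (simp_all add: fdiff_lattice_sum[OF assms])

abbreviation "dXY b \<equiv> (if b then dX else dY)"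

definition lattice_step :: "bool \<Rightarrow> int ^ 2" where "lattice_step b = (if b then vector [1, 0] else vector [1, 1])"

lemma coords_step: "coords (shift_dif (lattice_step b) u) = dXY b (coords u)"
proof -
  have "vector [i + j, j] + lattice_step b = vector [(i + (if b then 1 else 0)) + (j + (if b then 0 else 1)), j + (if b then 0 else 1)]" for i j
    by (simp add: vec2_eq_iff lattice_step_def)
  then show ?thesis by (auto simp: fun_eq_iff coords_def shift_dif_def dif_def)
qed

lemma coords_steps: "coords (foldr shift_dif (map lattice_step bs) u) = foldr dXY bs (coords u)"
  by (induction bs) (simp_all add: coords_step)

lemma step_vector: "(unbear ^^ q) (lattice_point (lattice_step b)) = (if b then fstep q else cstep q)"
proof -
  have e: "cstep q = (unbear ^^ q) (cstep 0)"
  proof (induction q)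
    case (Suc q)
    have "unbear (cstep q) = fstep q" by (simp add: cstep_def)
    with Suc show ?case by (simp add: cstep_Suc)
  qed simp
  have "lattice_point (lattice_step b) = (if b then fstep 0 else cstep 0)"
    by (simp add: fstep_0 cstep_0 lattice_step_def vec2_eq_iff)
  then show ?thesis by (simp add: e fstep_def)
qed

definition delta :: "int ^ 2 \<Rightarrow> real" where "delta k = (if k = 0 then 1 else 0)"

lemma lattice_sum_delta: "lattice_sum f delta x = f x"
  by (subst lattice_sum_eq_sum[of "{0}"]) (simp_all add: delta_def)

text \<open>The spline is the lattice sum of \<open>delta\<close>, hence of its \<open>q\<close>-th
  subdivision iterate at scale \<open>q\<close>. The scaled invariant \<open>P\<close> is abstract
  so that the argument serves both families of difference bounds; \<open>L\<close> is the largest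
  weight among the products of X and Y.\<close>

lemma small_diffs_spline:
  fixes P :: "real \<Rightarrow> (int \<Rightarrow> int \<Rightarrow> real) \<Rightarrow> bool"
  assumes base: "P 1 (coords delta)" and step: "\<And>K u. P K u \<Longrightarrow> P (\<rho> * K) (sub u)"
    and sub: "\<And>u. coords (subdivision_operator (bspline_mask (Suc n)) u) = sub (coords u)"
    and bound: "\<And>K u bs i j. P K u \<Longrightarrow> length bs = Suc (Suc n) \<Longrightarrow> \<bar>foldr dXY bs u i j\<bar> \<le> L * K"
  shows "\<exists>K. \<forall>q. small_diffs q (Suc (Suc n)) (K * \<rho> ^ q) (spline (Suc n))"
proof -
  let ?f = "spline (Suc n)" and ?S = "subdivision_operator (bspline_mask (Suc n))"
  have "bounded (range ?f)" using tame_bounded[OF tame_spline[of "Suc n"]] unfolding bounded_iff by blast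
  then obtain N where N: "\<And>u C x. (\<forall>k. \<bar>u k\<bar> \<le> C) \<Longrightarrow> \<bar>lattice_sum ?f u x\<bar> \<le> N * C"
    using lattice_sum_bound[OF bounded_support_spline] by blast
  have P: "P (\<rho> ^ q) (coords ((?S ^^ q) delta))" for q
    by (induction q) (use base step in \<open>simp_all add: sub\<close>)
  have "small_diffs q (Suc (Suc n)) (N * L * \<rho> ^ q) ?f" for q
    unfolding small_diffs_def
  proof (intro allI impI)
    fix vs x assume vs: "set vs \<subseteq> {fstep q, cstep q}" "length vs = Suc (Suc n)"
    define bs where "bs = map (\<lambda>v. v = fstep q) vs"
    have len: "length bs = Suc (Suc n)" using vs by (simp add: bs_def)
    have vs_eq: "vs = map (\<lambda>l. (unbear ^^ q) (lattice_point l)) (map lattice_step bs)"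
      unfolding bs_def map_map using vs(1) by (intro nth_equalityI) (auto simp: step_vector dest!: nth_mem)
    have f: "?f = (\<lambda>x. lattice_sum ?f ((?S ^^ q) delta) ((bear ^^ q) x))"
      using lattice_sum_subdivide_iter[of n delta] by (simp only: lattice_sum_delta)
    have "\<bar>foldr shift_dif (map lattice_step bs) ((?S ^^ q) delta) k\<bar> \<le> L * \<rho> ^ q" for k
    proof -
      have "k = vector [(k $ 1 - k $ 2) + k $ 2, k $ 2]" by (simp add: vec2_eq_iff)
      then have "foldr shift_dif (map lattice_step bs) ((?S ^^ q) delta) k
        = coords (foldr shift_dif (map lattice_step bs) ((?S ^^ q) delta)) (k $ 1 - k $ 2) (k $ 2)"
        unfolding coords_def by presburger
      then show ?thesis unfolding coords_steps using bound[OF P len] by simp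
    qed
    then have "\<bar>lattice_sum ?f (foldr shift_dif (map lattice_step bs) ((?S ^^ q) delta)) ((bear ^^ q) x)\<bar> \<le> N * (L * \<rho> ^ q)"
      by (intro N allI)
    then show "\<bar>fdiffs vs ?f x\<bar> \<le> N * L * \<rho> ^ q"
      by (subst f, subst vs_eq) (simp only: fdiffs_lattice_sum[OF bounded_support_spline] mult.assoc)
  qed
  then show ?thesis by blast
qed

section \<open>Starting values and resulting rates\<close>

lemma bounded_by_dif: "bounded_by c u \<Longrightarrow> bounded_by (2 * c) (dif s t u)"
  unfolding bounded_by_def dif_def
  by (smt (verit))

lemma bounded_by_mono: "bounded_by c u \<Longrightarrow> c \<le> d \<Longrightarrow> bounded_by d u"
  unfolding bounded_by_def by (meson order_trans)

lemma bounded_by_delta: "bounded_by 1 (coords delta)"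
  by (simp add: bounded_by_def coords_def delta_def)

text \<open>Each difference at most doubles the supremum, so three give 8, below the smallest weight
  40. For four differences the comparison is 16 against 72.\<close>

lemma diff_bounds2_delta: "diff_bounds2 1 (coords delta)"
proof -
  have "bounded_by (2 * (2 * (2 * 1))) (dif s1 t1 (dif s2 t2 (dif s3 t3 (coords delta))))" for s1 s2 s3 t1 t2 t3
    by (intro bounded_by_dif bounded_by_delta)
  then show ?thesis unfolding diff_bounds2_def by (intro conjI; rule bounded_by_mono) simp_all
qed

lemma diff_bounds3_delta: "diff_bounds3 1 (coords delta)"
proof -
  have "bounded_by (2 * (2 * (2 * (2 * 1)))) (dif s1 t1 (dif s2 t2 (dif s3 t3 (dif s4 t4 (coords delta)))))"
    for s1 s2 s3 s4 t1 t2 t3 t4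
    by (intro bounded_by_dif bounded_by_delta)
  then show ?thesis unfolding diff_bounds3_def by (intro conjI; rule bounded_by_mono) simp_all
qed

lemma dif_commute: "dY (dX u) = dX (dY u)"
  by (simp add: fun_eq_iff dif_def algebra_simps)

text \<open>The products of X and Y are the differences along the lattice frame; those with Z close
  the recursion. Commutation brings every word to one of the four listed orders, whose largest
  weight is 131.\<close>

lemma diff_bounds2_bound:
  assumes "diff_bounds2 K u" "length bs = Suc (Suc 1)"
  shows "\<bar>foldr dXY bs u i j\<bar> \<le> 131 * K"
proof -
  have K: "0 \<le> K"
    using assms bounded_byD[of "65 * K" "dX (dX (dX u))" 0 0] by (simp add: diff_bounds2_def)
  obtain a b c where bs: "bs = [a, b, c]" using assms(2) by (auto simp: length_Suc_conv)
  have *: "\<bar>v i j\<bar> \<le> 131 * K" if "bounded_by (w * K) v" "w \<le> 131" for w v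
    using bounded_byD[OF that(1), of i j] mult_right_mono[OF that(2) K] by linarith
  show ?thesis using assms(1) unfolding bs diff_bounds2_def
    by (cases a; cases b; cases c) (auto simp: dif_commute intro: *)
qed

lemma diff_bounds3_bound:
  assumes "diff_bounds3 K u" "length bs = Suc (Suc 2)"
  shows "\<bar>foldr dXY bs u i j\<bar> \<le> 360 * K"
proof -
  have K: "0 \<le> K"
    using assms bounded_byD[of "159 * K" "dX (dX (dX (dX u)))" 0 0] by (simp add: diff_bounds3_def)
  obtain a b c d where bs: "bs = [a, b, c, d]" using assms(2) by (auto simp: length_Suc_conv numeral_2_eq_2)
  have *: "\<bar>v i j\<bar> \<le> 360 * K" if "bounded_by (w * K) v" "w \<le> 360" for w v
    using bounded_byD[OF that(1), of i j] mult_right_mono[OF that(2) K] by linarith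
  show ?thesis using assms(1) unfolding bs diff_bounds3_def
    by (cases a; cases b; cases c; cases d) (auto simp: dif_commute intro: *)
qed

lemma spline_smooth:
  assumes "\<And>q. small_diffs q (Suc (Suc n)) (K * \<rho> ^ q) (spline (Suc n))" "0 \<le> \<rho>" "\<rho> * sqrt 2 ^ Suc n < 1"
  shows "\<exists>g R. deriv_family (Suc n) g \<and> g [] = spline (Suc n) \<and> (\<forall>w x. length w \<le> Suc n \<longrightarrow> R < norm x \<longrightarrow> g w x = 0)"
proof -
  obtain C R where "\<And>x. R < norm x \<Longrightarrow> spline (Suc n) x = 0" "0 \<le> R" using tameE[OF tame_spline[of "Suc n"]] by metis
  from regularity_from_differences[OF assms(1) this assms(2,3) continuous_spline]
  show ?thesis by blast
qed

lemma quadratic_spline_smooth: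
  "\<exists>g R. deriv_family 2 g \<and> g [] = spline 2 \<and> (\<forall>w x. length w \<le> 2 \<longrightarrow> R < norm x \<longrightarrow> g w x = 0)"
proof -
  have "\<exists>K. \<forall>q. small_diffs q (Suc (Suc 1)) (K * (497 / 1000) ^ q) (spline (Suc 1))"
    by (rule small_diffs_spline[where P = diff_bounds2 and sub = subdivide2 and L = 131])
      (use diff_bounds2_delta diff_bounds2_step diff_bounds2_bound coords_subdivide2 in \<open>simp_all add: numeral_2_eq_2\<close>)
  then obtain K where "\<And>q. small_diffs q (Suc (Suc 1)) (K * (497 / 1000) ^ q) (spline (Suc 1))" by blast
  \<comment> \<open>The rate suffices because 0.497 * \<open>sqrt 2 ^ 2\<close> = 0.994 < 1.\<close>
  from spline_smooth[OF this] show ?thesis by (simp add: numeral_2_eq_2)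
qed

lemma cubic_spline_smooth:
  "\<exists>g R. deriv_family 3 g \<and> g [] = spline 3 \<and> (\<forall>w x. length w \<le> 3 \<longrightarrow> R < norm x \<longrightarrow> g w x = 0)"
proof -
  have "\<exists>K. \<forall>q. small_diffs q (Suc (Suc 2)) (K * (351 / 1000) ^ q) (spline (Suc 2))"
    by (rule small_diffs_spline[where P = diff_bounds3 and sub = subdivide3 and L = 360])
      (use diff_bounds3_delta diff_bounds3_step diff_bounds3_bound coords_subdivide3 in \<open>simp_all add: numeral_3_eq_3 numeral_2_eq_2\<close>)
  then obtain K where K: "\<And>q. small_diffs q (Suc (Suc 2)) (K * (351 / 1000) ^ q) (spline (Suc 2))" by blast
  \<comment> \<open>The bound 1.42 is precise enough: 0.351 * 2 * 1.42 = 0.99684.\<close>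
  have "sqrt 2 \<le> 1.42" by (rule real_le_lsqrt) (simp_all add: power2_eq_square)
  moreover have "sqrt 2 ^ Suc 2 = 2 * sqrt 2" by (simp add: numeral_2_eq_2)
  ultimately have "351 / 1000 * sqrt 2 ^ Suc 2 < (1 :: real)" by simp
  from spline_smooth[OF K _ this] show ?thesis by (simp add: numeral_3_eq_3 numeral_2_eq_2)
qed

section \<open>Fourier transforms\<close>

abbreviation wave :: "real ^ 2 \<Rightarrow> real ^ 2 \<Rightarrow> complex" where
  "wave x \<xi> \<equiv> exp (- 2 * of_real pi * \<i> * of_real (x \<bullet> \<xi>))"

definition fourier :: "(real ^ 2 \<Rightarrow> complex) \<Rightarrow> real ^ 2 \<Rightarrow> complex" where
  "fourier f \<xi> = (LINT x|lborel. f x * wave x \<xi>)"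

lemma fourier_transform_eq: "fourier_transform h = fourier (\<lambda>x. of_real (h x))"
  by (simp add: fun_eq_iff fourier_transform_def fourier_def)

lemma norm_wave [simp]: "norm (wave x \<xi>) = 1"
  by (simp add: norm_exp_eq_Re)

lemma wave_measurable [measurable]: "(\<lambda>x. wave x \<xi>) \<in> borel_measurable borel"
  by measurable

lemma tame_of_real: "tame (h :: real ^ 2 \<Rightarrow> real) \<Longrightarrow> tame (\<lambda>x. complex_of_real (h x))"
  unfolding tame_def by auto

lemma tame_wave: "tame f \<Longrightarrow> tame (\<lambda>x. f x * wave x \<xi>)"
  by (rule tame_mult_bounded[of _ _ 1]) auto

lemma tame_mult_component:
  assumes "tame (f :: real ^ 2 \<Rightarrow> complex)"
  shows "tame (\<lambda>x. c * of_real (x $ i) * f x)"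
proof -
  obtain C R where f: "f \<in> borel_measurable borel" "\<And>x. norm (f x) \<le> C" "\<And>x. R < norm x \<Longrightarrow> f x = 0" "0 \<le> C" "0 \<le> R"
    using tameE[OF assms] by metis
  show ?thesis
  proof (rule tameI[of _ "norm c * R * C" R])
    show "norm (c * of_real (x $ i) * f x) \<le> norm c * R * C" for x
    proof (cases "R < norm x")
      case False
      then have "\<bar>x $ i\<bar> \<le> R" using component_le_norm_cart[of x i] by linarith
      then show ?thesis unfolding norm_mult using f(2)[of x] \<open>0 \<le> R\<close> by (intro mult_mono) auto
    qed (use f in simp)
    have [measurable]: "(\<lambda>x :: real ^ 2. x $ i) \<in> borel_measurable borel"
      by (intro borel_measurable_continuous_onI continuous_intros)
    show "(\<lambda>x. c * of_real (x $ i) * f x) \<in> borel_measurable borel" using f(1) by measurable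
  qed (use f in simp)
qed

lemma norm_exp_imaginary_remainder: "norm (exp (\<i> * of_real t) - 1 - \<i> * of_real t) \<le> t\<^sup>2"
  using Taylor_exp[of "\<i> * of_real t" 1] by (simp add: norm_mult power2_eq_square algebra_simps)

lemma has_derivative_quadratic_bound:
  fixes F :: "'a::real_normed_vector \<Rightarrow> 'b::real_normed_vector"
  assumes "bounded_linear L" "\<And>h. norm (F (x + h) - F x - L h) \<le> C * (norm h)\<^sup>2"
  shows "(F has_derivative L) (at x)"
  unfolding has_derivative_at_alt
proof (intro conjI assms(1) allI impI)
  fix e :: real assume "0 < e"
  show "\<exists>d>0. \<forall>y. norm (y - x) < d \<longrightarrow> norm (F y - F x - L (y - x)) \<le> e * norm (y - x)"
  proof (intro exI conjI allI impI)
    show "0 < e / (\<bar>C\<bar> + 1)" using \<open>0 < e\<close> by simp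
    fix y assume y: "norm (y - x) < e / (\<bar>C\<bar> + 1)"
    have "norm (F y - F x - L (y - x)) \<le> C * (norm (y - x))\<^sup>2" using assms(2)[of "y - x"] by simp
    also have "\<dots> \<le> (\<bar>C\<bar> + 1) * norm (y - x) * norm (y - x)"
      by (simp add: power2_eq_square mult_right_mono flip: mult.assoc)
    also have "\<dots> \<le> e * norm (y - x)"
      using y by (intro mult_right_mono) (auto simp: field_simps)
    finally show "norm (F y - F x - L (y - x)) \<le> e * norm (y - x)" .
  qed
qed

lemma wave_remainder:
  "norm (wave x (\<xi> + h) - wave x \<xi> - (- 2 * of_real pi * \<i>) * of_real (x \<bullet> h) * wave x \<xi>)
     \<le> (2 * pi * norm x * norm h)\<^sup>2"
proof -
  define t where "t = - 2 * pi * (x \<bullet> h)"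
  have t: "(- 2 * of_real pi * \<i>) * of_real (x \<bullet> h) = \<i> * complex_of_real t" by (simp add: t_def)
  have "- 2 * of_real pi * \<i> * of_real (x \<bullet> (\<xi> + h)) = - 2 * of_real pi * \<i> * of_real (x \<bullet> \<xi>) + \<i> * complex_of_real t"
    unfolding t[symmetric] inner_add_right of_real_add by (rule distrib_left)
  then have W: "wave x (\<xi> + h) = wave x \<xi> * exp (\<i> * complex_of_real t)"
    by (simp only: exp_add)
  have "wave x (\<xi> + h) - wave x \<xi> - (- 2 * of_real pi * \<i>) * of_real (x \<bullet> h) * wave x \<xi>
      = wave x \<xi> * (exp (\<i> * complex_of_real t) - 1 - \<i> * complex_of_real t)"
    unfolding W t right_diff_distrib by (simp only: mult_1_right mult_1_left mult.commute)
  then have "norm (wave x (\<xi> + h) - wave x \<xi> - (- 2 * of_real pi * \<i>) * of_real (x \<bullet> h) * wave x \<xi>)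
      = norm (exp (\<i> * complex_of_real t) - 1 - \<i> * complex_of_real t)"
    by (simp only: norm_mult norm_wave mult_1)
  also have "\<dots> \<le> t\<^sup>2" by (rule norm_exp_imaginary_remainder)
  also have "\<dots> \<le> (2 * pi * norm x * norm h)\<^sup>2"
  proof -
    have "\<bar>t\<bar> \<le> 2 * pi * norm x * norm h"
      using Cauchy_Schwarz_ineq2[of x h] by (simp add: t_def abs_mult mult.assoc)
    then show ?thesis using power_mono[of "\<bar>t\<bar>" _ 2] by simp
  qed
  finally show ?thesis .
qed

text \<open>On the support of \<open>f\<close> the second-order remainder of the wave is at most a
  constant times \<open>norm h\<close> squared. Integrated against \<open>f\<close> this gives a
  quadratic error, which justifies differentiation under the integral.\<close>

lemma fourier_has_derivative:
  assumes f: "tame f"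
  shows "(fourier f has_derivative (\<lambda>h. (h $ 1) *\<^sub>R fourier (\<lambda>x. (- 2 * of_real pi * \<i>) * of_real (x $ 1) * f x) \<xi>
     + (h $ 2) *\<^sub>R fourier (\<lambda>x. (- 2 * of_real pi * \<i>) * of_real (x $ 2) * f x) \<xi>)) (at \<xi>)"
proof -
  obtain C R where R: "\<And>x. R < norm x \<Longrightarrow> f x = 0" "0 \<le> R"
    using tameE[OF f] by metis
  define c where "c = - 2 * of_real pi * \<i>"
  define F where "F i x = c * of_real (x $ i) * f x" for i and x :: "real ^ 2"
  have fi: "integrable lborel (\<lambda>x. norm (f x))" using tame_integrable[OF f] by simp
  have int: "integrable lborel (\<lambda>x. f x * wave x \<eta>)" "integrable lborel (\<lambda>x. F i x * wave x \<eta>)" for \<eta> i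
    unfolding F_def by (intro tame_integrable tame_wave tame_mult_component f)+
  define B where "B = (2 * pi * R)\<^sup>2 * (LINT x|lborel. norm (f x))"
  have bl: "bounded_linear (\<lambda>h. (h $ 1) *\<^sub>R fourier (F 1) \<xi> + (h $ 2) *\<^sub>R fourier (F 2) \<xi>)"
    by (intro bounded_linear_add bounded_linear_scaleR_const bounded_linear_vec_nth)
  have bound: "norm (fourier f (\<xi> + h) - fourier f \<xi> - ((h $ 1) *\<^sub>R fourier (F 1) \<xi> + (h $ 2) *\<^sub>R fourier (F 2) \<xi>)) \<le> B * (norm h)\<^sup>2" for h
  proof -
    define r where "r x = f x * (wave x (\<xi> + h) - wave x \<xi> - c * of_real (x \<bullet> h) * wave x \<xi>)" for x
    have r: "r x = f x * wave x (\<xi> + h) - f x * wave x \<xi>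
        - (of_real (h $ 1) * (F 1 x * wave x \<xi>) + of_real (h $ 2) * (F 2 x * wave x \<xi>))" for x
    proof -
      define U W where "U = wave x (\<xi> + h)" and "W = wave x \<xi>"
      have "x \<bullet> h = x $ 1 * h $ 1 + x $ 2 * h $ 2" by (simp add: inner_vec_def sum_2)
      then show ?thesis unfolding r_def F_def U_def[symmetric] W_def[symmetric] by (simp add: algebra_simps)
    qed
    have ir: "integrable lborel r"
      unfolding r[abs_def] using int
      by (intro Bochner_Integration.integrable_diff Bochner_Integration.integrable_add integrable_mult_right) auto
    have "fourier f (\<xi> + h) - fourier f \<xi> - ((h $ 1) *\<^sub>R fourier (F 1) \<xi> + (h $ 2) *\<^sub>R fourier (F 2) \<xi>) = (LINT x|lborel. r x)"
      unfolding fourier_def r scaleR_conv_of_real using int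
      by (simp only: Bochner_Integration.integral_diff Bochner_Integration.integral_add
          Bochner_Integration.integrable_diff Bochner_Integration.integrable_add integrable_mult_right
          integral_mult_right_zero)
    also have "norm \<dots> \<le> (LINT x|lborel. (2 * pi * R * norm h)\<^sup>2 * norm (f x))"
    proof (rule Bochner_Integration.integral_norm_bound_integral[OF ir])
      show "integrable lborel (\<lambda>x. (2 * pi * R * norm h)\<^sup>2 * norm (f x))" using fi by simp
      fix x
      show "norm (r x) \<le> (2 * pi * R * norm h)\<^sup>2 * norm (f x)"
      proof (cases "R < norm x")
        case False
        have "norm (r x) \<le> norm (f x) * (2 * pi * norm x * norm h)\<^sup>2"
          unfolding r_def norm_mult[of "f x"] c_def by (intro mult_left_mono wave_remainder) simp
        also have "\<dots> \<le> norm (f x) * (2 * pi * R * norm h)\<^sup>2"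
          using False \<open>0 \<le> R\<close> by (intro mult_left_mono power_mono mult_right_mono) auto
        finally show ?thesis by (simp only: mult.commute)
      next
        case True
        then have "f x = 0" by (rule R)
        then show ?thesis by (simp add: r_def)
      qed
    qed
    also have "\<dots> = B * (norm h)\<^sup>2"
      by (simp add: B_def power_mult_distrib)
    finally show ?thesis .
  qed
  show ?thesis
    using has_derivative_quadratic_bound[OF bl bound] by (simp only: F_def[abs_def] c_def)
qed

lemma partial_derivativeI:
  assumes "(F has_derivative (\<lambda>h. (h $ 1) *\<^sub>R D 1 + (h $ 2) *\<^sub>R D 2)) (at x)"
  shows "partial_derivative i F x = D i"
proof -
  have "partial_derivative i F x = (axis i 1 $ 1) *\<^sub>R D 1 + (axis i 1 $ 2) *\<^sub>R D 2"
    by (simp add: partial_derivative_def frechet_derivative_at[OF assms, symmetric])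
  then show ?thesis using exhaust_2[of i] by (auto simp: axis_def)
qed

text \<open>Partial derivatives of a transform are transforms of tame functions again, so the
  induction runs over all tame \<open>f\<close> simultaneously.\<close>

lemma cont_diff_fourier: "tame f \<Longrightarrow> cont_diff_on m UNIV (fourier f)"
proof (induction m arbitrary: f)
  case 0
  then show ?case
    using has_derivative_continuous[OF fourier_has_derivative] by (auto simp: continuous_on_eq_continuous_at)
next
  case (Suc m)
  have "partial_derivative i (fourier f) = fourier (\<lambda>x. (- 2 * of_real pi * \<i>) * of_real (x $ i) * f x)" for i
    by (rule ext) (rule partial_derivativeI[OF fourier_has_derivative[OF Suc.prems]])
  then have e: "partial_derivative i (fourier f) = fourier (\<lambda>x. (- 2 * of_real pi * \<i>) * of_real (x $ i) * f x)" for i .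
  show ?case
    unfolding cont_diff_on.simps
  proof (intro conjI ballI allI)
    show "fourier f differentiable at x" for x
      unfolding differentiable_def using fourier_has_derivative[OF Suc.prems] by blast
    show "cont_diff_on m UNIV (partial_derivative i (fourier f))" for i
      unfolding e by (rule Suc.IH[OF tame_mult_component[OF Suc.prems]])
  qed
qed

section \<open>Product rule and orders of vanishing\<close>

lemma cont_diff_on_Suc_imp: "cont_diff_on (Suc m) UNIV F \<Longrightarrow> cont_diff_on m UNIV F"
proof (induction m arbitrary: F)
  case 0
  then show ?case
    by (auto simp: continuous_on_eq_continuous_at differentiable_imp_continuous_within)
qed auto

lemma partial_derivative_add:
  assumes "F differentiable at x" "G differentiable at x"
  shows "partial_derivative i (\<lambda>x. F x + G x) x = partial_derivative i F x + partial_derivative i G x"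
proof -
  have "((\<lambda>x. F x + G x) has_derivative (\<lambda>h. frechet_derivative F (at x) h + frechet_derivative G (at x) h)) (at x)"
    using assms by (intro has_derivative_add) (simp_all add: frechet_derivative_works)
  from frechet_derivative_at[OF this, symmetric] show ?thesis by (simp add: partial_derivative_def)
qed

lemma partial_derivative_mult:
  fixes F G :: "real ^ 2 \<Rightarrow> 'b::real_normed_algebra"
  assumes "F differentiable at x" "G differentiable at x"
  shows "partial_derivative i (\<lambda>x. F x * G x) x = F x * partial_derivative i G x + partial_derivative i F x * G x"
proof -
  have "((\<lambda>x. F x * G x) has_derivative (\<lambda>h. F x * frechet_derivative G (at x) h + frechet_derivative F (at x) h * G x)) (at x)"
    using assms by (intro has_derivative_mult) (simp_all add: frechet_derivative_works)
  from frechet_derivative_at[OF this, symmetric] show ?thesis by (simp add: partial_derivative_def)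
qed

lemma cont_diff_on_add:
  "cont_diff_on m UNIV F \<Longrightarrow> cont_diff_on m UNIV G \<Longrightarrow> cont_diff_on m UNIV (\<lambda>x. F x + G x)"
proof (induction m arbitrary: F G)
  case 0
  then show ?case by (auto intro: continuous_intros)
next
  case (Suc m)
  then have "partial_derivative i (\<lambda>x. F x + G x) = (\<lambda>x. partial_derivative i F x + partial_derivative i G x)" for i
    by (auto simp: partial_derivative_add)
  with Suc show ?case by simp
qed

lemma cont_diff_on_mult:
  fixes F G :: "real ^ 2 \<Rightarrow> 'b::real_normed_algebra"
  shows "cont_diff_on m UNIV F \<Longrightarrow> cont_diff_on m UNIV G \<Longrightarrow> cont_diff_on m UNIV (\<lambda>x. F x * G x)"
proof (induction m arbitrary: F G)
  case 0
  then show ?case by (auto intro: continuous_intros)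
next
  case (Suc m)
  then have e: "partial_derivative i (\<lambda>x. F x * G x) = (\<lambda>x. F x * partial_derivative i G x + partial_derivative i F x * G x)" for i
    by (auto simp: partial_derivative_mult)
  have "cont_diff_on m UNIV F" "cont_diff_on m UNIV G" using Suc.prems by (auto intro: cont_diff_on_Suc_imp)
  with Suc show ?case by (auto simp: e intro!: cont_diff_on_add Suc.IH)
qed

text \<open>All iterated partial derivatives of order below \<open>m\<close>, in any order of
  directions, are zero at \<open>z\<close>; thus \<open>vanishes (Suc m)\<close> is the counterpart
  of \<open>zero_of_order_gt m\<close>. The recursion on one derivative at a time suits the product
  rule.\<close>

primrec vanishes :: "nat \<Rightarrow> real ^ 2 \<Rightarrow> (real ^ 2 \<Rightarrow> 'b::real_normed_vector) \<Rightarrow> bool" where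
  "vanishes 0 z F \<longleftrightarrow> True"
| "vanishes (Suc m) z F \<longleftrightarrow> F z = 0 \<and> (\<forall>i. vanishes m z (partial_derivative i F))"

lemma vanishes_Suc_imp: "vanishes (Suc m) z F \<Longrightarrow> vanishes m z F"
  by (induction m arbitrary: F) auto

lemma vanishes_funpow: "vanishes (k + m) z F \<Longrightarrow> vanishes m z ((partial_derivative i ^^ k) F)"
  by (induction k arbitrary: F) (auto simp: funpow_Suc_right simp del: funpow.simps)

lemma vanishes_mixed_derivative:
  assumes "vanishes (Suc m) z F" "a + b \<le> m"
  shows "mixed_derivative a b F z = 0"
proof -
  have "Suc m = b + (a + Suc (m - a - b))" using assms(2) by simp
  then have "vanishes (Suc (m - a - b)) z (mixed_derivative a b F)"
    unfolding mixed_derivative_def using assms(1) by (intro vanishes_funpow) simp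
  then show ?thesis by simp
qed

lemma vanishes_add:
  "cont_diff_on m UNIV F \<Longrightarrow> cont_diff_on m UNIV G \<Longrightarrow> vanishes m z F \<Longrightarrow> vanishes m z G \<Longrightarrow>
    vanishes m z (\<lambda>x. F x + G x)"
proof (induction m arbitrary: F G)
  case (Suc m)
  then have "partial_derivative i (\<lambda>x. F x + G x) = (\<lambda>x. partial_derivative i F x + partial_derivative i G x)" for i
    by (auto simp: partial_derivative_add)
  with Suc show ?case by simp
qed simp

text \<open>Induction on the total order: the product rule lowers the order of exactly one factor by
  one, so both resulting terms vanish to order a + b - 1.\<close>

lemma vanishes_mult:
  fixes F G :: "real ^ 2 \<Rightarrow> 'b::real_normed_algebra"
  assumes "cont_diff_on (a + b) UNIV F" "cont_diff_on (a + b) UNIV G" "vanishes a z F" "vanishes b z G"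
  shows "vanishes (a + b) z (\<lambda>x. F x * G x)"
  using assms
proof (induction "a + b" arbitrary: a b F G)
  case (Suc n)
  have S: "cont_diff_on (Suc n) UNIV F" "cont_diff_on (Suc n) UNIV G" using Suc by simp_all
  then have d: "F differentiable at x" "G differentiable at x" for x by simp_all
  have e: "partial_derivative i (\<lambda>x. F x * G x) = (\<lambda>x. F x * partial_derivative i G x + partial_derivative i F x * G x)" for i
    using d by (auto simp: partial_derivative_mult)
  have Sn: "cont_diff_on n UNIV F" "cont_diff_on n UNIV G"
    "cont_diff_on n UNIV (partial_derivative i F)" "cont_diff_on n UNIV (partial_derivative i G)" for i
    using S by (auto intro: cont_diff_on_Suc_imp)
  have left: "vanishes n z (\<lambda>x. F x * partial_derivative i G x)" for i
  proof (cases b)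
    \<comment> \<open>When b = 0 the factor \<open>G\<close> has no order to lose; here
      \<open>F\<close> alone has order n + 1, one more than the term needs.\<close>
    case 0
    with Suc.hyps(2) have "a = Suc n" by simp
    with Suc.prems have "vanishes n z F" using vanishes_Suc_imp by blast
    with Suc.hyps(1)[of n 0] Sn show ?thesis by simp
  next
    case (Suc b')
    with Suc.hyps Suc.prems Sn show ?thesis using Suc.hyps(1)[of a b' F "partial_derivative i G"] by simp
  qed
  have right: "vanishes n z (\<lambda>x. partial_derivative i F x * G x)" for i
  proof (cases a)
    case 0
    with Suc.hyps(2) have "b = Suc n" by simp
    with Suc.prems have "vanishes n z G" using vanishes_Suc_imp by blast
    with Suc.hyps(1)[of 0 n] Sn show ?thesis by simp
  next
    case (Suc a')
    with Suc.hyps Suc.prems Sn show ?thesis using Suc.hyps(1)[of a' b "partial_derivative i F" G] by simp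
  qed
  have "F z * G z = 0" using Suc.hyps(2) Suc.prems(3,4) by (cases a; cases b) auto
  moreover have "vanishes n z (partial_derivative i (\<lambda>x. F x * G x))" for i
    unfolding e by (intro vanishes_add cont_diff_on_mult Sn left right)
  ultimately show ?case unfolding Suc.hyps(2)[symmetric] by simp
qed simp

lemma vanishes_power:
  fixes F :: "real ^ 2 \<Rightarrow> complex"
  assumes "\<And>m. cont_diff_on m UNIV F" "F z = 0"
  shows "(\<forall>m. cont_diff_on m UNIV (\<lambda>x. F x ^ Suc n)) \<and> vanishes (Suc n) z (\<lambda>x. F x ^ Suc n)"
proof (induction n)
  case 0
  then show ?case using assms by simp
next
  case (Suc n)
  have "vanishes (1 + Suc n) z (\<lambda>x. F x * F x ^ Suc n)"
    using assms Suc by (intro vanishes_mult) auto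
  moreover have "cont_diff_on m UNIV (\<lambda>x. F x * F x ^ Suc n)" for m
    using assms Suc by (intro cont_diff_on_mult) auto
  ultimately show ?case by simp
qed

section \<open>Zeros at the lattice\<close>

lemma wave_add: "wave (x + y) \<xi> = wave x \<xi> * wave y \<xi>"
  unfolding inner_add_left of_real_add distrib_left by (rule exp_add)

lemma fourier_convolution:
  assumes f: "tame f" and g: "tame g"
  shows "fourier (\<lambda>x. of_real (convolution f g x)) \<xi> = fourier (\<lambda>x. of_real (f x)) \<xi> * fourier (\<lambda>x. of_real (g x)) \<xi>"
proof -
  obtain C R where fR: "\<And>x. norm (f x) \<le> C" "\<And>x. R < norm x \<Longrightarrow> f x = 0" "0 \<le> C" "0 \<le> R"
    using tameE[OF f] by metis
  obtain D S where gS: "\<And>x. norm (g x) \<le> D" "\<And>x. S < norm x \<Longrightarrow> g x = 0" "0 \<le> D" "0 \<le> S"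
    using tameE[OF g] by metis
  have [measurable]: "f \<in> borel_measurable borel" "g \<in> borel_measurable borel"
    using f g by (auto dest: tame_measurable)
  define H where "H p = complex_of_real (f (snd p)) * of_real (g (fst p - snd p)) * wave (fst p) \<xi>" for p
  have H_meas: "H \<in> borel_measurable (borel \<Otimes>\<^sub>M borel)"
    unfolding H_def by measurable
  have "integrable lborel H"
  \<comment> \<open>A nonzero value forces |y| <= R and |x - y| <= S, hence |x| + |y| <= 2 R + S;
    boundedness on this ball makes the order of integration exchangeable.\<close>
  proof (rule integrableI_bounded_set[of "cball 0 (2 * R + S)" _ _ "C * D"])
    show "emeasure lborel (cball 0 (2 * R + S) :: ((real ^ 2) \<times> (real ^ 2)) set) < \<infinity>"
      by (rule emeasure_bounded_finite) simp
    show "H \<in> borel_measurable lborel" using H_meas by (simp add: borel_prod)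
    show "AE p \<in> cball 0 (2 * R + S) in lborel. norm (H p) \<le> C * D"
      using fR gS by (intro AE_I2) (auto simp: H_def norm_mult intro!: mult_mono)
    have "H p = 0" if "p \<notin> cball 0 (2 * R + S)" for p
    proof -
      obtain x y where p: "p = (x, y)" by (cases p)
      have "2 * R + S < norm x + norm y" using that norm_Pair_le[of x y] by (simp add: p)
      then have "R < norm y \<or> S < norm (x - y)" using norm_triangle_ineq2[of x y] by linarith
      then show ?thesis using fR gS by (auto simp: H_def p)
    qed
    then show "AE p in lborel. p \<notin> cball 0 (2 * R + S) \<longrightarrow> H p = 0" by simp
  qed simp
  then have int: "integrable (lborel \<Otimes>\<^sub>M lborel) (\<lambda>(x, y). H (x, y))" by (simp add: lborel_prod)
  have "fourier (\<lambda>x. of_real (convolution f g x)) \<xi> = (LINT x|lborel. LINT y|lborel. H (x, y))"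
    unfolding fourier_def convolution_def H_def
    by (simp flip: of_real_mult integral_complex_of_real add: integral_mult_left_zero)
  also have "\<dots> = (LINT y|lborel. LINT x|lborel. H (x, y))"
    by (rule lborel_pair.Fubini_integral[symmetric]) (rule int)
  also have "\<dots> = (LINT y|lborel. of_real (f y) * wave y \<xi> * fourier (\<lambda>x. of_real (g x)) \<xi>)"
  proof (intro Bochner_Integration.integral_cong refl)
    fix y
    have "(LINT x|lborel. H (x, y)) = (LINT x|lborel. H (x + y, y))"
      by (rule integral_translate[symmetric]) (use H_meas in measurable)
    also have "\<dots> = (LINT x|lborel. (of_real (f y) * wave y \<xi>) * (of_real (g x) * wave x \<xi>))"
      by (intro Bochner_Integration.integral_cong refl) (unfold H_def fst_conv snd_conv add_diff_cancel_right' wave_add, simp only: mult_ac)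
    also have "\<dots> = of_real (f y) * wave y \<xi> * fourier (\<lambda>x. of_real (g x)) \<xi>"
      unfolding fourier_def by (rule integral_mult_right_zero)
    finally show "(LINT x|lborel. H (x, y)) = of_real (f y) * wave y \<xi> * fourier (\<lambda>x. of_real (g x)) \<xi>" .
  qed
  also have "\<dots> = fourier (\<lambda>x. of_real (f x)) \<xi> * fourier (\<lambda>x. of_real (g x)) \<xi>"
    unfolding fourier_def by (rule integral_mult_left_zero)
  finally show ?thesis .
qed

section \<open>Transforms of the tile and of its splines\<close>

abbreviation "tile_fourier \<equiv> fourier_transform (indicator bear_tile)"

lemma fourier_transform_spline: "fourier_transform (spline n) = (\<lambda>\<xi>. tile_fourier \<xi> ^ Suc n)"
proof (induction n)
  case 0
  then show ?case by simp
next
  case (Suc n)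
  show ?case
  proof
    fix \<xi>
    have "fourier_transform (spline (Suc n)) \<xi> = fourier_transform (spline n) \<xi> * tile_fourier \<xi>"
      unfolding fourier_transform_eq tile_bspline.simps by (rule fourier_convolution[OF tame_spline tame_tile])
    then show "fourier_transform (spline (Suc n)) \<xi> = tile_fourier \<xi> ^ Suc (Suc n)"
      using Suc by (simp only: power_Suc2[of _ "Suc n"])
  qed
qed

lemma tile_fourier_0: "tile_fourier 0 = of_real (measure lborel bear_tile)"
  by (simp add: fourier_transform_def)

text \<open>The inverse transpose of M, through which frequencies move under the refinement
  equation.\<close>

definition dual :: "real ^ 2 \<Rightarrow> real ^ 2" where "dual \<xi> = vector [- \<xi> $ 2 / 2, \<xi> $ 1 + \<xi> $ 2 / 2]"

lemma inner_dual: "bear x \<bullet> dual \<xi> = x \<bullet> \<xi>"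
  by (simp add: inner_vec_def sum_2 dual_def field_simps)

text \<open>Both terms of the almost everywhere refinement equation are transformed; the factor 2 is
  det M and the wave comes from the translation by \<open>e1\<close>.\<close>

lemma tile_fourier_refinement: "2 * tile_fourier \<xi> = (1 + wave e1 (dual \<xi>)) * tile_fourier (dual \<xi>)"
proof -
  let ?c = "\<lambda>x. complex_of_real (indicator bear_tile x)"
  let ?h = "\<lambda>z. ?c z * wave z (dual \<xi>)" and ?k = "\<lambda>z. ?c (z + (- e1)) * wave z (dual \<xi>)"
  have c: "tame ?c" by (rule tame_of_real[OF tame_tile])
  have int: "integrable lborel ?h" "integrable lborel ?k"
    by (intro tame_integrable tame_wave c tame_translate[OF c])+
  have "tile_fourier \<xi> = (LINT x|lborel. ?h (bear x) + ?k (bear x))"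
    unfolding fourier_transform_def
  proof (rule integral_cong_AE)
    show "AE x in lborel. ?c x * wave x \<xi> = ?h (bear x) + ?k (bear x)"
      using bear_tile_refinement
    proof eventually_elim
      fix x :: "real ^ 2"
      assume "indicator bear_tile x = (indicator bear_tile (bear x) + indicator bear_tile (bear x + (- e1)) :: real)"
      then have "?c x = ?c (bear x) + ?c (bear x + (- e1))" by (simp only: of_real_add)
      then show "?c x * wave x \<xi> = ?h (bear x) + ?k (bear x)"
        unfolding inner_dual by (simp only: distrib_right)
    qed
  qed measurable
  moreover have "(LINT x|lborel. ?h x + ?k x) = 2 *\<^sub>R (LINT x|lborel. ?h (bear x) + ?k (bear x))"
    by (rule integral_bear) measurable
  moreover have "(LINT x|lborel. ?h x + ?k x) = (LINT x|lborel. ?h x) + (LINT x|lborel. ?k x)"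
    by (rule Bochner_Integration.integral_add[OF int])
  moreover have "(LINT x|lborel. ?k x) = (LINT x|lborel. wave e1 (dual \<xi>) * ?h x)"
  proof -
    have "(LINT x|lborel. ?k x) = (LINT x|lborel. ?k (x + e1))"
      by (rule integral_translate[symmetric]) measurable
    also have "\<dots> = (LINT x|lborel. wave e1 (dual \<xi>) * ?h x)"
    proof (intro Bochner_Integration.integral_cong refl)
      fix x
      have "x + e1 + - e1 = x" by simp
      then show "?k (x + e1) = wave e1 (dual \<xi>) * ?h x"
        unfolding wave_add by (simp only: mult_ac)
    qed
    finally show ?thesis .
  qed
  moreover have "\<dots> = wave e1 (dual \<xi>) * (LINT x|lborel. ?h x)"
    by (rule integral_mult_right_zero)
  moreover have "(LINT x|lborel. ?h x) = tile_fourier (dual \<xi>)" by (simp only: fourier_transform_def)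
  ultimately show ?thesis
    by (simp add: scaleR_conv_of_real distrib_right)
qed

text \<open>The form \<open>2 a\<^sup>2 + a b + b\<^sup>2\<close> halves under \<open>dual\<close>, so after finitely many steps the
  second coordinate of the frequency is odd and the mask vanishes there.\<close>

lemma tile_fourier_zero:
  fixes k :: "int ^ 2"
  assumes "k \<noteq> 0"
  shows "tile_fourier (lattice_point k) = 0"
  using assms
proof (induction "nat (2 * (k $ 1)\<^sup>2 + k $ 1 * k $ 2 + (k $ 2)\<^sup>2)" arbitrary: k rule: less_induct)
  case less
  show ?case
  proof (cases "even (k $ 2)")
    case False
    then obtain m where m: "k $ 2 = 2 * m + 1" by (rule oddE)
    \<comment> \<open>The first coordinate of \<open>dual\<close> is minus half the second
      coordinate of \<open>k\<close>, a half-integer here. The wave is then -1 and the factor 1 +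
      wave vanishes.\<close>
    have e: "e1 \<bullet> dual (lattice_point k) = - of_int m - 1 / 2"
      by (simp add: inner_vec_def sum_2 dual_def m)
    have "- 2 * of_real pi * \<i> * complex_of_real (e1 \<bullet> dual (lattice_point k))
        = (2 * of_int m + 1) * of_real pi * \<i>"
      unfolding e by (simp add: algebra_simps)
    then have "wave e1 (dual (lattice_point k)) = exp ((2 * of_int m + 1) * of_real pi * \<i>)"
      by (simp only:)
    also have "\<dots> = - 1" using exp_integer_2pi_plus1[of "of_int m"] by simp
    finally show ?thesis using tile_fourier_refinement[of "lattice_point k"] by simp
  next
    case True
    then obtain m where m: "k $ 2 = 2 * m" by (rule evenE)
    define k' :: "int ^ 2" where "k' = vector [- m, k $ 1 + m]"
    have dual: "dual (lattice_point k) = lattice_point k'"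
      by (simp add: dual_def k'_def vec2_eq_iff m)
    have "k' \<noteq> 0" using less.prems by (auto simp: k'_def vec2_eq_iff m)
    moreover have "2 * (k $ 1)\<^sup>2 + k $ 1 * k $ 2 + (k $ 2)\<^sup>2 = 2 * (2 * (k' $ 1)\<^sup>2 + k' $ 1 * k' $ 2 + (k' $ 2)\<^sup>2)"
      by (simp add: k'_def m power2_eq_square algebra_simps)
    moreover have "0 < 2 * (k' $ 1)\<^sup>2 + k' $ 1 * k' $ 2 + (k' $ 2)\<^sup>2"
    proof -
      \<comment> \<open>Completing the square shows that the form, of discriminant -7, is positive
        definite. Its value at \<open>k\<close> is positive and twice that at \<open>k'\<close>, so
        the induction measure drops strictly.\<close>
      have "4 * (2 * (k' $ 1)\<^sup>2 + k' $ 1 * k' $ 2 + (k' $ 2)\<^sup>2) = 7 * (k' $ 1)\<^sup>2 + (k' $ 1 + 2 * k' $ 2)\<^sup>2"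
        by (simp add: power2_eq_square algebra_simps)
      moreover have "0 < 7 * (k' $ 1)\<^sup>2 + (k' $ 1 + 2 * k' $ 2)\<^sup>2"
        using \<open>k' \<noteq> 0\<close> by (cases "k' $ 1 = 0") (auto simp: vec2_eq_iff add_pos_nonneg)
      ultimately have "0 < 4 * (2 * (k' $ 1)\<^sup>2 + k' $ 1 * k' $ 2 + (k' $ 2)\<^sup>2)" by (simp only:)
      then show ?thesis unfolding zero_less_mult_iff by simp
    qed
    ultimately have "tile_fourier (lattice_point k') = 0" by (intro less.hyps) auto
    then show ?thesis using tile_fourier_refinement[of "lattice_point k"] by (simp add: dual)
  qed
qed

lemma spline_fourier_zero_order:
  assumes "k \<noteq> 0"
  shows "zero_of_order_gt n (fourier_transform (\<lambda>x. spline n x / c)) (lattice_point k)"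
proof -
  let ?F = "\<lambda>\<xi>. tile_fourier \<xi> ^ Suc n"
  have smooth: "cont_diff_on m UNIV tile_fourier" for m
    unfolding fourier_transform_eq by (intro cont_diff_fourier tame_of_real tame_tile)
  from vanishes_power[OF smooth tile_fourier_zero[OF assms], of n]
  have F: "\<And>m. cont_diff_on m UNIV ?F" "vanishes (Suc n) (lattice_point k) ?F" by auto
  have const: "cont_diff_on m UNIV (\<lambda>_ :: real ^ 2. b)" for m and b :: complex
  proof (induction m arbitrary: b)
    case (Suc m)
    have "partial_derivative i (\<lambda>_ :: real ^ 2. b) = (\<lambda>_. 0)" for i
      by (simp add: fun_eq_iff partial_derivative_def)
    then show ?case using Suc by simp
  qed simp
  have e: "fourier_transform (\<lambda>x. spline n x / c) = (\<lambda>\<xi>. ?F \<xi> * of_real (1 / c))"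
  proof
    fix \<xi>
    have "fourier_transform (\<lambda>x. spline n x / c) \<xi> = fourier_transform (spline n) \<xi> * of_real (1 / c)"
      unfolding fourier_transform_def by (simp flip: integral_mult_left_zero add: mult_ac divide_inverse)
    then show "fourier_transform (\<lambda>x. spline n x / c) \<xi> = ?F \<xi> * of_real (1 / c)"
      unfolding fourier_transform_spline .
  qed
  have "vanishes (Suc n + 0) (lattice_point k) (\<lambda>\<xi>. ?F \<xi> * of_real (1 / c))"
    using F const by (intro vanishes_mult) auto
  then have v: "vanishes (Suc n) (lattice_point k) (\<lambda>\<xi>. ?F \<xi> * of_real (1 / c))"
    by (simp only: add_0_right)
  have "cont_diff_on n UNIV (\<lambda>\<xi>. ?F \<xi> * of_real (1 / c))"
    by (intro cont_diff_on_mult F const)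
  then show ?thesis
    unfolding zero_of_order_gt_def e using vanishes_mixed_derivative[OF v] open_UNIV by blast
qed

section \<open>Convergence\<close>

lemma deriv_family_scale:
  fixes g :: "2 list \<Rightarrow> real ^ 2 \<Rightarrow> real"
  assumes "deriv_family r g"
  shows "deriv_family r (\<lambda>w x. g w x / c)"
  unfolding deriv_family_def
proof (intro conjI allI impI)
  fix w :: "2 list" and x assume "length w < r"
  then have "(g w has_derivative (\<lambda>h. (h $ 1) *\<^sub>R g (1 # w) x + (h $ 2) *\<^sub>R g (2 # w) x)) (at x)"
    using assms by (simp add: deriv_family_def)
  from has_derivative_mult_right[OF this, of "1 / c"]
  show "((\<lambda>x. g w x / c) has_derivative (\<lambda>h. (h $ 1) *\<^sub>R (g (1 # w) x / c) + (h $ 2) *\<^sub>R (g (2 # w) x / c))) (at x)"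
    by (simp add: add_divide_distrib)
next
  fix w :: "2 list" assume "length w \<le> r"
  then have "continuous_on UNIV (g w)" using assms by (simp add: deriv_family_def)
  from continuous_on_mult_left[OF this, of "1 / c"]
  show "continuous_on UNIV (\<lambda>x. g w x / c)" by simp
qed

lemma deriv_family_partial_derivative:
  assumes "deriv_family r g" "length w < r"
  shows "partial_derivative i (g w) = g (i # w)"
proof
  fix x
  have "(g w has_derivative (\<lambda>h. (h $ 1) *\<^sub>R g (1 # w) x + (h $ 2) *\<^sub>R g (2 # w) x)) (at x)"
    using assms by (simp add: deriv_family_def)
  from partial_derivativeI[where D = "\<lambda>i. g (i # w) x", OF this]
  show "partial_derivative i (g w) x = g (i # w) x" .
qed

lemma deriv_family_cont_diff:
  assumes g: "deriv_family r g"
  shows "length w + m = r \<Longrightarrow> cont_diff_on m UNIV (g w)"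
proof (induction m arbitrary: w)
  case 0
  then show ?case using g by (simp add: deriv_family_def)
next
  case (Suc m)
  then have "length w < r" by simp
  then have "g w differentiable at x" for x
    using g unfolding deriv_family_def differentiable_def by blast
  moreover have "cont_diff_on m UNIV (g (i # w))" for i using Suc by simp
  ultimately show ?case using deriv_family_partial_derivative[OF g \<open>length w < r\<close>] by simp
qed

lemma deriv_family_funpow:
  assumes g: "deriv_family r g"
  shows "length w + k \<le> r \<Longrightarrow> (partial_derivative i ^^ k) (g w) = g (replicate k i @ w)"
proof (induction k)
  case (Suc k)
  then show ?case using deriv_family_partial_derivative[OF g, of "replicate k i @ w"] by simp
qed simp

lemma deriv_family_mixed_derivative:
  assumes "deriv_family r g" "a + b \<le> r"
  shows "mixed_derivative a b (g []) = g (replicate a 1 @ replicate b 2)"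
  using assms deriv_family_funpow[OF assms(1), of "[]" b 2]
    deriv_family_funpow[OF assms(1), of "replicate b 2" a 1]
  by (simp add: mixed_derivative_def)

lemma deriv_family_C_space:
  fixes g :: "2 list \<Rightarrow> real ^ 2 \<Rightarrow> real"
  assumes g: "deriv_family r g" and "\<And>w. length w \<le> r \<Longrightarrow> bounded (range (g w))"
  shows "g [] \<in> C_space r"
  unfolding C_space_def
  using deriv_family_cont_diff[OF g, of "[]" r] deriv_family_mixed_derivative[OF g] assms(2) by auto

section \<open>Smoothness and boundedness of lattice sums\<close>

lemma bounded_range_of_support:
  fixes f :: "real ^ 2 \<Rightarrow> real"
  assumes "continuous_on UNIV f" "\<And>x. R < norm x \<Longrightarrow> f x = 0"
  shows "bounded (range f)"
proof -
  have "compact (f ` cball 0 R)"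
    by (intro compact_continuous_image continuous_on_subset[OF assms(1)]) auto
  then have "bounded (insert 0 (f ` cball 0 R))" by (simp add: compact_imp_bounded)
  moreover have "range f \<subseteq> insert 0 (f ` cball 0 R)" using assms(2) by force
  ultimately show ?thesis by (rule bounded_subset)
qed

lemma lattice_sum_local:
  assumes "\<And>x. R < norm x \<Longrightarrow> f x = 0" "dist y x < 1"
  shows "lattice_sum f u y = (\<Sum>k | norm (lattice_point k - x) \<le> R + 1. u k * f (y - lattice_point k))"
proof (rule lattice_sum_eq_sum[OF finite_lattice_ball])
  fix k assume "k \<notin> {k. norm (lattice_point k - x) \<le> R + 1}"
  then have "R < norm (y - lattice_point k)"
    using norm_triangle_ineq[of "lattice_point k - y" "y - x"] assms(2) by (simp add: dist_norm norm_minus_commute)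
  then show "u k * f (y - lattice_point k) = 0" using assms(1) by simp
qed

text \<open>On the unit ball around \<open>x\<close> the sum runs over one finite index set, common
  to all words, so it can be differentiated term by term.\<close>

lemma deriv_family_lattice_sum:
  fixes g :: "2 list \<Rightarrow> real ^ 2 \<Rightarrow> real"
  assumes g: "deriv_family r g" and supp: "\<And>w x. length w \<le> r \<Longrightarrow> R < norm x \<Longrightarrow> g w x = 0"
  shows "deriv_family r (\<lambda>w. lattice_sum (g w) u)"
proof -
  define F where "F x = {k. norm (lattice_point k - x) \<le> R + 1}" for x
  have fin: "finite (F x)" for x unfolding F_def by (rule finite_lattice_ball)
  have loc: "lattice_sum (g w) u y = (\<Sum>k\<in>F x. u k * g w (y - lattice_point k))"
    if "length w \<le> r" "dist y x < 1" for w x y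
    unfolding F_def by (rule lattice_sum_local) (use supp that in auto)
  show ?thesis
    unfolding deriv_family_def
  proof (intro conjI allI impI)
    fix w :: "2 list" and x assume w: "length w < r"
    have "((\<lambda>y. \<Sum>k\<in>F x. u k * g w (y - lattice_point k)) has_derivative
        (\<lambda>h. \<Sum>k\<in>F x. u k * (h $ 1 * g (1 # w) (x - lattice_point k) + h $ 2 * g (2 # w) (x - lattice_point k)))) (at x)"
    proof (intro has_derivative_sum has_derivative_mult_right)
      fix k
      have "(g w has_derivative (\<lambda>h. h $ 1 * g (1 # w) (x - lattice_point k) + h $ 2 * g (2 # w) (x - lattice_point k)))
          (at (x - lattice_point k))"
        using g w by (simp add: deriv_family_def)
      moreover have "((\<lambda>y. y - lattice_point k) has_derivative (\<lambda>h. h)) (at x)"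
        by (auto intro!: derivative_eq_intros)
      ultimately show "((\<lambda>y. g w (y - lattice_point k)) has_derivative
          (\<lambda>h. h $ 1 * g (1 # w) (x - lattice_point k) + h $ 2 * g (2 # w) (x - lattice_point k))) (at x)"
        using has_derivative_compose by blast
    qed
    moreover have "(\<Sum>k\<in>F x. u k * (h $ 1 * g (1 # w) (x - lattice_point k) + h $ 2 * g (2 # w) (x - lattice_point k)))
        = h $ 1 *\<^sub>R lattice_sum (g (1 # w)) u x + h $ 2 *\<^sub>R lattice_sum (g (2 # w)) u x" for h :: "real ^ 2"
      using w by (simp add: loc[of _ x x] sum_distrib_left sum.distrib distrib_left mult_ac)
    ultimately have "((\<lambda>y. \<Sum>k\<in>F x. u k * g w (y - lattice_point k)) has_derivative
        (\<lambda>h. h $ 1 *\<^sub>R lattice_sum (g (1 # w)) u x + h $ 2 *\<^sub>R lattice_sum (g (2 # w)) u x)) (at x)"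
      by (simp only:)
    then show "(lattice_sum (g w) u has_derivative
        (\<lambda>h. h $ 1 *\<^sub>R lattice_sum (g (1 # w)) u x + h $ 2 *\<^sub>R lattice_sum (g (2 # w)) u x)) (at x)"
      by (rule has_derivative_transform_within_open[of _ _ _ _ "ball x 1"])
        (use w loc in \<open>auto simp: dist_commute\<close>)
  next
    fix w :: "2 list" assume w: "length w \<le> r"
    have cont: "continuous_on UNIV (g w)" using g w by (simp add: deriv_family_def)
    show "continuous_on UNIV (lattice_sum (g w) u)"
      unfolding continuous_on_eq_continuous_at[OF open_UNIV]
    proof
      fix x
      have "continuous_on UNIV (\<lambda>y. g w (y - lattice_point k))" for k
        by (rule continuous_on_compose2[OF cont]) (auto intro!: continuous_intros)
      then have "continuous_on UNIV (\<lambda>y. \<Sum>k\<in>F x. u k * g w (y - lattice_point k))"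
        by (intro continuous_intros)
      then have "isCont (\<lambda>y. \<Sum>k\<in>F x. u k * g w (y - lattice_point k)) x"
        by (simp add: continuous_on_eq_continuous_at)
      moreover have "\<forall>\<^sub>F y in nhds x. lattice_sum (g w) u y = (\<Sum>k\<in>F x. u k * g w (y - lattice_point k))"
        unfolding eventually_nhds
        by (rule exI[of _ "ball x 1"]) (use w loc in \<open>auto simp: dist_commute\<close>)
      ultimately show "isCont (lattice_sum (g w) u) x"
        using isCont_cong[of "lattice_sum (g w) u" "\<lambda>y. \<Sum>k\<in>F x. u k * g w (y - lattice_point k)" x] by simp
    qed
  qed
qed

lemma lattice_sum_C_space:
  fixes g :: "2 list \<Rightarrow> real ^ 2 \<Rightarrow> real"
  assumes g: "deriv_family r g" and supp: "\<And>w x. length w \<le> r \<Longrightarrow> R < norm x \<Longrightarrow> g w x = 0"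
    and u: "bounded (range u)"
  shows "lattice_sum (g []) u \<in> C_space r"
proof (rule deriv_family_C_space[OF deriv_family_lattice_sum[OF g supp]])
  fix w :: "2 list" assume w: "length w \<le> r"
  have "bounded (range (g w))"
    using g w supp by (intro bounded_range_of_support) (auto simp: deriv_family_def)
  moreover have "bounded_support (g w)" using supp w by (auto simp: bounded_support_def)
  ultimately obtain N where N: "\<And>u C x. (\<forall>k. \<bar>u k\<bar> \<le> C) \<Longrightarrow> \<bar>lattice_sum (g w) u x\<bar> \<le> N * C"
    using lattice_sum_bound by blast
  obtain C where "\<forall>k. \<bar>u k\<bar> \<le> C" using u by (auto simp: bounded_iff)
  from N[OF this] show "bounded (range (lattice_sum (g w) u))" by (auto simp: bounded_iff)
qed

lemma mixed_derivative_zero: "mixed_derivative a b (\<lambda>_. 0 :: real) = (\<lambda>_. 0)"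
proof -
  have "partial_derivative i (\<lambda>_. 0 :: real) = (\<lambda>_. 0)" for i
    by (simp add: fun_eq_iff partial_derivative_def)
  then have "(partial_derivative i ^^ k) (\<lambda>_. 0 :: real) = (\<lambda>_. 0)" for i k
    by (induction k) simp_all
  then show ?thesis by (simp add: mixed_derivative_def)
qed

lemma C_norm_zero: "C_norm r (\<lambda>_. 0) = 0"
proof -
  have "(\<lambda>(a, b). SUP x. \<bar>mixed_derivative a b (\<lambda>_. 0 :: real) x\<bar>) ` {(a, b). a + b \<le> r} = {0 :: real}"
    by (auto simp: mixed_derivative_zero image_iff intro!: exI[of _ 0])
  then show ?thesis unfolding C_norm_def by simp
qed

text \<open>The initial function is the normalised spline itself: by its refinement equation the
  iterates of the algorithm do not depend on \<open>q\<close> at all.\<close>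

lemma spline_subdivision_converges:
  fixes g :: "2 list \<Rightarrow> real ^ 2 \<Rightarrow> real"
  assumes g: "deriv_family (Suc n) g" "g [] = spline (Suc n)"
    and supp: "\<And>w x. length w \<le> Suc n \<Longrightarrow> R < norm x \<Longrightarrow> g w x = 0"
  shows "subdivision_converges (Suc n) (subdivision_operator (bspline_mask (Suc n)))"
proof -
  let ?S = "subdivision_operator (bspline_mask (Suc n))"
  \<comment> \<open>The integral of the spline: its Fourier transform at 0 is a product of n + 2
    factors, each the measure of the tile.\<close>
  define c where "c = measure lborel bear_tile ^ Suc (Suc n)"
  define G where "G w x = g w x / c" for w x
  have "0 < c" unfolding c_def using measure_bear_tile_pos by simp
  have G: "deriv_family (Suc n) G" unfolding G_def using g(1) by (rule deriv_family_scale)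
  have G0: "G [] = (\<lambda>x. spline (Suc n) x / c)" by (simp only: G_def[abs_def] g(2))
  have Gsupp: "\<And>w x. length w \<le> Suc n \<Longrightarrow> R < norm x \<Longrightarrow> G w x = 0" using supp by (simp add: G_def)
  have bounded_support: "bounded_support (G [])" using Gsupp[of "[]"] by (auto simp: bounded_support_def)
  have mult: "(\<lambda>y. bear_matrix *v y) ^^ q = (bear ^^ q :: real ^ 2 \<Rightarrow> real ^ 2)" for q
    by (rule arg_cong[where f = "\<lambda>f. f ^^ q"]) (simp add: fun_eq_iff bear_matrix_mult)
  have scale: "lattice_sum (G []) u x = lattice_sum (spline (Suc n)) u x / c" for u x
    unfolding lattice_sum_eq_support[OF bounded_support_spline] G0 sum_divide_distrib
    by (subst lattice_sum_eq_sum[OF finite_lattice_support[OF bounded_support_spline[of "Suc n"], of x]])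
      (auto simp del: tile_bspline.simps)
  have const: "(\<Sum>\<^sub>\<infinity>k. shift_term (G []) ((?S ^^ q) u) q x k) = lattice_sum (G []) u x" for q u x
  proof -
    have "(\<Sum>\<^sub>\<infinity>k. shift_term (G []) ((?S ^^ q) u) q x k) = lattice_sum (G []) ((?S ^^ q) u) ((bear ^^ q) x)"
      by (simp add: shift_term_def lattice_sum_def mult)
    then show ?thesis unfolding scale lattice_sum_subdivide_iter[of n u x q] .
  qed
  have "G [] \<in> Q_space (Suc n)"
    unfolding Q_space_def
  proof (intro CollectI conjI allI impI)
    have "bounded (range (G w))" if "length w \<le> Suc n" for w
      by (rule bounded_range_of_support[of _ R]) (use G Gsupp that in \<open>auto simp: deriv_family_def\<close>)
    then show "G [] \<in> C_space (Suc n)" by (rule deriv_family_C_space[OF G])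
    show "integrable lborel (G [])"
      unfolding G0 by (intro integrable_divide tame_integrable tame_spline)
    have "fourier_transform (G []) 0 = fourier_transform (spline (Suc n)) 0 / c"
      unfolding fourier_transform_def G0 by simp
    also have "\<dots> = 1"
      unfolding fourier_transform_spline tile_fourier_0 using measure_bear_tile_pos by (simp add: c_def)
    finally show "fourier_transform (G []) 0 = 1" .
    show "zero_of_order_gt (Suc n) (fourier_transform (G [])) (lattice_point k)" if "k \<noteq> 0" for k
      unfolding G0 using that by (rule spline_fourier_zero_order)
  qed
  moreover have "\<exists>f\<in>C_space (Suc n). (\<forall>q x. shift_term (G []) ((?S ^^ q) u) q x summable_on UNIV) \<and>
      (\<forall>q. (\<lambda>x. \<Sum>\<^sub>\<infinity>k. shift_term (G []) ((?S ^^ q) u) q x k) \<in> C_space (Suc n)) \<and>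
      (\<lambda>q. C_norm (Suc n) (\<lambda>x. (\<Sum>\<^sub>\<infinity>k. shift_term (G []) ((?S ^^ q) u) q x k) - f x)) \<longlonglongrightarrow> 0"
    if u: "bounded (range u)" for u
  proof (intro bexI conjI allI)
    show mem: "lattice_sum (G []) u \<in> C_space (Suc n)"
      by (rule lattice_sum_C_space[OF G Gsupp u])
    show "shift_term (G []) ((?S ^^ q) u) q x summable_on UNIV" for q x
      unfolding shift_term_def[abs_def] by (rule lattice_summable[OF bounded_support])
    show "(\<lambda>x. \<Sum>\<^sub>\<infinity>k. shift_term (G []) ((?S ^^ q) u) q x k) \<in> C_space (Suc n)" for q
      unfolding const by (rule mem)
    show "(\<lambda>q. C_norm (Suc n) (\<lambda>x. (\<Sum>\<^sub>\<infinity>k. shift_term (G []) ((?S ^^ q) u) q x k) - lattice_sum (G []) u x)) \<longlonglongrightarrow> 0"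
      unfolding const by (simp add: C_norm_zero)
  qed
  ultimately show ?thesis unfolding subdivision_converges_def by blast
qed

theorem theorem7:
  shows "(refinement_equation (bspline_mask 2) bear_3 \<and>
          subdivision_converges 2 (subdivision_operator (bspline_mask 2))) \<and>
         (refinement_equation (bspline_mask 3) bear_4 \<and>
          subdivision_converges 3 (subdivision_operator (bspline_mask 3)))"
proof -
  have n: "2 = Suc 1" "3 = Suc 2" by simp_all
  have "refinement_equation (bspline_mask 2) bear_3"
    unfolding bear_3_def n by (rule refinement_equation_spline)
  moreover have "refinement_equation (bspline_mask 3) bear_4"
    unfolding bear_4_def n(2) by (rule refinement_equation_spline)
  moreover have "subdivision_converges 2 (subdivision_operator (bspline_mask 2))"
    using quadratic_spline_smooth spline_subdivision_converges unfolding n by blast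
  moreover have "subdivision_converges 3 (subdivision_operator (bspline_mask 3))"
    using cubic_spline_smooth spline_subdivision_converges unfolding n(2) by blast
  ultimately show ?thesis by blast
qed

end
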